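(* Let $\Delta\subset\mathbb R^n$ be an absolutely simple lattice polytope with non-empty interior, and let $X(\Sigma)$ be the associated non-singular projective toric variety with its associated ample equivariant line bundle $E$. There exists a unique continuous volume form on $X(\Sigma)$, denoted $\omega_{E,\infty}^n$, such that $$(\omega_{E,\infty}^n)|_{\mathrm{int}(C_\sigma)}=\varphi_\sigma^*(\mu_0)\qquad\text{for all }\sigma\in\Sigma_{\max},$$ where $\mu_0$ is the standard volume form on $\mathbb C^n$ and $\mathrm{int}$ denotes the interior. In particular, if $\Delta=\Delta_n$ is the standard polytope of $\mathbb R^n$, so that $X(\Sigma)=\mathbb P^n$, then this form, denoted $\omega_\infty^n$, satisfies $$(\omega_\infty^n)|_{\{x_0\ne0\}}=\Big(\frac{i}{2\pi}\Big)^n\frac{\prod_{j=1}^n dz_j\wedge d\bar z_j}{\big(\max(1,|z_1|,\dots,|z_n|)\big)^{2(n+1)}},\qquad z_j=\frac{x_j}{x_0},\ j=1,\dots,n .$$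
   Context: A lattice polytope $\Delta\subset M_{\mathbb R}=\mathbb R^n$, $M=\mathbb Z^n$, is absolutely simple if at each vertex the primitive edge vectors form a $\mathbb Z$-basis of $M$. It determines a complete fan $\Sigma$ (its normal fan) in $N_{\mathbb R}$, $N=M^\vee$, and a unique ample horizontal torus-invariant Cartier divisor $E$ on $X(\Sigma)$ with polytope $\Delta_E=\Delta$; $X(\Sigma)$ is then non-singular. $\Sigma_{\max}$ is the set of maximal cones of $\Sigma$. For $\sigma\in\Sigma$, $\check\sigma$ is the dual cone, $\mathcal S_\sigma=\check\sigma\cap M$, $U_\sigma$ the corresponding affine open set, and $\chi^m$ the character (rational function) attached to $m\in M$. Define the compact set $$C_\sigma=\{x\in X(\Sigma):\ \forall m\in\mathcal S_\sigma,\ \chi^m\text{ is regular at }x\text{ and }|\chi^m(x)|\le1\}\subset U_\sigma .$$ For $\sigma\in\Sigma_{\max}$, $\varphi_\sigma:U_\sigma\to\mathbb C^n$ is the map $x\mapsto(\chi^{m_1}(x),\dots,\chi^{m_n}(x))$ where $\{m_1,\dots,m_n\}$ is the minimal generating family of the semigroup $\mathcal S_\sigma$ (a basis of $M$). The standard volume form is $\mu_0=(\frac{i}{2\pi})^n\prod_{k=1}^n dy_k\wedge d\bar y_k$ in the coordinates $y_1,\dots,y_n$ of $\mathbb C^n$. $\Delta_n=\{x\in\mathbb R^n:x_j\ge0,\ \sum_jx_j\le1\}$, and $x_0,\dots,x_n$ are the standard homogeneous coordinates of $\mathbb P^n$. *)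

theory Defs
  imports "HOL-Analysis.Analysis" "HOL-Library.Poly_Mapping"
begin

text \<open>
  The lattice \<open>M\<close> is the type \<open>int ^ 'n\<close>, the spaces \<open>M\<^sub>\<real>\<close> and \<open>N\<^sub>\<real>\<close> are both \<open>real ^ 'n\<close>, and the
  pairing between them is the inner product.
\<close>

definition emb :: "int ^ 'n \<Rightarrow> real ^ 'n" where
  "emb m = (\<chi> i. of_int (m $ i))"

definition lattice_polytope :: "(real ^ 'n::finite) set \<Rightarrow> bool" where
  "lattice_polytope P \<longleftrightarrow> (\<exists>V. finite V \<and> P = convex hull (emb ` V))"

definition primitive :: "int ^ 'n::finite \<Rightarrow> bool" where
  "primitive u \<longleftrightarrow> Gcd (range (\<lambda>i. u $ i)) = 1"

definition primitive_edge_vectors :: "(real ^ 'n::finite) set \<Rightarrow> real ^ 'n \<Rightarrow> (int ^ 'n) set" where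
  "primitive_edge_vectors P v =
     {u. primitive u \<and> (\<exists>e. e edge_of P \<and> v \<in> e \<and> (\<exists>t>0. v + t *\<^sub>R emb u \<in> e))}"

definition Z_basis :: "(int ^ 'n::finite) set \<Rightarrow> bool" where
  "Z_basis B \<longleftrightarrow> finite B \<and>
     (\<forall>m. \<exists>!c :: int ^ 'n \<Rightarrow> int. (\<forall>b. b \<notin> B \<longrightarrow> c b = 0) \<and> m = (\<Sum>b\<in>B. c b *s b))"

definition absolutely_simple :: "(real ^ 'n::finite) set \<Rightarrow> bool" where
  "absolutely_simple P \<longleftrightarrow>
     (\<forall>v. v extreme_point_of P \<longrightarrow> Z_basis (primitive_edge_vectors P v))"

definition std_simplex :: "(real ^ 'n::finite) set" where
  "std_simplex = {x. (\<forall>j. 0 \<le> x $ j) \<and> (\<Sum>j\<in>UNIV. x $ j) \<le> 1}"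

text \<open>
  Inner normals are used: the dual of the cone of a vertex \<open>v\<close> is the cone spanned by \<open>P - v\<close>.
\<close>

definition normal_cone :: "(real ^ 'n::finite) set \<Rightarrow> (real ^ 'n) set \<Rightarrow> (real ^ 'n) set" where
  "normal_cone P F = {u. \<forall>m\<in>P. \<forall>m'\<in>F. 0 \<le> (m - m') \<bullet> u}"

definition normal_fan :: "(real ^ 'n::finite) set \<Rightarrow> (real ^ 'n) set set" where
  "normal_fan P = {normal_cone P F | F. F face_of P \<and> F \<noteq> {}}"

definition max_cones :: "(real ^ 'n::finite) set set \<Rightarrow> (real ^ 'n) set set" where
  "max_cones \<Sigma> = {\<sigma> \<in> \<Sigma>. \<forall>\<tau>\<in>\<Sigma>. \<sigma> \<subseteq> \<tau> \<longrightarrow> \<tau> = \<sigma>}"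

definition dual_cone :: "(real ^ 'n::finite) set \<Rightarrow> (real ^ 'n) set" where
  "dual_cone \<sigma> = {m. \<forall>u\<in>\<sigma>. 0 \<le> m \<bullet> u}"

definition cone_monoid :: "(real ^ 'n::finite) set \<Rightarrow> (int ^ 'n) set" where
  "cone_monoid \<sigma> = {m. emb m \<in> dual_cone \<sigma>}"

definition add_submonoid :: "'a::comm_monoid_add set \<Rightarrow> bool" where
  "add_submonoid T \<longleftrightarrow> 0 \<in> T \<and> (\<forall>a\<in>T. \<forall>b\<in>T. a + b \<in> T)"

definition minimal_generating :: "'a::comm_monoid_add set \<Rightarrow> 'a set \<Rightarrow> bool" where
  "minimal_generating G S \<longleftrightarrow>
     add_submonoid hull G = S \<and> (\<forall>G'. G' \<subset> G \<longrightarrow> add_submonoid hull G' \<noteq> S)"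

text \<open>
  The complex points of \<open>U\<^sub>\<sigma> = Spec \<complex>[S\<^sub>\<sigma>]\<close> are the monoid homomorphisms from \<open>S\<^sub>\<sigma>\<close> to \<open>(\<complex>, \<cdot>)\<close>.
  The variety is obtained by gluing \<open>U\<^sub>\<sigma>\<close> and \<open>U\<^sub>\<tau>\<close> along \<open>U\<^bsub>\<sigma> \<inter> \<tau>\<^esub>\<close>; a point of it is an
  equivalence class of pairs of a cone \<open>\<sigma>\<close> and a point of \<open>U\<^sub>\<sigma>\<close>.
\<close>

type_synonym 'n toric_point = "((real ^ 'n) set \<times> (int ^ 'n \<Rightarrow> complex)) set"

definition affine_points :: "(real ^ 'n::finite) set \<Rightarrow> (int ^ 'n \<Rightarrow> complex) set" where
  "affine_points \<sigma> =
     {y \<in> extensional (cone_monoid \<sigma>). y 0 = 1 \<and>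
        (\<forall>m\<in>cone_monoid \<sigma>. \<forall>m'\<in>cone_monoid \<sigma>. y (m + m') = y m * y m')}"

definition glue_rel :: "(real ^ 'n::finite) set set \<Rightarrow>
    (((real ^ 'n) set \<times> (int ^ 'n \<Rightarrow> complex)) \<times> ((real ^ 'n) set \<times> (int ^ 'n \<Rightarrow> complex))) set" where
  "glue_rel \<Sigma> =
     {((\<sigma>, y), (\<tau>, y')). \<sigma> \<in> \<Sigma> \<and> \<tau> \<in> \<Sigma> \<and> y \<in> affine_points \<sigma> \<and> y' \<in> affine_points \<tau> \<and>
        (\<exists>z\<in>affine_points (\<sigma> \<inter> \<tau>).
           y = restrict z (cone_monoid \<sigma>) \<and> y' = restrict z (cone_monoid \<tau>))}"

definition toric_variety :: "(real ^ 'n::finite) set set \<Rightarrow> 'n toric_point set" where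
  "toric_variety \<Sigma> = (SIGMA \<sigma>:\<Sigma>. affine_points \<sigma>) // glue_rel \<Sigma>"

definition affine_open :: "(real ^ 'n::finite) set set \<Rightarrow> (real ^ 'n) set \<Rightarrow> 'n toric_point set" where
  "affine_open \<Sigma> \<sigma> = {x \<in> toric_variety \<Sigma>. \<exists>y. (\<sigma>, y) \<in> x}"

text \<open>
  The classical topology: the quotient topology, where \<open>affine_points \<sigma>\<close> carries the topology of
  pointwise convergence (equivalently, that of \<open>\<complex>\<^sup>r\<close> for any \<open>r\<close> generators of \<open>S\<^sub>\<sigma>\<close>).
\<close>

definition toric_topology :: "(real ^ 'n::finite) set set \<Rightarrow> 'n toric_point topology" where
  "toric_topology \<Sigma> = topology (\<lambda>W. W \<subseteq> toric_variety \<Sigma> \<and>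
     (\<forall>\<sigma>\<in>\<Sigma>. openin (top_of_set (affine_points \<sigma>))
        {y \<in> affine_points \<sigma>. glue_rel \<Sigma> `` {(\<sigma>, y)} \<in> W}))"

lemma openin_toric_topology:
  "openin (toric_topology \<Sigma>) W \<longleftrightarrow> W \<subseteq> toric_variety \<Sigma> \<and>
     (\<forall>\<sigma>\<in>\<Sigma>. openin (top_of_set (affine_points \<sigma>))
        {y \<in> affine_points \<sigma>. glue_rel \<Sigma> `` {(\<sigma>, y)} \<in> W})"
proof -
  let ?pre = "\<lambda>\<sigma> W. {y \<in> affine_points \<sigma>. glue_rel \<Sigma> `` {(\<sigma>, y)} \<in> W}"
  have int: "?pre \<sigma> (S \<inter> T) = ?pre \<sigma> S \<inter> ?pre \<sigma> T" for \<sigma> S T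
    by blast
  have un: "?pre \<sigma> (\<Union>\<K>) = (\<Union>K\<in>\<K>. ?pre \<sigma> K)" for \<sigma> \<K>
    by blast
  have "istopology (\<lambda>W. W \<subseteq> toric_variety \<Sigma> \<and>
     (\<forall>\<sigma>\<in>\<Sigma>. openin (top_of_set (affine_points \<sigma>)) (?pre \<sigma> W)))"
    unfolding istopology_def int un by (blast intro: openin_Int openin_Union)
  then show ?thesis
    unfolding toric_topology_def by (simp add: topology_inverse')
qed

text \<open>
  \<open>int ^ 'n \<Rightarrow>\<^sub>0 complex\<close> is the group algebra \<open>\<complex>[M]\<close>, in which \<open>\<chi>\<^sup>m\<close> is \<open>Poly_Mapping.single m 1\<close>.
  Regularity at \<open>x \<in> U\<^sub>\<sigma>\<close> means membership in the local ring, the localisation of \<open>\<complex>[S\<^sub>\<sigma>]\<close> at the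
  maximal ideal of \<open>x\<close>.
\<close>

definition eval_at :: "(int ^ 'n \<Rightarrow> complex) \<Rightarrow> (int ^ 'n \<Rightarrow>\<^sub>0 complex) \<Rightarrow> complex" where
  "eval_at y f = (\<Sum>m\<in>Poly_Mapping.keys f. Poly_Mapping.lookup f m * y m)"

definition has_value_at ::
    "(real ^ 'n::finite) set set \<Rightarrow> int ^ 'n \<Rightarrow> 'n toric_point \<Rightarrow> complex \<Rightarrow> bool" where
  "has_value_at \<Sigma> m x a \<longleftrightarrow> (\<exists>\<sigma>\<in>\<Sigma>. \<exists>y f g. (\<sigma>, y) \<in> x \<and>
     Poly_Mapping.keys f \<subseteq> cone_monoid \<sigma> \<and> Poly_Mapping.keys g \<subseteq> cone_monoid \<sigma> \<and>
     eval_at y g \<noteq> 0 \<and> Poly_Mapping.single m 1 * g = f \<and> a = eval_at y f / eval_at y g)"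

definition regular_at :: "(real ^ 'n::finite) set set \<Rightarrow> int ^ 'n \<Rightarrow> 'n toric_point \<Rightarrow> bool" where
  "regular_at \<Sigma> m x \<longleftrightarrow> (\<exists>a. has_value_at \<Sigma> m x a)"

definition character :: "(real ^ 'n::finite) set set \<Rightarrow> int ^ 'n \<Rightarrow> 'n toric_point \<Rightarrow> complex" where
  "character \<Sigma> m x = (THE a. has_value_at \<Sigma> m x a)"

definition C_set :: "(real ^ 'n::finite) set set \<Rightarrow> (real ^ 'n) set \<Rightarrow> 'n toric_point set" where
  "C_set \<Sigma> \<sigma> = {x \<in> toric_variety \<Sigma>.
     \<forall>m\<in>cone_monoid \<sigma>. regular_at \<Sigma> m x \<and> cmod (character \<Sigma> m x) \<le> 1}"

text \<open>
  A chart is a maximal cone together with an enumeration by \<open>'n\<close> of the minimal generating family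
  of its monoid.
\<close>

type_synonym 'n chart = "(real ^ 'n) set \<times> ('n \<Rightarrow> int ^ 'n)"

definition charts :: "(real ^ 'n::finite) set set \<Rightarrow> 'n chart set" where
  "charts \<Sigma> =
     {(\<sigma>, b). \<sigma> \<in> max_cones \<Sigma> \<and> inj b \<and> minimal_generating (range b) (cone_monoid \<sigma>)}"

definition chart_dom :: "(real ^ 'n::finite) set set \<Rightarrow> 'n chart \<Rightarrow> 'n toric_point set" where
  "chart_dom \<Sigma> c = affine_open \<Sigma> (fst c)"

definition chart_map :: "(real ^ 'n::finite) set set \<Rightarrow> 'n chart \<Rightarrow> 'n toric_point \<Rightarrow> complex ^ 'n" where
  "chart_map \<Sigma> c x = (\<chi> k. character \<Sigma> (snd c k) x)"

definition chart_inv :: "(real ^ 'n::finite) set set \<Rightarrow> 'n chart \<Rightarrow> complex ^ 'n \<Rightarrow> 'n toric_point" where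
  "chart_inv \<Sigma> c = inv_into (chart_dom \<Sigma> c) (chart_map \<Sigma> c)"

text \<open>
  A form of degree \<open>2n\<close> at a point of \<open>\<complex>\<^sup>n\<close> takes \<open>2n\<close> tangent vectors, indexed by \<open>'n \<times> bool\<close> and
  understood in the order \<open>(1, False), (1, True), \<dots>, (n, False), (n, True)\<close>. Reordering \<open>'n\<close> is an
  even permutation of these indices, so that no order on \<open>'n\<close> has to be chosen.
\<close>

type_synonym 'n top_covector = "('n \<times> bool \<Rightarrow> complex ^ 'n) \<Rightarrow> complex"

definition alternating_multilinear :: "'n::finite top_covector \<Rightarrow> bool" where
  "alternating_multilinear \<alpha> \<longleftrightarrow>
     (\<forall>v s. linear (\<lambda>w. \<alpha> (v(s := w)))) \<and> (\<forall>v s t. s \<noteq> t \<and> v s = v t \<longrightarrow> \<alpha> v = 0)"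

definition wedge :: "('n \<times> bool \<Rightarrow> complex ^ 'n \<Rightarrow> complex) \<Rightarrow> 'n::finite top_covector" where
  "wedge \<alpha> v = det (\<chi> r s. \<alpha> r (v s))"

definition dcoord :: "'n \<times> bool \<Rightarrow> complex ^ 'n::finite \<Rightarrow> complex" where
  "dcoord r w = (if snd r then cnj (w $ fst r) else w $ fst r)"

definition mu0 :: "complex ^ 'n::finite \<Rightarrow> 'n top_covector" where
  "mu0 z v = (\<i> / (2 * complex_of_real pi)) ^ CARD('n) * wedge dcoord v"

text \<open>
  A form on an open subset of the variety is given by its local expressions: \<open>\<omega> c x\<close> is the
  expression of the form at \<open>x\<close> in the coordinates of the chart \<open>c\<close>. Local expressions are
  \<open>undefined\<close> outside their domain, so that equality of forms is equality in HOL.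
\<close>

type_synonym 'n form = "'n chart \<Rightarrow> 'n toric_point \<Rightarrow> 'n top_covector"

definition restrict_form ::
    "(real ^ 'n::finite) set set \<Rightarrow> 'n toric_point set \<Rightarrow> 'n form \<Rightarrow> 'n form" where
  "restrict_form \<Sigma> W \<omega> =
     (\<lambda>c x. if c \<in> charts \<Sigma> \<and> x \<in> W \<inter> chart_dom \<Sigma> c then \<omega> c x else undefined)"

definition pullback_form ::
    "(real ^ 'n::finite) set set \<Rightarrow> 'n toric_point set \<Rightarrow> ('n toric_point \<Rightarrow> complex ^ 'n)
      \<Rightarrow> (complex ^ 'n \<Rightarrow> 'n top_covector) \<Rightarrow> 'n form" where
  "pullback_form \<Sigma> W f \<alpha> = restrict_form \<Sigma> W
     (\<lambda>c x v. \<alpha> (f x) (\<lambda>s. frechet_derivative (f \<circ> chart_inv \<Sigma> c) (at (chart_map \<Sigma> c x)) (v s)))"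

definition top_form :: "(real ^ 'n::finite) set set \<Rightarrow> 'n form \<Rightarrow> bool" where
  "top_form \<Sigma> \<omega> \<longleftrightarrow>
     restrict_form \<Sigma> (toric_variety \<Sigma>) \<omega> = \<omega> \<and>
     (\<forall>c\<in>charts \<Sigma>. \<forall>x\<in>chart_dom \<Sigma> c. alternating_multilinear (\<omega> c x)) \<and>
     (\<forall>c\<in>charts \<Sigma>. \<forall>c'\<in>charts \<Sigma>. \<forall>x\<in>chart_dom \<Sigma> c \<inter> chart_dom \<Sigma> c'. \<forall>v.
        \<omega> c x v = \<omega> c' x (\<lambda>s. frechet_derivative (chart_map \<Sigma> c' \<circ> chart_inv \<Sigma> c)
                                 (at (chart_map \<Sigma> c x)) (v s)))"

definition continuous_volume_form :: "(real ^ 'n::finite) set set \<Rightarrow> 'n form \<Rightarrow> bool" where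
  "continuous_volume_form \<Sigma> \<omega> \<longleftrightarrow>
     top_form \<Sigma> \<omega> \<and>
     (\<forall>c\<in>charts \<Sigma>. \<forall>v. continuous_map
        (subtopology (toric_topology \<Sigma>) (chart_dom \<Sigma> c)) euclidean (\<lambda>x. \<omega> c x v)) \<and>
     (\<forall>c\<in>charts \<Sigma>. \<forall>x\<in>chart_dom \<Sigma> c. (\<forall>v. \<omega> c x v \<in> \<real>) \<and> (\<exists>v. \<omega> c x v \<noteq> 0))"

text \<open>
  The divisor \<open>E\<close> in \<open>\<omega>\<^bsub>E,\<infinity>\<^esub>\<^sup>n\<close> is determined by \<open>P\<close> (its support function is
  \<open>u \<mapsto> min\<^bsub>m\<in>P\<^esub> \<langle>m, u\<rangle>\<close>) and the form depends on it only through the normal fan of \<open>P\<close>.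
\<close>

definition is_omega_infty :: "(real ^ 'n::finite) set \<Rightarrow> 'n form \<Rightarrow> bool" where
  "is_omega_infty P \<omega> \<longleftrightarrow> (let \<Sigma> = normal_fan P in
     continuous_volume_form \<Sigma> \<omega> \<and>
     (\<forall>(\<sigma>, b)\<in>charts \<Sigma>. let W = toric_topology \<Sigma> interior_of C_set \<Sigma> \<sigma> in
        restrict_form \<Sigma> W \<omega> = pullback_form \<Sigma> W (chart_map \<Sigma> (\<sigma>, b)) mu0))"

definition omega_infty :: "(real ^ 'n::finite) set \<Rightarrow> 'n form" where
  "omega_infty P = (THE \<omega>. is_omega_infty P \<omega>)"

text \<open>
  A point of projective space is a class of nonzero vectors up to scaling. The index set of the
  homogeneous coordinates is \<open>'n option\<close>, with \<open>None\<close> for \<open>x\<^sub>0\<close> and \<open>Some j\<close> for \<open>x\<^sub>j\<close>.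
\<close>

definition projective_space :: "(complex ^ ('n::finite option)) set set" where
  "projective_space = {{a *s w | a. a \<noteq> 0} | w. w \<noteq> 0}"

definition nonzero_x0 :: "(complex ^ ('n::finite option)) set set" where
  "nonzero_x0 = {L \<in> projective_space. \<forall>w\<in>L. w $ None \<noteq> 0}"

definition affine_coords :: "(complex ^ ('n::finite option)) set \<Rightarrow> complex ^ 'n" where
  "affine_coords L = (let w = (SOME w. w \<in> L) in (\<chi> j. w $ Some j / w $ None))"

definition simplex_vertex :: "'n::finite option \<Rightarrow> int ^ 'n" where
  "simplex_vertex k = (case k of None \<Rightarrow> 0 | Some j \<Rightarrow> axis j 1)"

text \<open>
  The identification of the variety of the standard simplex with projective space. The homogeneous
  coordinates are the sections \<open>\<chi>\<^sup>m\<close>, where \<open>m\<close> runs over the vertices of the simplex; on the affine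
  open set of the vertex \<open>m\<^sub>k\<close>, these sections are trivialised by dividing by \<open>\<chi>\<^sup>m\<close> for \<open>m = m\<^sub>k\<close>.
\<close>

definition to_projective :: "'n::finite toric_point \<Rightarrow> (complex ^ ('n option)) set" where
  "to_projective x = {w. \<exists>k a. a \<noteq> 0 \<and>
     x \<in> affine_open (normal_fan std_simplex) (normal_cone std_simplex {emb (simplex_vertex k)}) \<and>
     w = (\<chi> j. a * character (normal_fan std_simplex) (simplex_vertex j - simplex_vertex k) x)}"

definition projective_density :: "complex ^ 'n::finite \<Rightarrow> 'n top_covector" where
  "projective_density z v = (\<i> / (2 * complex_of_real pi)) ^ CARD('n) * wedge dcoord v /
     complex_of_real (Max (insert 1 (range (\<lambda>j. cmod (z $ j)))) ^ (2 * (CARD('n) + 1)))"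

end

theory Submission
  imports Defs
begin

text \<open>
  Vertices of the polytope correspond to charts of the variety: the monoid of a vertex \<open>v\<close> is freely
  generated by the primitive edge vectors at \<open>v\<close>, and every point is given by its coordinates in some chart. The sets \<open>C\<^sub>w\<close> cover the variety, because \<open>C\<^sub>w\<close> consists of the points at which the section
  \<open>\<chi>\<^sup>w\<close> of \<open>E\<close> is maximal in absolute value among those of the vertices. The coordinate change from \<open>v\<close>
  to \<open>w\<close> is monomial with a unimodular exponent matrix, so that it multiplies \<open>\<mu>\<^sub>0\<close> by the squared absolute
  value of the character \<open>\<chi>\<^sup>q\<close>, where \<open>q\<close> is the difference of the sums of the two bases. On
  \<open>C\<^sub>v \<inter> C\<^sub>w\<close> this factor is \<open>1\<close>, hence the forms \<open>\<phi>\<^sub>w\<^sup>*\<mu>\<^sub>0\<close> on the closed sets \<open>C\<^sub>w\<close> glue to a continuous form. It is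
  unique because the interiors of the \<open>C\<^sub>w\<close> are dense. For the simplex, \<open>q = - (n + 1) w\<close> relative to the
  vertex \<open>0\<close>.
\<close>

section \<open>Lattice bases and monomials\<close>

text \<open>The obstacle is the boundary of the torus. At a vanishing coordinate
  \<open>0 powi (-1) = 0\<close>, so \<open>monomial\<close> is multiplicative only for exponents
  without a pole at the point, and every product of characters needs a proof of regularity. This
  shapes the set-up: points are written in vertex charts only, and cones are indexed by sets of
  vertices, so that the chart at v meets the chart at w exactly where the one character with
  exponent w - v is nonzero. The exponent q comes from logarithmic differentials: the wedge of the
  dy_k / y_k changes only by a sign under a unimodular monomial map, so the Jacobian determinant is
  the character of q up to sign. That computation is valid on the torus; that this character has
  neither zero nor pole on the whole overlap is a separate combinatorial fact about the two bases,
  and the determinant formula then extends by continuity.\<close>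

definition lattice_basis :: "('n \<Rightarrow> int ^ 'n::finite) \<Rightarrow> bool" where
  "lattice_basis b \<longleftrightarrow> (\<forall>m. \<exists>!c :: int ^ 'n. m = (\<Sum>k\<in>UNIV. c $ k *s b k))"

definition lcoord :: "('n \<Rightarrow> int ^ 'n::finite) \<Rightarrow> int ^ 'n \<Rightarrow> int ^ 'n" where
  "lcoord b m = (THE c. m = (\<Sum>k\<in>UNIV. c $ k *s b k))"

lemma lcoord_expansion:
  assumes "lattice_basis b"
  shows "(\<Sum>k\<in>UNIV. lcoord b m $ k *s b k) = m"
proof -
  have "\<exists>!c :: int ^ 'a. m = (\<Sum>k\<in>UNIV. c $ k *s b k)"
    using assms unfolding lattice_basis_def by blast
  from theI'[OF this] show ?thesis unfolding lcoord_def by simp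
qed

lemma lcoord_unique:
  assumes "lattice_basis b" and "m = (\<Sum>k\<in>UNIV. c $ k *s b k)"
  shows "lcoord b m = c"
proof -
  have "\<exists>!c :: int ^ 'a. m = (\<Sum>k\<in>UNIV. c $ k *s b k)"
    using assms unfolding lattice_basis_def by blast
  with assms(2) lcoord_expansion[OF assms(1), of m] show ?thesis by metis
qed

lemma lcoord_add:
  assumes "lattice_basis b"
  shows "lcoord b (m + m') = lcoord b m + lcoord b m'"
  by (rule lcoord_unique[OF assms])
     (simp add: vector_sadd_rdistrib sum.distrib lcoord_expansion[OF assms])

lemma lcoord_smult:
  assumes "lattice_basis b"
  shows "lcoord b (a *s m) = a *s lcoord b m"
proof (rule lcoord_unique[OF assms])
  have "a *s m = a *s (\<Sum>k\<in>UNIV. lcoord b m $ k *s b k)" by (simp only: lcoord_expansion[OF assms])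
  then show "a *s m = (\<Sum>k\<in>UNIV. (a *s lcoord b m) $ k *s b k)"
    by (simp only: vec_eq_iff sum_component vector_smult_component) (simp add: sum_distrib_left mult.assoc)
qed

lemma lcoord_uminus:
  assumes "lattice_basis b"
  shows "lcoord b (- m) = - lcoord b m"
  using lcoord_smult[OF assms, of "-1" m] by (simp only: vector_sneg_minus1[symmetric])

lemma lcoord_diff:
  assumes "lattice_basis b"
  shows "lcoord b (m - m') = lcoord b m - lcoord b m'"
  using lcoord_add[OF assms, of m "- m'"] by (simp add: lcoord_uminus[OF assms])

lemma lcoord_0: "lattice_basis b \<Longrightarrow> lcoord b 0 = 0"
  using lcoord_smult[of b 0 0] by simp

lemma lcoord_sum:
  assumes "lattice_basis b"
  shows "lcoord b (sum f A) = (\<Sum>a\<in>A. lcoord b (f a))"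
  by (induction A rule: infinite_finite_induct) (auto simp: lcoord_0[OF assms] lcoord_add[OF assms])

lemma lcoord_basis:
  assumes "lattice_basis b"
  shows "lcoord b (b j) = axis j 1"
proof (rule lcoord_unique[OF assms])
  have "(\<Sum>k\<in>UNIV. axis j (1::int) $ k *s b k) = (\<Sum>k\<in>UNIV. if k = j then b k else 0)"
    by (rule sum.cong) (auto simp: axis_def)
  then show "b j = (\<Sum>k\<in>UNIV. axis j 1 $ k *s b k)" by simp
qed

lemma lattice_basis_inj:
  assumes "lattice_basis b" shows "inj b"
proof (rule injI)
  fix j k assume "b j = b k"
  then have "axis j (1::int) = axis k 1" using lcoord_basis[OF assms] by metis
  then show "j = k" by (simp add: axis_eq_axis)
qed

section \<open>The lattice inside real space and the dual basis\<close>

lemma emb_add: "emb (m + m') = emb m + emb m'"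
  by (simp add: emb_def vec_eq_iff)
lemma emb_diff: "emb (m - m') = emb m - emb m'"
  by (simp add: emb_def vec_eq_iff)
lemma emb_0: "emb 0 = 0"
  by (simp add: emb_def vec_eq_iff)
lemma emb_smult: "emb (a *s m) = of_int a *\<^sub>R emb m"
  by (simp add: emb_def vec_eq_iff)
lemma emb_sum: "emb (sum f A) = (\<Sum>a\<in>A. emb (f a))"
  by (induction A rule: infinite_finite_induct) (auto simp: emb_0 emb_add)
lemma emb_eq_iff: "emb m = emb m' \<longleftrightarrow> m = m'"
  by (simp add: emb_def vec_eq_iff)
lemma emb_expansion:
  assumes "lattice_basis b"
  shows "emb m = (\<Sum>k\<in>UNIV. of_int (lcoord b m $ k) *\<^sub>R emb (b k))"
  by (subst lcoord_expansion[OF assms, of m, symmetric]) (simp only: emb_sum emb_smult)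

text \<open>The \<open>k\<close>-th member of the dual basis, given by its values on the standard
  basis of the lattice. For a basis attached to a vertex, these vectors span the rays of the normal
  cone.\<close>

definition dual_vec :: "('n \<Rightarrow> int ^ 'n::finite) \<Rightarrow> 'n \<Rightarrow> real ^ 'n" where
  "dual_vec b k = (\<chi> i. of_int (lcoord b (axis i 1) $ k))"

lemma dual_vec:
  assumes "lattice_basis b"
  shows "emb m \<bullet> dual_vec b k = of_int (lcoord b m $ k)"
proof -
  have "m = (\<Sum>i\<in>UNIV. m $ i *s axis i 1)" by (simp add: basis_expansion)
  then have "lcoord b m $ k = (\<Sum>i\<in>UNIV. lcoord b (m $ i *s axis i 1)) $ k"
    by (metis lcoord_sum[OF assms])
  then have "lcoord b m $ k = (\<Sum>i\<in>UNIV. m $ i * lcoord b (axis i 1) $ k)"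
    by (simp add: lcoord_smult[OF assms])
  then show ?thesis by (simp add: inner_vec_def emb_def dual_vec_def)
qed

section \<open>Characters in the coordinates of a basis\<close>

definition monomial :: "('n \<Rightarrow> int ^ 'n::finite) \<Rightarrow> complex ^ 'n \<Rightarrow> int ^ 'n \<Rightarrow> complex" where
  "monomial b y m = (\<Prod>k\<in>UNIV. (y $ k) powi (lcoord b m $ k))"

text \<open>Guards against the convention for \<open>powi\<close> at zero: if
  \<open>y $ k = 0\<close>, the exponents \<open>b k\<close> and \<open>- b k\<close> both have
  monomial 0, although their sum has monomial 1.\<close>

definition regular_exponent :: "('n \<Rightarrow> int ^ 'n::finite) \<Rightarrow> complex ^ 'n \<Rightarrow> int ^ 'n \<Rightarrow> bool" where
  "regular_exponent b y m \<longleftrightarrow> (\<forall>k. y $ k = 0 \<longrightarrow> 0 \<le> lcoord b m $ k)"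

lemma regular_exponent_add:
  "lattice_basis b \<Longrightarrow> regular_exponent b y m \<Longrightarrow> regular_exponent b y m' \<Longrightarrow> regular_exponent b y (m + m')"
  by (simp add: regular_exponent_def lcoord_add)

lemma regular_exponent_0: "lattice_basis b \<Longrightarrow> regular_exponent b y 0"
  by (simp add: regular_exponent_def lcoord_0)

lemma regular_exponent_nonneg: "\<forall>k. 0 \<le> lcoord b m $ k \<Longrightarrow> regular_exponent b y m"
  by (simp add: regular_exponent_def)

lemma powi_add_nonneg:
  "(x::complex) \<noteq> 0 \<or> (0 \<le> i \<and> 0 \<le> j) \<Longrightarrow> x powi (i + j) = x powi i * x powi j"
  by (cases "x = 0") (auto simp: power_int_add power_int_0_left_if)

lemma monomial_add:
  assumes "lattice_basis b" "regular_exponent b y m" "regular_exponent b y m'"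
  shows "monomial b y (m + m') = monomial b y m * monomial b y m'"
proof -
  have "y $ k powi (lcoord b m $ k + lcoord b m' $ k) = y $ k powi (lcoord b m $ k) * y $ k powi (lcoord b m' $ k)" for k
    using assms by (intro powi_add_nonneg) (auto simp: regular_exponent_def)
  then show ?thesis
    by (simp add: monomial_def lcoord_add[OF assms(1)] prod.distrib)
qed

lemma monomial_0: "lattice_basis b \<Longrightarrow> monomial b y 0 = 1"
  by (simp add: monomial_def lcoord_0)

lemma monomial_basis:
  assumes "lattice_basis b" shows "monomial b y (b j) = y $ j"
proof -
  have "monomial b y (b j) = (\<Prod>k\<in>UNIV. if k = j then y $ k else 1)"
    unfolding monomial_def lcoord_basis[OF assms] by (rule prod.cong) (auto simp: axis_def)
  then show ?thesis by simp
qed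

lemma monomial_nonzero_iff:
  "monomial b y m \<noteq> 0 \<longleftrightarrow> (\<forall>k. y $ k = 0 \<longrightarrow> lcoord b m $ k = 0)"
  by (auto simp: monomial_def)

lemma monomial_uminus:
  assumes "lattice_basis b" shows "monomial b y (- m) = inverse (monomial b y m)"
  by (simp add: monomial_def lcoord_uminus[OF assms] power_int_minus prod_inversef[symmetric] o_def)

lemma monomial_smult:
  assumes "lattice_basis b" shows "monomial b y (a *s m) = monomial b y m powi a"
proof -
  have "(\<Prod>k\<in>A. y $ k powi (lcoord b m $ k * a)) = (\<Prod>k\<in>A. y $ k powi lcoord b m $ k) powi a" for A
    by (induction A rule: infinite_finite_induct) (auto simp: power_int_mult power_int_mult_distrib)
  then show ?thesis by (simp add: monomial_def lcoord_smult[OF assms] mult.commute)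
qed

lemma norm_monomial_le_one:
  assumes "\<forall>k. cmod (y $ k) \<le> 1" "\<forall>k. 0 \<le> lcoord b m $ k"
  shows "cmod (monomial b y m) \<le> 1"
  unfolding monomial_def prod_norm[symmetric]
  using assms by (intro prod_le_1) (auto simp: norm_power_int intro: power_int_le_one)

text \<open>\<open>T\<close> is the localisation of the free monoid at the generators with index in \<open>K\<close>.\<close>

lemma multiplicative_eq_monomial:
  fixes f :: "int ^ 'n::finite \<Rightarrow> complex"
  assumes b: "lattice_basis b"
    and T: "\<And>m. m \<in> T \<longleftrightarrow> (\<forall>k. k \<notin> K \<longrightarrow> 0 \<le> lcoord b m $ k)"
    and f0: "f 0 = 1"
    and fm: "\<And>m m'. m \<in> T \<Longrightarrow> m' \<in> T \<Longrightarrow> f (m + m') = f m * f m'"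
    and m: "m \<in> T"
  shows "f m = monomial b (\<chi> k. f (b k)) m" and "\<And>k. k \<in> K \<Longrightarrow> f (b k) \<noteq> 0"
    and "regular_exponent b (\<chi> k. f (b k)) m"
proof -
  have bT: "c *s b k \<in> T" if "k \<in> K \<or> 0 \<le> c" for c k
    using that by (auto simp: T lcoord_smult[OF b] lcoord_basis[OF b] axis_def)
  have nz: "f (b k) \<noteq> 0" if "k \<in> K" for k
  proof
    assume "f (b k) = 0"
    moreover have "1 *s b k + (- 1) *s b k = 0" by (simp add: vec_eq_iff)
    ultimately show False using fm[OF bT[of k 1] bT[of k "-1"]] that f0 by simp
  qed
  then show "\<And>k. k \<in> K \<Longrightarrow> f (b k) \<noteq> 0" .
  have nat: "f (int n *s b k) = f (b k) ^ n" for n k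
  proof (induction n)
    case 0 show ?case by (simp add: f0)
  next
    case (Suc n)
    have "int (Suc n) *s b k = b k + int n *s b k" by (simp add: vector_sadd_rdistrib)
    then show ?case using fm[OF bT[of k 1] bT[of k "int n"]] Suc by simp
  qed
  have int: "f (c *s b k) = f (b k) powi c" if "k \<in> K \<or> 0 \<le> c" for c k
  proof (cases "0 \<le> c")
    case True
    then show ?thesis using nat[of "nat c" k] by (simp add: power_int_nonneg_exp)
  next
    case False
    then have k: "k \<in> K" using that by auto
    have "f (c *s b k) * f ((- c) *s b k) = 1"
      using fm[OF bT[of k c] bT[of k "- c"]] k f0
      by (simp add: vector_sadd_rdistrib[symmetric])
    moreover have "f ((- c) *s b k) = f (b k) powi (- c)"
      using nat[of "nat (- c)" k] False by (simp add: power_int_nonneg_exp)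
    ultimately show ?thesis using nz[OF k]
      by (simp add: power_int_minus field_simps)
  qed
  have cond: "k \<in> K \<or> 0 \<le> lcoord b m $ k" for k using m T by auto
  have sT: "(\<Sum>k\<in>F. lcoord b m $ k *s b k) \<in> T" for F
    unfolding T
  proof (intro allI impI)
    fix j assume "j \<notin> K"
    then show "0 \<le> lcoord b (\<Sum>k\<in>F. lcoord b m $ k *s b k) $ j"
      using cond[of j]
      by (auto simp: lcoord_sum[OF b] lcoord_smult[OF b] lcoord_basis[OF b] axis_def intro!: sum_nonneg)
  qed
  have "f (\<Sum>k\<in>F. lcoord b m $ k *s b k) = (\<Prod>k\<in>F. f (b k) powi (lcoord b m $ k))" if "finite F" for F
    using that
  proof induction
    case empty show ?case by (simp add: f0)
  next
    case (insert k F)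
    then show ?case using fm[OF bT[OF cond[of k]] sT[of F]] int[OF cond[of k]] by simp
  qed
  from this[of UNIV] show "f m = monomial b (\<chi> k. f (b k)) m"
    by (simp add: lcoord_expansion[OF b] monomial_def)
  show "regular_exponent b (\<chi> k. f (b k)) m"
    using nz cond by (auto simp: regular_exponent_def)
qed

text \<open>Every generating set contains the basis, whose elements are irreducible.\<close>

lemma minimal_generating_basis:
  assumes b: "lattice_basis b" and S: "S = {m. \<forall>k. 0 \<le> lcoord b m $ k}"
  shows "minimal_generating G S \<longleftrightarrow> G = range b"
proof -
  have sub: "add_submonoid S"
    by (auto simp: S add_submonoid_def lcoord_0[OF b] lcoord_add[OF b])
  have bS: "range b \<subseteq> S"
    by (auto simp: S lcoord_basis[OF b] axis_def)
  have hull_S: "add_submonoid hull range b = S"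
  proof (rule hull_unique)
    show "range b \<subseteq> S" by (rule bS)
    show "add_submonoid S" by (rule sub)
    fix T assume T: "range b \<subseteq> T" "add_submonoid T"
    have nT: "int n *s b k \<in> T" for n k
      using T by (induction n) (auto simp: add_submonoid_def vector_sadd_rdistrib)
    have sT: "(\<Sum>k\<in>F. int (c k) *s b k) \<in> T" if "finite F" for F c
      using that T nT by induction (auto simp: add_submonoid_def)
    show "S \<subseteq> T"
    proof
      fix m assume "m \<in> S"
      then have "(\<Sum>k\<in>UNIV. lcoord b m $ k *s b k) = (\<Sum>k\<in>UNIV. int (nat (lcoord b m $ k)) *s b k)"
        by (intro sum.cong) (auto simp: S)
      then show "m \<in> T" using sT[of UNIV "\<lambda>k. nat (lcoord b m $ k)"] by (simp add: lcoord_expansion[OF b])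
    qed
  qed
  have irr: "b j \<in> G" if G: "add_submonoid hull G = S" for G j
  proof (rule ccontr)
    assume nG: "b j \<notin> G"
    have GS: "G \<subseteq> S" using hull_subset[of G add_submonoid] G by simp
    \<comment> \<open>Since \<open>b j\<close> is irreducible in \<open>S\<close>, deleting it
      leaves a submonoid, which would contain everything generated by \<open>G\<close>.\<close>
    let ?T = "S - {b j}"
    have "add_submonoid ?T" unfolding add_submonoid_def
    proof (intro conjI ballI)
      have "b j \<noteq> 0" using lcoord_basis[OF b, of j] lcoord_0[OF b] by (metis axis_eq_0_iff zero_neq_one)
      then show "0 \<in> ?T" using sub by (auto simp: add_submonoid_def)
      fix m m' assume m: "m \<in> ?T" "m' \<in> ?T"
      have "m + m' \<noteq> b j"
      proof
        assume e: "m + m' = b j"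
        then have e': "lcoord b m $ k + lcoord b m' $ k = axis j 1 $ k" for k
          using lcoord_add[OF b, of m m'] by (simp add: lcoord_basis[OF b])
        have p: "0 \<le> lcoord b m $ k" "0 \<le> lcoord b m' $ k" for k using m by (auto simp: S)
        have o: "lcoord b m $ k = 0 \<and> lcoord b m' $ k = 0" if "k \<noteq> j" for k
          using e'[of k] p[of k] that by (auto simp: axis_def)
        have "lcoord b m $ j = 0 \<or> lcoord b m' $ j = 0"
          using e'[of j] p[of j] by (auto simp: axis_def)
        then have "lcoord b m = 0 \<or> lcoord b m' = 0" using o by (auto simp: vec_eq_iff) metis+
        then have "m = 0 \<or> m' = 0"
          using lcoord_expansion[OF b, of m] lcoord_expansion[OF b, of m'] by auto
        then show False using e m by auto
      qed
      then show "m + m' \<in> ?T" using m sub by (auto simp: add_submonoid_def)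
    qed
    moreover have "G \<subseteq> ?T" using GS nG by auto
    ultimately have "add_submonoid hull G \<subseteq> ?T" by (metis hull_minimal)
    then show False using G bS by auto
  qed
  show ?thesis
  proof
    assume m: "minimal_generating G S"
    then have "range b \<subseteq> G" using irr by (auto simp: minimal_generating_def)
    with m hull_S show "G = range b" unfolding minimal_generating_def by blast
  next
    assume G: "G = range b"
    show "minimal_generating G S" unfolding minimal_generating_def
    proof (intro conjI allI impI)
      show "add_submonoid hull G = S" using G hull_S by simp
      fix G' assume "G' \<subset> G"
      then show "add_submonoid hull G' \<noteq> S" using irr[of G'] G by blast
    qed
  qed
qed

section \<open>From basis sets to bases indexed by the coordinates\<close>

lemma Z_basis_unique:
  assumes "Z_basis B" and "\<forall>b. b \<notin> B \<longrightarrow> c b = 0" "\<forall>b. b \<notin> B \<longrightarrow> d b = 0"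
    and "(\<Sum>b\<in>B. c b *s b) = (\<Sum>b\<in>B. d b *s b)"
  shows "c = d"
proof -
  have "\<exists>!c'. (\<forall>b. b \<notin> B \<longrightarrow> c' b = 0) \<and> (\<Sum>b\<in>B. c b *s b) = (\<Sum>b\<in>B. c' b *s b)"
    using assms(1) unfolding Z_basis_def by blast
  then obtain e where e: "\<And>c'. (\<forall>b. b \<notin> B \<longrightarrow> c' b = 0) \<and> (\<Sum>b\<in>B. c b *s b) = (\<Sum>b\<in>B. c' b *s b) \<Longrightarrow> c' = e"
    by (elim ex1E) blast
  show ?thesis using e[of c] e[of d] assms(2-4) by simp
qed

text \<open>Counting modulo 2: the classes of the subset sums of a basis exhaust \<open>M / 2 M\<close> without
  repetition.\<close>

lemma Z_basis_card:
  fixes B :: "(int ^ 'n::finite) set"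
  assumes "Z_basis B" shows "card B = CARD('n)"
proof -
  have fB: "finite B" and ex: "\<And>m. \<exists>!c :: int ^ 'n \<Rightarrow> int. (\<forall>b. b \<notin> B \<longrightarrow> c b = 0) \<and> m = (\<Sum>b\<in>B. c b *s b)"
    using assms by (auto simp: Z_basis_def)
  define par :: "int ^ 'n \<Rightarrow> 'n set" where "par m = {i. odd (m $ i)}" for m
  have "bij_betw (\<lambda>X. par (\<Sum>X)) (Pow B) (UNIV :: 'n set set)"
  proof (rule bij_betw_imageI)
    show "inj_on (\<lambda>X. par (\<Sum>X)) (Pow B)"
    proof (rule inj_onI)
      fix X Y assume XY: "X \<in> Pow B" "Y \<in> Pow B" "par (\<Sum>X) = par (\<Sum>Y)"
      have fin: "finite X" "finite Y" using XY fB finite_subset by auto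
      have "even ((\<Sum>X - \<Sum>Y) $ i)" for i
      proof -
        have "odd ((\<Sum>X) $ i) \<longleftrightarrow> odd ((\<Sum>Y) $ i)" using XY(3) unfolding par_def by blast
        then show ?thesis by (metis vector_minus_component even_diff even_add)
      qed
      then have "(2::int) *s (\<chi> i. (\<Sum>X - \<Sum>Y) $ i div 2) = \<Sum>X - \<Sum>Y"
        by (simp only: vec_eq_iff vector_smult_component vec_lambda_beta) (metis dvd_mult_div_cancel)
      then obtain m where m: "(2::int) *s m = \<Sum>X - \<Sum>Y" by blast
      obtain c where c: "\<forall>b. b \<notin> B \<longrightarrow> c b = 0" "m = (\<Sum>b\<in>B. c b *s b)" using ex[of m] by blast
      \<comment> \<open>The coefficients of the difference of the two subset sums lie in {-1, 0, 1}.
        Expanding \<open>m\<close> shows that they are also even, so they vanish and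
        \<open>X = Y\<close>.\<close>
      let ?d = "\<lambda>b. (if b \<in> X then 1 else 0) - (if b \<in> Y then 1 else (0::int))"
      have sumX: "\<Sum>Z = (\<Sum>b\<in>B. (if b \<in> Z then 1 else (0::int)) *s b)" if "Z \<subseteq> B" for Z
      proof -
        have "\<Sum>Z = (\<Sum>b\<in>B. if b \<in> Z then b else 0)"
          using that fB by (simp add: sum.inter_restrict[symmetric] Int_absorb1)
        then show ?thesis by (simp add: if_distrib[of "\<lambda>a. a *s _"] cong: if_cong)
      qed
      have "\<Sum>X - \<Sum>Y = (\<Sum>b\<in>B. ?d b *s b)"
        using sumX[of X] sumX[of Y] XY by (simp only: Pow_iff vector_sub_rdistrib sum_subtractf)
      moreover have "\<Sum>X - \<Sum>Y = (\<Sum>b\<in>B. (2 * c b) *s b)"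
        unfolding m[symmetric] c(2) by (simp add: vec_eq_iff sum_distrib_left mult.assoc)
      moreover have "\<forall>b. b \<notin> B \<longrightarrow> ?d b = 0" "\<forall>b. b \<notin> B \<longrightarrow> 2 * c b = 0" using XY c by auto
      ultimately have "?d = (\<lambda>b. 2 * c b)" by (intro Z_basis_unique[OF assms]) simp_all
      then have "?d b = 2 * c b" for b by (rule fun_cong)
      then have ev: "even (?d b)" for b by simp
      have "b \<in> X \<longleftrightarrow> b \<in> Y" for b using ev[of b] by (cases "b \<in> X"; cases "b \<in> Y") simp_all
      then show "X = Y" by blast
    qed
    show "(\<lambda>X. par (\<Sum>X)) ` Pow B = UNIV"
    proof -
      have "A \<in> (\<lambda>X. par (\<Sum>X)) ` Pow B" for A
      proof -
        \<comment> \<open>Every class modulo 2 has a 0/1 representative; reducing its coefficients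
          modulo 2 gives the required subset.\<close>
        define m :: "int ^ 'n" where "m = (\<chi> i. if i \<in> A then 1 else 0)"
        obtain c where c: "m = (\<Sum>b\<in>B. c b *s b)" using ex[of m] by blast
        let ?X = "{b\<in>B. odd (c b)}"
        have "odd (m $ i) \<longleftrightarrow> odd ((\<Sum>?X) $ i)" for i
        proof -
          have "m $ i - (\<Sum>?X) $ i = (\<Sum>b\<in>B. c b * b $ i) - (\<Sum>b\<in>B. if odd (c b) then b $ i else 0)"
            using fB unfolding c
            by (simp add: sum.inter_filter if_distrib[of "\<lambda>x. x $ i"] cong: if_cong)
          also have "\<dots> = (\<Sum>b\<in>B. c b * b $ i - (if odd (c b) then b $ i else 0))"
            by (simp add: sum_subtractf)
          also have "even \<dots>" by (intro dvd_sum) (simp add: left_diff_distrib[symmetric])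
          finally show ?thesis by (simp only: even_diff) (simp only: even_add)
        qed
        moreover have "odd (m $ i) \<longleftrightarrow> i \<in> A" for i by (simp add: m_def)
        ultimately have "par (\<Sum>?X) = A" unfolding par_def by blast
        then show ?thesis by blast
      qed
      then show ?thesis by blast
    qed
  qed
  then have "card (Pow B) = card (UNIV :: 'n set set)" by (rule bij_betw_same_card)
  moreover have "card (UNIV :: 'n set set) = 2 ^ CARD('n)"
    using card_Pow[of "UNIV :: 'n set"] by simp
  ultimately have "(2::nat) ^ card B = 2 ^ CARD('n)" using card_Pow[OF fB] by metis
  then show ?thesis by simp
qed

text \<open>Charts take values in \<open>complex ^ 'n\<close>, so the basis must be enumerated by
  the type \<open>'n\<close> itself; the count of its elements provides the bijection.\<close>

lemma Z_basis_lattice_basis: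
  fixes B :: "(int ^ 'n::finite) set"
  assumes "Z_basis B" obtains b :: "'n \<Rightarrow> int ^ 'n" where "lattice_basis b" "range b = B"
proof -
  have fB: "finite B" and ex: "\<And>m. \<exists>!c :: int ^ 'n \<Rightarrow> int. (\<forall>b. b \<notin> B \<longrightarrow> c b = 0) \<and> m = (\<Sum>b\<in>B. c b *s b)"
    using assms by (auto simp: Z_basis_def)
  obtain b :: "'n \<Rightarrow> int ^ 'n" where b: "bij_betw b UNIV B"
    using finite_same_card_bij[of "UNIV :: 'n set" B] fB Z_basis_card[OF assms] by auto
  then have inj: "inj b" and rng: "range b = B" by (auto simp: bij_betw_def)
  have "lattice_basis b" unfolding lattice_basis_def
  proof
    fix m
    have re: "(\<Sum>x\<in>B. c x *s x) = (\<Sum>k\<in>UNIV. c (b k) *s b k)" for c :: "int ^ 'n \<Rightarrow> int"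
      using sum.reindex[OF inj, of "\<lambda>x. c x *s x"] rng by simp
    obtain c where c: "m = (\<Sum>b\<in>B. c b *s b)" using ex[of m] by blast
    show "\<exists>!c :: int ^ 'n. m = (\<Sum>k\<in>UNIV. c $ k *s b k)"
    proof (rule ex1I[of _ "\<chi> k. c (b k)"])
      show "m = (\<Sum>k\<in>UNIV. (\<chi> k. c (b k)) $ k *s b k)" using c re by simp
      fix d :: "int ^ 'n" assume d: "m = (\<Sum>k\<in>UNIV. d $ k *s b k)"
      let ?e = "\<lambda>x. if x \<in> B then d $ (inv b x) else 0"
      let ?c = "\<lambda>x. if x \<in> B then c x else 0"
      have ek: "?e (b k) = d $ k" for k using inj rng by auto
      have "m = (\<Sum>b\<in>B. ?e b *s b)" unfolding re ek by (rule d)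
      moreover have "m = (\<Sum>b\<in>B. ?c b *s b)" unfolding c by (rule sum.cong) simp_all
      ultimately have "?e = ?c" by (intro Z_basis_unique[OF assms]) simp_all
      then have "?e (b k) = ?c (b k)" for k by (rule fun_cong)
      moreover have "?c (b k) = c (b k)" for k using rng by auto
      ultimately show "d = (\<chi> k. c (b k))" using ek by (simp add: vec_eq_iff)
    qed
  qed
  then show thesis using rng that by blast
qed

section \<open>Vertex charts of a smooth lattice polytope\<close>

text \<open>The proof cuts the polytope by a hyperplane that separates the vertex from all the others: the
  extreme points of the section lie on edges through the vertex.\<close>

lemma nonneg_on_polytope_if_nonneg_on_edges:
  fixes P :: "'a::euclidean_space set"
  assumes P: "polytope P" and v: "v extreme_point_of P"
    and edges: "\<And>e x. e edge_of P \<Longrightarrow> v \<in> e \<Longrightarrow> x \<in> e \<Longrightarrow> 0 \<le> (x - v) \<bullet> u"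
    and p: "p \<in> P"
  shows "0 \<le> (p - v) \<bullet> u"
proof -
  define E where "E = {x. x extreme_point_of P}"
  have comp: "compact P" and conv: "convex P"
    using P polytope_imp_compact polytope_imp_convex by auto
  have PE: "P = convex hull E"
    unfolding E_def by (rule Krein_Milman_Minkowski[OF comp conv])
  have finE: "finite E" unfolding E_def
    using P polytope_imp_polyhedron finite_polyhedron_extreme_points by blast
  have vE: "v \<in> E" using v by (simp add: E_def)
  let ?R = "convex hull (E - {v})"
  have "v \<notin> ?R"
  proof
    assume "v \<in> ?R"
    then have "?R = convex hull (insert v (E - {v}))" using hull_redundant[of v convex "E - {v}"] by simp
    then have "P = ?R" using PE vE by (simp add: insert_absorb)
    then show False using v extreme_point_of_convex_hull by blast
  qed
  moreover have "closed ?R" using finE by (simp add: finite_imp_compact_convex_hull compact_imp_closed)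
  ultimately obtain a b where ab: "a \<bullet> v < b" "\<And>x. x \<in> ?R \<Longrightarrow> b < a \<bullet> x"
    using separating_hyperplane_closed_point[of ?R v] convex_convex_hull by blast
  let ?H = "{x. a \<bullet> x = b}"
  let ?Q = "P \<inter> ?H"
  have halfspace: "convex {x. 0 \<le> (x - v) \<bullet> u}"
  proof -
    have "{x. 0 \<le> (x - v) \<bullet> u} = {x. u \<bullet> x \<ge> u \<bullet> v}"
      by (auto simp: inner_diff_left inner_diff_right inner_commute)
    then show ?thesis by (simp add: convex_halfspace_ge)
  qed
  have ext: "0 \<le> (q - v) \<bullet> u" if q: "q extreme_point_of ?Q" for q
  proof -
    have qP: "q \<in> P" and qH: "a \<bullet> q = b" using q by (auto simp: extreme_point_of_def)
    \<comment> \<open>\<open>F\<close> is the smallest face through \<open>q\<close>; minimality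
      puts \<open>q\<close> in its relative interior. The aim is that \<open>F\<close> is an edge
      containing \<open>v\<close>.\<close>
    define F where "F = \<Inter>{F. F face_of P \<and> q \<in> F}"
    have Fface: "F face_of P" unfolding F_def
      by (rule face_of_Inter) (use qP conv face_of_refl in auto)
    have qF: "q \<in> F" by (simp add: F_def)
    have Fmin: "F \<subseteq> G" if "G face_of P" "q \<in> G" for G using that by (auto simp: F_def)
    have Fpoly: "polytope F" using P Fface face_of_polytope_polytope by blast
    have Fconv: "convex F" using Fface face_of_imp_convex by blast
    have qri: "q \<in> rel_interior F"
    proof (rule ccontr)
      assume "q \<notin> rel_interior F"
      then have "q \<in> rel_frontier F" using qF closure_subset by (auto simp: rel_frontier_def)
      then obtain G where G: "G facet_of F" "q \<in> G"
        using rel_frontier_of_polyhedron[OF polytope_imp_polyhedron[OF Fpoly]] by auto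
      then have "G face_of P" using Fface face_of_trans facet_of_imp_face_of by blast
      then have "F \<subseteq> G" using Fmin G by blast
      then have "F = G" using facet_of_imp_subset[OF G(1)] by blast
      then show False using G(1) by simp
    qed
    \<comment> \<open>In dimension at least 2 the hyperplane still meets the affine hull of
      \<open>F\<close> in a line through \<open>q\<close>, and a short symmetric segment of it lies
      in \<open>?Q\<close>, so that \<open>q\<close> would not be extreme.\<close>
    have "aff_dim F \<le> 1"
    proof (rule ccontr)
      assume "\<not> aff_dim F \<le> 1"
      then have dim: "aff_dim (affine hull F) \<ge> 2" by simp
      have qA: "q \<in> affine hull F \<inter> ?H" using qF qH hull_inc by fastforce
      have "aff_dim (affine hull F \<inter> ?H) \<ge> 1"
        using aff_dim_affine_Int_hyperplane[OF affine_affine_hull[of F], of a b] dim qA by auto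
      then have "affine hull F \<inter> ?H \<noteq> {q}" using aff_dim_sing[of q] by auto
      then obtain x where x: "x \<in> affine hull F" "a \<bullet> x = b" "x \<noteq> q" using qA by auto
      obtain r where r: "r > 0" "ball q r \<inter> affine hull F \<subseteq> F"
        using qri by (auto simp: mem_rel_interior_ball)
      define t where "t = r / (2 * norm (x - q))"
      have t: "t > 0" "t * norm (x - q) < r" using r x by (auto simp: t_def)
      have aff: "q + s *\<^sub>R (x - q) \<in> affine hull F" for s
        using mem_affine[OF affine_affine_hull[of F], of q x "1 - s" s] x qF hull_inc[of q F affine]
        by (simp add: algebra_simps)
      have inQ: "q + s *\<^sub>R (x - q) \<in> ?Q" if "\<bar>s\<bar> = t" for s
      proof -
        have "q + s *\<^sub>R (x - q) \<in> ball q r" using t that by (simp add: dist_norm)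
        then have "q + s *\<^sub>R (x - q) \<in> P" using aff r Fface face_of_imp_subset by blast
        moreover have "a \<bullet> (q + s *\<^sub>R (x - q)) = b" using x qH by (simp add: algebra_simps)
        ultimately show ?thesis by simp
      qed
      have "q + t *\<^sub>R (x - q) \<in> ?Q" "q + (- t) *\<^sub>R (x - q) \<in> ?Q"
        using inQ[of t] inQ[of "- t"] t(1) by (simp_all only: abs_minus abs_of_pos)
      moreover have "q \<in> open_segment (q + t *\<^sub>R (x - q)) (q + (- t) *\<^sub>R (x - q))"
      proof -
        have "q = midpoint (q + t *\<^sub>R (x - q)) (q + (- t) *\<^sub>R (x - q))"
          by (simp add: midpoint_def algebra_simps flip: scaleR_2)
        moreover have "q + t *\<^sub>R (x - q) \<noteq> q + (- t) *\<^sub>R (x - q)"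
        proof
          assume "q + t *\<^sub>R (x - q) = q + (- t) *\<^sub>R (x - q)"
          then have "(t + t) *\<^sub>R (x - q) = 0" unfolding scaleR_add_left by (simp add: algebra_simps)
          then show False using t x by simp
        qed
        ultimately show ?thesis by (metis midpoint_in_open_segment)
      qed
      ultimately show False using q by (auto simp: extreme_point_of_def)
    qed
    \<comment> \<open>Otherwise \<open>q\<close> is a vertex other than \<open>v\<close>, and those
      lie strictly beyond the hyperplane.\<close>
    moreover have "aff_dim F \<noteq> 0"
    proof
      assume "aff_dim F = 0"
      then have "F = {q}" using qF by (auto simp: aff_dim_eq_0)
      then have "q \<in> E" using Fface by (simp add: E_def face_of_singleton)
      moreover have "q \<noteq> v" using ab(1) qH by auto
      ultimately have "q \<in> ?R" by (simp add: hull_inc)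
      then show False using ab(2) qH by fastforce
    qed
    moreover have "aff_dim F \<ge> 0" using qF by (metis aff_dim_negative_iff empty_iff linorder_not_less)
    ultimately have edge: "F edge_of P" using Fface by (simp add: edge_of_def)
    \<comment> \<open>A face avoiding \<open>v\<close> is the hull of other vertices and so misses
      the hyperplane.\<close>
    have "v \<in> F"
    proof (rule ccontr)
      assume vF: "v \<notin> F"
      have "F = convex hull {x. x extreme_point_of F}"
        using Krein_Milman_Minkowski polytope_imp_compact[OF Fpoly] Fconv by blast
      also have "\<dots> \<subseteq> ?R"
      proof (rule hull_mono)
        show "{x. x extreme_point_of F} \<subseteq> E - {v}"
          using vF Fface by (auto simp: E_def extreme_point_of_face)
      qed
      finally show False using qF ab(2) qH by fastforce
    qed
    then show ?thesis using edges[OF edge] qF by blast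
  qed
  have "compact ?Q" using comp closed_hyperplane[of a b] by (simp add: compact_Int_closed)
  moreover have "convex ?Q" by (intro convex_Int conv convex_hyperplane)
  ultimately have "?Q = convex hull {x. x extreme_point_of ?Q}" by (rule Krein_Milman_Minkowski)
  moreover have "convex hull {x. x extreme_point_of ?Q} \<subseteq> {x. 0 \<le> (x - v) \<bullet> u}"
    by (rule hull_minimal) (use ext halfspace in auto)
  ultimately have Q: "0 \<le> (q - v) \<bullet> u" if "q \<in> ?Q" for q using that by blast
  have "0 \<le> (w - v) \<bullet> u" if w: "w \<in> E" for w
  proof (cases "w = v")
    case False
    then have aw: "b < a \<bullet> w" using w ab(2) by (simp add: hull_inc)
    \<comment> \<open>The parameter at which the segment from \<open>v\<close> to \<open>w\<close>
      crosses the hyperplane. The crossing point lies in \<open>?Q\<close>, and its displacement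
      from \<open>v\<close> is a positive multiple of \<open>w - v\<close>.\<close>
    define s where "s = (b - a \<bullet> v) / (a \<bullet> w - a \<bullet> v)"
    have s: "0 < s" "s < 1" using aw ab(1) by (auto simp: s_def)
    have "(1 - s) *\<^sub>R v + s *\<^sub>R w \<in> P"
      using s w vE PE by (intro convexD_alt[OF conv]) (auto simp: hull_inc)
    moreover have "a \<bullet> ((1 - s) *\<^sub>R v + s *\<^sub>R w) = b"
    proof -
      have "a \<bullet> ((1 - s) *\<^sub>R v + s *\<^sub>R w) = a \<bullet> v + s * (a \<bullet> w - a \<bullet> v)" by (simp add: algebra_simps)
      also have "\<dots> = b" using aw ab(1) by (simp add: s_def)
      finally show ?thesis .
    qed
    ultimately have "0 \<le> ((1 - s) *\<^sub>R v + s *\<^sub>R w - v) \<bullet> u" using Q by blast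
    also have "((1 - s) *\<^sub>R v + s *\<^sub>R w - v) = s *\<^sub>R (w - v)" by (simp add: algebra_simps)
    finally show ?thesis using s by (simp add: zero_le_mult_iff)
  qed simp
  then have "P \<subseteq> {x. 0 \<le> (x - v) \<bullet> u}"
    unfolding PE by (intro hull_minimal) (use halfspace in auto)
  then show ?thesis using p by blast
qed

lemma primitive_multiple:
  fixes m :: "int ^ 'n::finite"
  assumes "m \<noteq> 0" obtains g u where "g > 0" "primitive u" "m = g *s u"
proof -
  define g where "g = Gcd (range (\<lambda>i. m $ i))"
  have "g \<noteq> 0" using assms by (auto simp: g_def vec_eq_iff)
  moreover have "g \<ge> 0" by (simp add: g_def)
  ultimately have g: "g > 0" by simp
  have gd: "g dvd m $ i" for i by (simp add: g_def Gcd_dvd)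
  define u :: "int ^ 'n" where "u = (\<chi> i. m $ i div g)"
  have mu: "m $ i = g * u $ i" for i using gd by (simp add: u_def)
  let ?h = "Gcd (range (\<lambda>i. u $ i))"
  have "g * ?h dvd g"
  proof -
    have "g * ?h dvd m $ i" for i unfolding mu by (rule mult_dvd_mono) (auto simp: Gcd_dvd)
    then have "g * ?h dvd Gcd (range (\<lambda>i. m $ i))" by (intro Gcd_greatest) auto
    then show ?thesis by (simp only: g_def[symmetric])
  qed
  then have "?h dvd 1" using g by (metis dvd_mult_cancel_left mult.right_neutral less_irrefl)
  then have "?h = 1" by (simp add: zdvd1_eq)
  then have "primitive u" by (simp add: primitive_def)
  then show thesis using g mu that[of g u] by (simp add: vec_eq_iff)
qed

text \<open>Biduality by hand: \<open>dual_vec b k\<close> lies in the cone, and pairing with it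
  reads off the \<open>k\<close>-th coordinate. The converse is the expansion in the basis.\<close>

lemma cone_monoid_dual_basis:
  assumes b: "lattice_basis b" and cone: "\<And>u. u \<in> \<sigma> \<longleftrightarrow> (\<forall>k. 0 \<le> emb (b k) \<bullet> u)"
  shows "cone_monoid \<sigma> = {m. \<forall>k. 0 \<le> lcoord b m $ k}"
proof (intro set_eqI iffI; clarsimp)
  fix m k assume m: "m \<in> cone_monoid \<sigma>"
  have "dual_vec b k \<in> \<sigma>"
    unfolding cone by (simp add: dual_vec[OF b] lcoord_basis[OF b] axis_def)
  then have "0 \<le> emb m \<bullet> dual_vec b k" using m by (simp add: cone_monoid_def dual_cone_def)
  then show "0 \<le> lcoord b m $ k" by (simp add: dual_vec[OF b])
next
  fix m assume m: "\<forall>k. 0 \<le> lcoord b m $ k"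
  have "0 \<le> emb m \<bullet> u" if "u \<in> \<sigma>" for u
    unfolding emb_expansion[OF b, of m] inner_sum_left
    using that m cone by (intro sum_nonneg) (simp add: inner_scaleR_left)
  then show "m \<in> cone_monoid \<sigma>" by (simp add: cone_monoid_def dual_cone_def)
qed

section \<open>Cones and charts indexed by vertices\<close>

locale smooth_polytope =
  fixes P :: "(real ^ 'n::finite) set"
  assumes lattice: "lattice_polytope P" and simple: "absolutely_simple P" and nonempty: "P \<noteq> {}"
begin

definition verts :: "(int ^ 'n) set" where
  "verts = {m. emb m extreme_point_of P}"

text \<open>\<open>A\<close> may be any set of vertices, not only that of a face. Intersections of
  cones then become unions of index sets (\<open>vcone_Un\<close>), and gluing never has to identify
  the face that an intersection belongs to.\<close>

definition vcone :: "(int ^ 'n) set \<Rightarrow> (real ^ 'n) set" where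
  "vcone A = normal_cone P (emb ` A)"

text \<open>What is recorded is the freeness of the monoid rather than the edge vectors. This form
  is stable under permuting the basis and can be checked directly for the simplex.\<close>

definition vchart :: "int ^ 'n \<Rightarrow> ('n \<Rightarrow> int ^ 'n) \<Rightarrow> bool" where
  "vchart v b \<longleftrightarrow> v \<in> verts \<and> lattice_basis b \<and> cone_monoid (vcone {v}) = {m. \<forall>k. 0 \<le> lcoord b m $ k}"

lemma polytope: "polytope P"
  using lattice by (auto simp: lattice_polytope_def polytope_def)

lemma extreme_point_verts: "x extreme_point_of P \<Longrightarrow> \<exists>m\<in>verts. x = emb m"
proof -
  assume x: "x extreme_point_of P"
  obtain W where "P = convex hull (emb ` W)" using lattice by (auto simp: lattice_polytope_def)
  then have "x \<in> emb ` W" using x extreme_point_of_convex_hull by blast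
  then show ?thesis using x by (auto simp: verts_def)
qed

lemma emb_verts: "emb ` verts = {x. x extreme_point_of P}"
  using extreme_point_verts by (auto simp: verts_def)

lemma P_hull: "P = convex hull (emb ` verts)"
  unfolding emb_verts
  by (rule Krein_Milman_Minkowski) (use polytope polytope_imp_compact polytope_imp_convex in auto)

lemma finite_verts: "finite verts"
proof -
  have "finite (emb ` verts)" unfolding emb_verts
    using polytope polytope_imp_polyhedron finite_polyhedron_extreme_points by blast
  then show ?thesis by (rule finite_imageD) (auto simp: inj_on_def emb_eq_iff)
qed

lemma verts_nonempty: "verts \<noteq> {}"
  using P_hull nonempty by auto

lemma verts_in_P: "v \<in> verts \<Longrightarrow> emb v \<in> P"
  by (auto simp: verts_def extreme_point_of_def)

lemma vcone_Un: "A \<noteq> {} \<Longrightarrow> B \<noteq> {} \<Longrightarrow> vcone A \<inter> vcone B = vcone (A \<union> B)"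
  unfolding vcone_def normal_cone_def by blast

lemma vcone_mono: "A \<subseteq> B \<Longrightarrow> vcone B \<subseteq> vcone A"
  unfolding vcone_def normal_cone_def by blast

lemma cone_monoid_antimono: "\<sigma> \<subseteq> \<tau> \<Longrightarrow> cone_monoid \<tau> \<subseteq> cone_monoid \<sigma>"
  unfolding cone_monoid_def dual_cone_def by blast

text \<open>The polytope is the hull of its vertices and a half-space is convex, so finitely many
  inequalities between lattice points suffice.\<close>

lemma mem_vcone_iff:
  assumes "A \<subseteq> verts"
  shows "u \<in> vcone A \<longleftrightarrow> (\<forall>w\<in>verts. \<forall>a\<in>A. 0 \<le> emb (w - a) \<bullet> u)"
proof
  assume "u \<in> vcone A"
  then show "\<forall>w\<in>verts. \<forall>a\<in>A. 0 \<le> emb (w - a) \<bullet> u"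
    using verts_in_P by (auto simp: vcone_def normal_cone_def emb_diff)
next
  assume *: "\<forall>w\<in>verts. \<forall>a\<in>A. 0 \<le> emb (w - a) \<bullet> u"
  have "P \<subseteq> {x. u \<bullet> x \<ge> u \<bullet> emb a}" if "a \<in> A" for a
  proof -
    have "emb ` verts \<subseteq> {x. u \<bullet> x \<ge> u \<bullet> emb a}"
      using * that by (auto simp: emb_diff inner_diff_left inner_diff_right inner_commute)
    then have "convex hull (emb ` verts) \<subseteq> {x. u \<bullet> x \<ge> u \<bullet> emb a}"
      by (rule hull_minimal) (rule convex_halfspace_ge)
    then show ?thesis by (rule ord_eq_le_trans[OF P_hull])
  qed
  then show "u \<in> vcone A"
    by (force simp: vcone_def normal_cone_def inner_diff_left inner_diff_right inner_commute)
qed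

lemma diff_in_cone_monoid:
  assumes "v \<in> A" "A \<subseteq> verts" "w \<in> verts" shows "w - v \<in> cone_monoid (vcone A)"
  using assms mem_vcone_iff[OF assms(2)] by (auto simp: cone_monoid_def dual_cone_def)

text \<open>Absolute simplicity speaks about edges, the normal cone about all of \<open>P\<close>.
  The edge criterion bridges the two: a functional that is nonnegative on the primitive edge vectors
  at \<open>v\<close> is nonnegative on the edges at \<open>v\<close>, hence on
  \<open>P - v\<close>.\<close>

lemma vchart_exists:
  assumes v: "v \<in> verts" obtains b where "vchart v b"
proof -
  let ?B = "primitive_edge_vectors P (emb v)"
  have "Z_basis ?B" using v simple by (auto simp: absolutely_simple_def verts_def)
  then obtain b where b: "lattice_basis b" and rb: "range b = ?B" by (rule Z_basis_lattice_basis)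
  have cone: "u \<in> vcone {v} \<longleftrightarrow> (\<forall>k. 0 \<le> emb (b k) \<bullet> u)" for u
  proof
    assume u: "u \<in> vcone {v}"
    show "\<forall>k. 0 \<le> emb (b k) \<bullet> u"
    proof
      fix k
      have "b k \<in> ?B" using rb by blast
      then obtain e t where e: "e edge_of P" "t > 0" "emb v + t *\<^sub>R emb (b k) \<in> e"
        by (auto simp: primitive_edge_vectors_def)
      then have "emb v + t *\<^sub>R emb (b k) \<in> P" using edge_of_imp_subset by blast
      then have "0 \<le> (t *\<^sub>R emb (b k)) \<bullet> u" using u by (force simp: vcone_def normal_cone_def)
      then show "0 \<le> emb (b k) \<bullet> u" using e(2) by (simp add: zero_le_mult_iff)
    qed
  next
    assume u: "\<forall>k. 0 \<le> emb (b k) \<bullet> u"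
    have "0 \<le> (x - emb v) \<bullet> u" if e: "e edge_of P" "emb v \<in> e" and x: "x \<in> e" for e x
    proof -
      have face: "e face_of P" using e by (simp add: edge_of_def)
      have "e = convex hull {x. x extreme_point_of e}"
        using face polytope face_of_polytope_polytope polytope_imp_compact face_of_imp_convex
          Krein_Milman_Minkowski by metis
      moreover have "0 \<le> (y - emb v) \<bullet> u" if y: "y extreme_point_of e" for y
      proof -
        have "y extreme_point_of P" using y face by (simp add: extreme_point_of_face)
        then obtain w where w: "y = emb w" using extreme_point_verts by blast
        show ?thesis
        proof (cases "w = v")
          case False
          \<comment> \<open>The other end of the edge differs from \<open>v\<close> by a lattice
            vector, whose primitive part is an edge vector and hence some
            \<open>b k\<close>.\<close>
          then obtain g m where g: "g > 0" "primitive m" "w - v = g *s m"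
            using primitive_multiple[of "w - v"] by auto
          have eq: "emb v + of_int g *\<^sub>R emb m = y"
            using arg_cong[OF g(3), of emb] by (simp add: emb_diff emb_smult w algebra_simps)
          have "y \<in> e" using y by (simp add: extreme_point_of_def)
          then have "m \<in> ?B" unfolding primitive_edge_vectors_def
            using g e eq by (auto intro!: exI[of _ e] exI[of _ "of_int g"])
          then obtain k where "m = b k" using rb by blast
          then have "0 \<le> emb m \<bullet> u" using u by simp
          moreover have "y - emb v = of_int g *\<^sub>R emb m" using eq by (simp add: algebra_simps)
          ultimately show ?thesis using g by simp
        qed (simp add: w)
      qed
      then have "{x. x extreme_point_of e} \<subseteq> {x. u \<bullet> x \<ge> u \<bullet> emb v}"
        by (auto simp: inner_diff_left inner_diff_right inner_commute)
      then have "convex hull {x. x extreme_point_of e} \<subseteq> {x. u \<bullet> x \<ge> u \<bullet> emb v}"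
        by (rule hull_minimal) (rule convex_halfspace_ge)
      ultimately have "u \<bullet> x \<ge> u \<bullet> emb v" using x by blast
      then show ?thesis by (simp add: inner_diff_left inner_diff_right inner_commute)
    qed
    then have "0 \<le> (p - emb v) \<bullet> u" if "p \<in> P" for p
      using nonneg_on_polytope_if_nonneg_on_edges[OF polytope _ _ that, of "emb v" u] v
      by (auto simp: verts_def)
    then show "u \<in> vcone {v}" by (auto simp: vcone_def normal_cone_def)
  qed
  then have "cone_monoid (vcone {v}) = {m. \<forall>k. 0 \<le> lcoord b m $ k}" by (rule cone_monoid_dual_basis[OF b])
  then show thesis using that b v by (auto simp: vchart_def)
qed

lemma vchartD:
  assumes "vchart v b"
  shows "v \<in> verts" "lattice_basis b" "\<And>m. m \<in> cone_monoid (vcone {v}) \<longleftrightarrow> (\<forall>k. 0 \<le> lcoord b m $ k)"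
  using assms by (auto simp: vchart_def)

lemma vchart_coord_nonneg:
  assumes "vchart v b" "w \<in> verts" shows "0 \<le> lcoord b (w - v) $ k"
  using diff_in_cone_monoid[of v "{v}" w] vchartD[OF assms(1)] assms(2) by auto

text \<open>All vertices have nonnegative coordinates relative to \<open>v\<close>, so this
  functional is minimal over the polytope at \<open>v\<close>, and equally at every vertex whose
  \<open>k\<close>-th coordinate is zero.\<close>

lemma dual_vec_in_vcone:
  assumes b: "vchart v b" and A: "v \<in> A" "A \<subseteq> verts" and k: "\<forall>a\<in>A. lcoord b (a - v) $ k = 0"
  shows "dual_vec b k \<in> vcone A"
  unfolding mem_vcone_iff[OF A(2)]
proof (intro ballI)
  fix w a assume w: "w \<in> verts" "a \<in> A"
  have "lcoord b (w - a) = lcoord b (w - v) - lcoord b (a - v)"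
    using lcoord_diff[OF vchartD(2)[OF b], of "w - v" "a - v"] by simp
  then show "0 \<le> emb (w - a) \<bullet> dual_vec b k"
    using vchart_coord_nonneg[OF b w(1)] k w by (simp add: dual_vec[OF vchartD(2)[OF b]])
qed

lemma basis_inner_nonneg:
  assumes "vchart v b" "u \<in> vcone {v}" shows "0 \<le> emb (b k) \<bullet> u"
proof -
  have "b k \<in> cone_monoid (vcone {v})"
    using vchartD[OF assms(1)] by (simp add: lcoord_basis axis_def)
  then show ?thesis using assms(2) by (simp add: cone_monoid_def dual_cone_def)
qed

text \<open>The exponents \<open>k\<close> with \<open>lcoord b (a - v) $ k \<noteq> 0\<close> for some \<open>a \<in> A\<close> are the ones that become
  invertible on the face spanned by \<open>A\<close>.\<close>

lemma cone_monoid_vcone: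
  assumes b: "vchart v b" and A: "v \<in> A" "A \<subseteq> verts"
  shows "m \<in> cone_monoid (vcone A) \<longleftrightarrow>
    (\<forall>k. k \<notin> {k. \<exists>a\<in>A. lcoord b (a - v) $ k \<noteq> 0} \<longrightarrow> 0 \<le> lcoord b m $ k)"
proof
  assume m: "m \<in> cone_monoid (vcone A)"
  show "\<forall>k. k \<notin> {k. \<exists>a\<in>A. lcoord b (a - v) $ k \<noteq> 0} \<longrightarrow> 0 \<le> lcoord b m $ k"
  proof (intro allI impI)
    fix k assume "k \<notin> {k. \<exists>a\<in>A. lcoord b (a - v) $ k \<noteq> 0}"
    then have "dual_vec b k \<in> vcone A" by (intro dual_vec_in_vcone[OF b A]) blast
    then have "0 \<le> emb m \<bullet> dual_vec b k" using m by (simp add: cone_monoid_def dual_cone_def)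
    then show "0 \<le> lcoord b m $ k" by (simp add: dual_vec[OF vchartD(2)[OF b]])
  qed
next
  assume m: "\<forall>k. k \<notin> {k. \<exists>a\<in>A. lcoord b (a - v) $ k \<noteq> 0} \<longrightarrow> 0 \<le> lcoord b m $ k"
  have "0 \<le> emb m \<bullet> u" if u: "u \<in> vcone A" for u
  proof -
    have uv: "u \<in> vcone {v}" using u vcone_mono[of "{v}" A] A by auto
    have nn: "0 \<le> emb (b k) \<bullet> u" for k by (rule basis_inner_nonneg[OF b uv])
    have z: "emb (b k) \<bullet> u = 0" if a: "a \<in> A" "lcoord b (a - v) $ k \<noteq> 0" for a k
    proof -
      have "0 \<le> emb (v - a) \<bullet> u" "0 \<le> emb (a - v) \<bullet> u"
        using u a A mem_vcone_iff[OF A(2)] by auto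
      then have "0 = emb (a - v) \<bullet> u" by (simp add: emb_diff inner_diff_left)
      also have "\<dots> = (\<Sum>k\<in>UNIV. of_int (lcoord b (a - v) $ k) * (emb (b k) \<bullet> u))"
        unfolding emb_expansion[OF vchartD(2)[OF b], of "a - v"] by (simp add: inner_sum_left)
      finally have "(\<Sum>k\<in>UNIV. of_int (lcoord b (a - v) $ k) * (emb (b k) \<bullet> u)) = 0" by simp
      moreover have "0 \<le> of_int (lcoord b (a - v) $ k) * (emb (b k) \<bullet> u)" for k
        using vchart_coord_nonneg[OF b, of a k] a A nn by auto
      ultimately have "of_int (lcoord b (a - v) $ k) * (emb (b k) \<bullet> u) = 0"
        by (subst (asm) sum_nonneg_eq_0_iff) auto
      then show ?thesis using a by simp
    qed
    have "0 \<le> of_int (lcoord b m $ k) * (emb (b k) \<bullet> u)" for k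
      using m nn[of k] z[of _ k] by (cases "k \<in> {k. \<exists>a\<in>A. lcoord b (a - v) $ k \<noteq> 0}") auto
    then show ?thesis
      unfolding emb_expansion[OF vchartD(2)[OF b], of m] inner_sum_left
      by (intro sum_nonneg) (simp add: inner_scaleR_left)
  qed
  then show "m \<in> cone_monoid (vcone A)" by (simp add: cone_monoid_def dual_cone_def)
qed

text \<open>If all the functionals \<open>dual_vec b k\<close> at \<open>v\<close> were also minimal
  at \<open>w\<close>, every coordinate of \<open>w - v\<close> would be both nonnegative and
  nonpositive. This is what makes the vertex cones maximal.\<close>

lemma vcone_subset_imp_eq:
  assumes "v \<in> verts" "w \<in> verts" "vcone {v} \<subseteq> vcone {w}" shows "v = w"
proof (rule ccontr)
  assume ne: "v \<noteq> w"
  obtain b where b: "vchart v b" using vchart_exists[OF assms(1)] .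
  note lb = vchartD(2)[OF b]
  have "lcoord b (w - v) $ k \<le> 0" for k
  proof -
    have "dual_vec b k \<in> vcone {v}"
      by (rule dual_vec_in_vcone[OF b]) (use assms(1) lcoord_0[OF lb] in auto)
    then have "dual_vec b k \<in> vcone {w}" using assms(3) by blast
    then have "0 \<le> emb (v - w) \<bullet> dual_vec b k" using mem_vcone_iff[of "{w}"] assms by auto
    then have "0 \<le> lcoord b (v - w) $ k" by (simp add: dual_vec[OF lb])
    then show ?thesis by (simp add: lcoord_diff[OF lb])
  qed
  then have "lcoord b (w - v) = 0"
    using vchart_coord_nonneg[OF b assms(2)] by (simp add: vec_eq_iff order_antisym)
  then have "w - v = 0" using lcoord_expansion[OF lb, of "w - v"] by simp
  then show False using ne by simp
qed

lemma normal_fan_vcone: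
  assumes "\<sigma> \<in> normal_fan P"
  obtains A where "A \<subseteq> verts" "A \<noteq> {}" "\<sigma> = vcone A"
proof -
  obtain F where F: "F face_of P" "F \<noteq> {}" "\<sigma> = normal_cone P F" using assms by (auto simp: normal_fan_def)
  let ?A = "{m\<in>verts. emb m \<in> F}"
  have ext: "{x. x extreme_point_of F} = emb ` ?A"
    using F(1) emb_verts by (auto simp: extreme_point_of_face)
  have hull: "F = convex hull (emb ` ?A)"
    unfolding ext[symmetric]
    using F(1) polytope face_of_polytope_polytope polytope_imp_compact face_of_imp_convex
      Krein_Milman_Minkowski by metis
  have "normal_cone P F = vcone ?A"
  proof
    show "normal_cone P F \<subseteq> vcone ?A" by (auto simp: normal_cone_def vcone_def)
    show "vcone ?A \<subseteq> normal_cone P F"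
    proof
      fix u assume u: "u \<in> vcone ?A"
      have "F \<subseteq> {x. u \<bullet> x \<le> u \<bullet> p}" if "p \<in> P" for p
      proof -
        have "emb ` ?A \<subseteq> {x. u \<bullet> x \<le> u \<bullet> p}"
          using u that by (auto simp: vcone_def normal_cone_def inner_diff_left inner_diff_right inner_commute)
        then have "convex hull (emb ` ?A) \<subseteq> {x. u \<bullet> x \<le> u \<bullet> p}"
          by (rule hull_minimal) (rule convex_halfspace_le)
        then show ?thesis using hull by simp
      qed
      then show "u \<in> normal_cone P F"
        by (force simp: normal_cone_def inner_diff_left inner_diff_right inner_commute)
    qed
  qed
  moreover have "?A \<noteq> {}"
  proof
    assume "?A = {}"
    then have "convex hull (emb ` ?A) = {}" by (simp only: image_empty convex_hull_empty)
    then show False using F(2) by (simp only: hull[symmetric])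
  qed
  ultimately show thesis using that[of ?A] F(3) by auto
qed

lemma vcone_in_normal_fan:
  assumes "v \<in> verts" shows "vcone {v} \<in> normal_fan P"
  using assms unfolding normal_fan_def vcone_def verts_def
  by (auto simp: face_of_singleton[symmetric])

lemma max_cones_iff: "\<sigma> \<in> max_cones (normal_fan P) \<longleftrightarrow> (\<exists>v\<in>verts. \<sigma> = vcone {v})"
proof
  assume m: "\<sigma> \<in> max_cones (normal_fan P)"
  then obtain A where A: "A \<subseteq> verts" "A \<noteq> {}" "\<sigma> = vcone A"
    using normal_fan_vcone by (auto simp: max_cones_def)
  then obtain v where v: "v \<in> A" by blast
  then have "\<sigma> \<subseteq> vcone {v}" "vcone {v} \<in> normal_fan P" using vcone_mono[of "{v}" A] vcone_in_normal_fan A by auto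
  then have "vcone {v} = \<sigma>" using m by (auto simp: max_cones_def)
  then show "\<exists>v\<in>verts. \<sigma> = vcone {v}" using v A by blast
next
  assume "\<exists>v\<in>verts. \<sigma> = vcone {v}"
  then obtain v where v: "v \<in> verts" "\<sigma> = vcone {v}" by blast
  have "\<tau> = \<sigma>" if t: "\<tau> \<in> normal_fan P" "\<sigma> \<subseteq> \<tau>" for \<tau>
  proof -
    obtain A where A: "A \<subseteq> verts" "A \<noteq> {}" "\<tau> = vcone A" using normal_fan_vcone[OF t(1)] .
    then obtain w where w: "w \<in> A" by blast
    have sub: "\<tau> \<subseteq> vcone {w}" using vcone_mono[of "{w}" A] w A by auto
    then have "v = w" using vcone_subset_imp_eq[of v w] v t A w by auto
    then show ?thesis using sub t v by auto
  qed
  then show "\<sigma> \<in> max_cones (normal_fan P)" using v vcone_in_normal_fan by (auto simp: max_cones_def)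
qed

text \<open>A free monoid has only one minimal generating family, so the sole freedom in a chart
  over a given vertex is the order of enumeration.\<close>

lemma charts_iff: "c \<in> charts (normal_fan P) \<longleftrightarrow> (\<exists>v b. c = (vcone {v}, b) \<and> vchart v b)"
proof
  assume "c \<in> charts (normal_fan P)"
  then obtain \<sigma> b where c: "c = (\<sigma>, b)" "\<sigma> \<in> max_cones (normal_fan P)" "inj b"
    "minimal_generating (range b) (cone_monoid \<sigma>)" by (auto simp: charts_def)
  then obtain v where v: "v \<in> verts" "\<sigma> = vcone {v}" using max_cones_iff by blast
  obtain b' where b': "vchart v b'" using vchart_exists[OF v(1)] .
  note lb = vchartD(2)[OF b']
  have S: "cone_monoid (vcone {v}) = {m. \<forall>k. 0 \<le> lcoord b' m $ k}" using b' by (simp add: vchart_def)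
  have rng: "range b = range b'" using c(4) v minimal_generating_basis[OF lb S] by simp
  \<comment> \<open>\<open>p\<close> is the permutation of indices between the given enumeration and
    the one known to be a basis; coordinates are permuted by it.\<close>
  define p where "p = inv b' \<circ> b"
  have ib': "inj b'" by (rule lattice_basis_inj[OF lb])
  have bp: "b = b' \<circ> p" 
  proof
    fix k
    have "b k \<in> range b'" using rng by blast
    then show "b k = (b' \<circ> p) k" by (simp add: p_def f_inv_into_f)
  qed
  have "inj p" using c(3) unfolding bp by (rule inj_on_imageI2)
  then have bij: "bij p" by (simp add: finite_UNIV_inj_surj bij_def)
  have re: "(\<Sum>k\<in>UNIV. c $ k *s b k) = (\<Sum>k\<in>UNIV. c $ (inv p k) *s b' k)" for c :: "int ^ 'n"
    using bij sum.reindex_bij_betw[OF bij, of "\<lambda>k. c $ (inv p k) *s b' k"]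
    by (simp add: bp bij_is_inj)
  have b: "lattice_basis b"
    unfolding lattice_basis_def
  proof
    fix m
    show "\<exists>!c :: int ^ 'n. m = (\<Sum>k\<in>UNIV. c $ k *s b k)"
    proof (rule ex1I[of _ "\<chi> k. lcoord b' m $ p k"])
      have "(\<chi> k. lcoord b' m $ p k) $ inv p k = lcoord b' m $ k" for k
        using bij by (simp add: surj_f_inv_f bij_is_surj)
      then show "m = (\<Sum>k\<in>UNIV. (\<chi> k. lcoord b' m $ p k) $ k *s b k)"
        unfolding re by (simp only: lcoord_expansion[OF lb])
      fix c :: "int ^ 'n" assume "m = (\<Sum>k\<in>UNIV. c $ k *s b k)"
      then have "m = (\<Sum>k\<in>UNIV. (\<chi> k. c $ inv p k) $ k *s b' k)" unfolding re by simp
      then have "lcoord b' m = (\<chi> k. c $ inv p k)" by (rule lcoord_unique[OF lb])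
      then show "c = (\<chi> k. lcoord b' m $ p k)" using bij by (simp add: vec_eq_iff bij_is_inj)
    qed
  qed
  have "lcoord b m = (\<chi> k. lcoord b' m $ p k)" for m
  proof (rule lcoord_unique[OF b])
    have "(\<chi> k. lcoord b' m $ p k) $ inv p k = lcoord b' m $ k" for k
      using bij by (simp add: surj_f_inv_f bij_is_surj)
    then show "m = (\<Sum>k\<in>UNIV. (\<chi> k. lcoord b' m $ p k) $ k *s b k)"
      unfolding re by (simp only: lcoord_expansion[OF lb])
  qed
  then have "(\<forall>k. 0 \<le> lcoord b m $ k) \<longleftrightarrow> (\<forall>k. 0 \<le> lcoord b' m $ k)" for m
    using bij by (simp) (metis bij_pointE)
  then have "vchart v b" using b v S by (auto simp: vchart_def)
  then show "\<exists>v b. c = (vcone {v}, b) \<and> vchart v b" using c v by blast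
next
  assume "\<exists>v b. c = (vcone {v}, b) \<and> vchart v b"
  then obtain v b where c: "c = (vcone {v}, b)" "vchart v b" by blast
  note lb = vchartD(2)[OF c(2)]
  have S: "cone_monoid (vcone {v}) = {m. \<forall>k. 0 \<le> lcoord b m $ k}" using c by (simp add: vchart_def)
  show "c \<in> charts (normal_fan P)"
    using c minimal_generating_basis[OF lb S] lattice_basis_inj[OF lb] max_cones_iff vchartD(1)[OF c(2)]
    by (auto simp: charts_def)
qed

text \<open>Otherwise, a large multiple of the sum of the other dual vectors minus the \<open>j\<close>-th one would lie in
  the normal cone.\<close>

lemma vertex_along_basis:
  assumes b: "vchart w b"
  shows "\<exists>u\<in>verts. \<exists>c>0. u - w = c *s b j"
proof (rule ccontr)
  assume none: "\<not> (\<exists>u\<in>verts. \<exists>c>0. u - w = c *s b j)"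
  note lb = vchartD(2)[OF b]
  have wv: "w \<in> verts" using vchartD(1)[OF b] .
  \<comment> \<open>\<open>N\<close> bounds the \<open>j\<close>-th coordinate of each vertex. By
    integrality, a vertex with another nonzero coordinate has the sum of its other coordinates at
    least 1, so \<open>N\<close> times that sum dominates.\<close>
  define N where "N = (\<Sum>u\<in>verts. lcoord b (u - w) $ j)"
  define f where "f = of_int N *\<^sub>R (\<Sum>l\<in>UNIV-{j}. dual_vec b l) - dual_vec b j"
  have ip: "emb m \<bullet> f = of_int (N * (\<Sum>l\<in>UNIV-{j}. lcoord b m $ l) - lcoord b m $ j)" for m
    unfolding f_def by (simp add: inner_diff_right inner_sum_right dual_vec[OF lb])
  have "f \<in> vcone {w}"
  proof -
    have "0 \<le> emb (u - w) \<bullet> f" if u: "u \<in> verts" for u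
    proof -
      have nn: "0 \<le> lcoord b (u - w) $ k" for k using vchart_coord_nonneg[OF b u] .
      have jN: "lcoord b (u - w) $ j \<le> N" unfolding N_def
        by (rule member_le_sum[OF u]) (use finite_verts vchart_coord_nonneg[OF b] in auto)
      show ?thesis
      proof (cases "\<exists>l. l \<noteq> j \<and> lcoord b (u - w) $ l \<noteq> 0")
        case True
        then obtain l where l: "l \<noteq> j" "lcoord b (u - w) $ l \<noteq> 0" by blast
        have "lcoord b (u - w) $ l \<le> (\<Sum>l\<in>UNIV-{j}. lcoord b (u - w) $ l)"
          by (rule member_le_sum) (use l nn in auto)
        then have "1 \<le> (\<Sum>l\<in>UNIV-{j}. lcoord b (u - w) $ l)" using l(2) nn[of l] by linarith
        then have "N * 1 \<le> N * (\<Sum>l\<in>UNIV-{j}. lcoord b (u - w) $ l)"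
          using jN nn[of j] by (intro mult_left_mono) auto
        then have "lcoord b (u - w) $ j \<le> N * (\<Sum>l\<in>UNIV-{j}. lcoord b (u - w) $ l)" using jN by linarith
        then show ?thesis by (simp only: ip of_int_0_le_iff diff_ge_0_iff_ge)
      next
        case False
        then have e: "lcoord b (u - w) = lcoord b (u - w) $ j *s axis j 1"
          by (auto simp: vec_eq_iff axis_def)
        have "u - w = lcoord b (u - w) $ j *s b j"
        proof -
          have "(\<Sum>k\<in>UNIV. lcoord b (u - w) $ k *s b k) = (\<Sum>k\<in>UNIV. if k = j then lcoord b (u - w) $ j *s b j else 0)"
            using False by (intro sum.cong) auto
          then show ?thesis by (simp add: lcoord_expansion[OF lb])
        qed
        then have "\<not> lcoord b (u - w) $ j > 0" using none u by blast
        then have "lcoord b (u - w) $ j = 0" using nn[of j] by simp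
        then have "lcoord b (u - w) = 0" using False by (auto simp: vec_eq_iff)
        then have "u - w = 0" using lcoord_expansion[OF lb, of "u - w"] by simp
        then show ?thesis by (simp add: emb_0)
      qed
    qed
    then show ?thesis using mem_vcone_iff[of "{w}"] wv by auto
  qed
  \<comment> \<open>By construction \<open>f\<close> takes the value -1 on \<open>b j\<close>,
    whereas members of the normal cone are nonnegative on the basis.\<close>
  then have "0 \<le> emb (b j) \<bullet> f" by (rule basis_inner_nonneg[OF b])
  then show False unfolding ip lcoord_basis[OF lb] by (simp add: axis_def)
qed

end

section \<open>Points, characters and the sets C\<close>

lemma cone_monoid_0: "0 \<in> cone_monoid \<sigma>"
  by (simp add: cone_monoid_def dual_cone_def emb_0)

lemma cone_monoid_add: "m \<in> cone_monoid \<sigma> \<Longrightarrow> m' \<in> cone_monoid \<sigma> \<Longrightarrow> m + m' \<in> cone_monoid \<sigma>"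
  by (simp add: cone_monoid_def dual_cone_def emb_add inner_add_left)

lemma restrict_affine_points:
  assumes "f \<in> affine_points \<sigma>" "cone_monoid \<tau> \<subseteq> cone_monoid \<sigma>"
  shows "restrict f (cone_monoid \<tau>) \<in> affine_points \<tau>"
  using assms cone_monoid_0[of \<tau>] cone_monoid_add[of _ \<tau>]
  by (auto simp: affine_points_def subset_iff)

lemma affine_points_extensional: "f \<in> affine_points \<sigma> \<Longrightarrow> restrict f (cone_monoid \<sigma>) = f"
  by (simp add: affine_points_def extensional_restrict)

lemma restrict_restrict_subset: "B \<subseteq> A \<Longrightarrow> restrict (restrict f A) B = restrict f B"
  by (auto simp: restrict_def fun_eq_iff)

lemma lookup_single_times:
  fixes g :: "'a::ab_group_add \<Rightarrow>\<^sub>0 'b::semiring_1"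
  shows "Poly_Mapping.lookup (Poly_Mapping.single m 1 * g) k = Poly_Mapping.lookup g (k - m)"
proof -
  have "(k = m + q) \<longleftrightarrow> (q = k - m)" for q by (auto simp: algebra_simps)
  then show ?thesis by (simp add: lookup_mult lookup_single when_mult)
qed

lemma keys_single_times:
  fixes g :: "'a::ab_group_add \<Rightarrow>\<^sub>0 'b::semiring_1"
  shows "Poly_Mapping.keys (Poly_Mapping.single m 1 * g) = (+) m ` Poly_Mapping.keys g"
proof (intro set_eqI iffI)
  fix k assume "k \<in> Poly_Mapping.keys (Poly_Mapping.single m 1 * g)"
  then have "k - m \<in> Poly_Mapping.keys g" by (simp add: in_keys_iff lookup_single_times)
  then show "k \<in> (+) m ` Poly_Mapping.keys g" by (force intro: image_eqI[of _ _ "k - m"])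
qed (auto simp: in_keys_iff lookup_single_times)

lemma eval_at_single_times:
  assumes "\<And>k. k \<in> Poly_Mapping.keys g \<Longrightarrow> z (m + k) = z m * z k"
  shows "eval_at z (Poly_Mapping.single m 1 * g) = z m * eval_at z g"
proof -
  have inj: "inj_on ((+) m) (Poly_Mapping.keys g)" by (simp add: inj_on_def)
  have "eval_at z (Poly_Mapping.single m 1 * g)
      = (\<Sum>k\<in>Poly_Mapping.keys g. Poly_Mapping.lookup g k * z (m + k))"
    unfolding eval_at_def keys_single_times by (simp add: sum.reindex[OF inj] lookup_single_times)
  also have "\<dots> = (\<Sum>k\<in>Poly_Mapping.keys g. z m * (Poly_Mapping.lookup g k * z k))"
    using assms by (intro sum.cong) auto
  finally show ?thesis by (simp add: eval_at_def sum_distrib_left)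
qed

lemma eval_at_restrict: "Poly_Mapping.keys g \<subseteq> T \<Longrightarrow> eval_at (restrict z T) g = eval_at z g"
  unfolding eval_at_def by (intro sum.cong) auto

context smooth_polytope
begin

abbreviation Fan :: "(real ^ 'n) set set" where "Fan \<equiv> normal_fan P"

abbreviation vmonoid :: "(int ^ 'n) set \<Rightarrow> (int ^ 'n) set" where
  "vmonoid A \<equiv> cone_monoid (vcone A)"

lemma vmonoid_mono: "A \<subseteq> B \<Longrightarrow> vmonoid A \<subseteq> vmonoid B"
  by (intro cone_monoid_antimono vcone_mono)

text \<open>The monoid of \<open>vcone A\<close> is a localisation of the free monoid at
  \<open>v\<close>, so a point is determined by its values on the basis. For \<open>a\<close> in
  \<open>A\<close> both \<open>a - v\<close> and \<open>v - a\<close> belong to the monoid, which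
  makes the value at \<open>a - v\<close> a unit.\<close>

lemma affine_points_vcone:
  assumes b: "vchart v b" and A: "v \<in> A" "A \<subseteq> verts" and f: "f \<in> affine_points (vcone A)"
  shows "f = restrict (monomial b (\<chi> k. f (b k))) (vmonoid A)"
    and "\<And>m. m \<in> vmonoid A \<Longrightarrow> f m = monomial b (\<chi> k. f (b k)) m"
    and "\<And>a. a \<in> A \<Longrightarrow> monomial b (\<chi> k. f (b k)) (a - v) \<noteq> 0"
proof -
  have f0: "f 0 = 1" and fm: "\<And>m m'. m \<in> vmonoid A \<Longrightarrow> m' \<in> vmonoid A \<Longrightarrow> f (m + m') = f m * f m'"
    using f by (auto simp: affine_points_def)
  show eq: "f m = monomial b (\<chi> k. f (b k)) m" if "m \<in> vmonoid A" for m
    by (rule multiplicative_eq_monomial(1)[OF vchartD(2)[OF b] cone_monoid_vcone[OF b A] f0 fm that])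
  show "f = restrict (monomial b (\<chi> k. f (b k))) (vmonoid A)"
  proof
    fix m
    show "f m = restrict (monomial b (\<chi> k. f (b k))) (vmonoid A) m"
      using eq[of m] fun_cong[OF affine_points_extensional[OF f], of m] by (auto simp: restrict_def)
  qed
  fix a assume a: "a \<in> A"
  have "a - v \<in> vmonoid A" "v - a \<in> vmonoid A"
    using diff_in_cone_monoid[of v A a] diff_in_cone_monoid[of a A v] a A by auto
  then have "f (a - v) * f (v - a) = 1" using fm[of "a - v" "v - a"] f0 by simp
  then show "monomial b (\<chi> k. f (b k)) (a - v) \<noteq> 0" using eq[of "a - v"] \<open>a - v \<in> vmonoid A\<close> by auto
qed

lemma regular_exponent_vmonoid:
  assumes b: "vchart v b" and A: "v \<in> A" "A \<subseteq> verts"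
    and nz: "\<forall>a\<in>A. monomial b y (a - v) \<noteq> 0" and m: "m \<in> vmonoid A"
  shows "regular_exponent b y m"
  unfolding regular_exponent_def
proof (intro allI impI)
  fix k assume "y $ k = 0"
  then have "\<forall>a\<in>A. lcoord b (a - v) $ k = 0" using nz by (auto simp: monomial_nonzero_iff)
  then show "0 \<le> lcoord b m $ k" using m cone_monoid_vcone[OF b A, of m] by blast
qed

lemma monomial_affine_points:
  assumes b: "vchart v b" and A: "v \<in> A" "A \<subseteq> verts"
    and nz: "\<forall>a\<in>A. monomial b y (a - v) \<noteq> 0"
  shows "restrict (monomial b y) (vmonoid A) \<in> affine_points (vcone A)"
  using regular_exponent_vmonoid[OF b A nz] monomial_add[OF vchartD(2)[OF b]]
    monomial_0[OF vchartD(2)[OF b]] cone_monoid_0[of "vcone A"] cone_monoid_add[of _ "vcone A"]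
  by (auto simp: affine_points_def)

lemma monomial_affine_points_vertex:
  assumes "vchart v b"
  shows "restrict (monomial b y) (vmonoid {v}) \<in> affine_points (vcone {v})"
  using monomial_affine_points[OF assms, of "{v}" y] vchartD(1)[OF assms]
  by (simp add: monomial_0[OF vchartD(2)[OF assms]])

lemma basis_in_vmonoid: "vchart v b \<Longrightarrow> b k \<in> vmonoid {v}"
  by (simp add: vchartD(3) lcoord_basis[OF vchartD(2)] axis_def)

section \<open>Gluing and coordinates of points\<close>

text \<open>Only transitivity has content: the two gluing witnesses live over different
  intersections of cones. In the chart of a vertex of the middle cone both are monomials in the same
  coordinates, so one monomial serves over all three cones and restricts to the outer two.\<close>

lemma equiv_glue_rel: "equiv (SIGMA \<sigma>:Fan. affine_points \<sigma>) (glue_rel Fan)"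
proof (rule equivI)
  show "glue_rel Fan \<subseteq> (SIGMA \<sigma>:Fan. affine_points \<sigma>) \<times> (SIGMA \<sigma>:Fan. affine_points \<sigma>)"
    by (auto simp: glue_rel_def)
  show "refl_on (SIGMA \<sigma>:Fan. affine_points \<sigma>) (glue_rel Fan)"
    unfolding refl_on_def glue_rel_def
    by (auto simp: affine_points_extensional)
  show "sym (glue_rel Fan)"
    unfolding sym_def glue_rel_def by (auto simp: Int_commute)
  show "trans (glue_rel Fan)"
  proof (rule transI)
    fix p q r assume pq: "(p, q) \<in> glue_rel Fan" and qr: "(q, r) \<in> glue_rel Fan"
    obtain \<sigma> f where p: "p = (\<sigma>, f)" by (cases p)
    obtain \<tau> g where q: "q = (\<tau>, g)" by (cases q)
    obtain \<rho> h where r: "r = (\<rho>, h)" by (cases r)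
    have 1: "p = (\<sigma>, f)" "q = (\<tau>, g)" "\<sigma> \<in> Fan" "\<tau> \<in> Fan" "f \<in> affine_points \<sigma>" "g \<in> affine_points \<tau>"
      and ex1: "\<exists>z\<in>affine_points (\<sigma> \<inter> \<tau>). f = restrict z (cone_monoid \<sigma>) \<and> g = restrict z (cone_monoid \<tau>)"
      using pq by (auto simp: glue_rel_def p q)
    have 2: "r = (\<rho>, h)" "\<rho> \<in> Fan" "h \<in> affine_points \<rho>"
      and ex2: "\<exists>z\<in>affine_points (\<tau> \<inter> \<rho>). g = restrict z (cone_monoid \<tau>) \<and> h = restrict z (cone_monoid \<rho>)"
      using qr by (auto simp: glue_rel_def q r)
    obtain A where A: "A \<subseteq> verts" "A \<noteq> {}" "\<sigma> = vcone A" using normal_fan_vcone[OF 1(3)] .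
    obtain B where B: "B \<subseteq> verts" "B \<noteq> {}" "\<tau> = vcone B" using normal_fan_vcone[OF 1(4)] .
    obtain C where C: "C \<subseteq> verts" "C \<noteq> {}" "\<rho> = vcone C" using normal_fan_vcone[OF 2(2)] .
    have AB: "\<sigma> \<inter> \<tau> = vcone (A \<union> B)" and BC: "\<tau> \<inter> \<rho> = vcone (B \<union> C)" and AC: "\<sigma> \<inter> \<rho> = vcone (A \<union> C)"
      using A B C vcone_Un by auto
    obtain z where z: "z \<in> affine_points (vcone (A \<union> B))" "f = restrict z (vmonoid A)" "g = restrict z (vmonoid B)"
      using ex1 unfolding AB A(3)[symmetric] B(3)[symmetric] by blast
    obtain z' where z': "z' \<in> affine_points (vcone (B \<union> C))" "g = restrict z' (vmonoid B)" "h = restrict z' (vmonoid C)"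
      using ex2 unfolding BC C(3)[symmetric] B(3)[symmetric] by blast
    obtain v where v: "v \<in> B" using B by blast
    obtain b where b: "vchart v b" using vchart_exists v B by blast
    define y where "y = (\<chi> k. g (b k))"
    have bB: "b k \<in> vmonoid B" for k using basis_in_vmonoid[OF b] vmonoid_mono[of "{v}" B] v by blast
    have yz: "(\<chi> k. z (b k)) = y" "(\<chi> k. z' (b k)) = y"
      unfolding y_def using z(3) z'(2) bB by (auto simp: vec_eq_iff) (metis restrict_apply')+
    have vAB: "v \<in> A \<union> B" "A \<union> B \<subseteq> verts" and vBC: "v \<in> B \<union> C" "B \<union> C \<subseteq> verts"
      and vABC: "v \<in> A \<union> B \<union> C" "A \<union> B \<union> C \<subseteq> verts" using v A B C by auto
    note e = affine_points_vcone[OF b vAB z(1), unfolded yz]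
    note e' = affine_points_vcone[OF b vBC z'(1), unfolded yz]
    have "restrict (monomial b y) (vmonoid (A \<union> B \<union> C)) \<in> affine_points (vcone (A \<union> B \<union> C))"
      using e(3) e'(3) by (intro monomial_affine_points[OF b vABC]) auto
    then have "restrict (restrict (monomial b y) (vmonoid (A \<union> B \<union> C))) (vmonoid (A \<union> C)) \<in> affine_points (vcone (A \<union> C))"
      by (rule restrict_affine_points) (rule vmonoid_mono, blast)
    moreover have "vmonoid (A \<union> C) \<subseteq> vmonoid (A \<union> B \<union> C)" by (rule vmonoid_mono) blast
    ultimately have w: "restrict (monomial b y) (vmonoid (A \<union> C)) \<in> affine_points (\<sigma> \<inter> \<rho>)"
      by (simp only: AC restrict_restrict_subset)
    have "f = restrict (restrict (monomial b y) (vmonoid (A \<union> C))) (vmonoid A)"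
      using vmonoid_mono[of A "A \<union> C"] vmonoid_mono[of A "A \<union> B"] e(2)
      unfolding z(2) by (auto simp: restrict_def fun_eq_iff)
    moreover have "h = restrict (restrict (monomial b y) (vmonoid (A \<union> C))) (vmonoid C)"
      using vmonoid_mono[of C "A \<union> C"] vmonoid_mono[of C "B \<union> C"] e'(2)
      unfolding z'(3) by (auto simp: restrict_def fun_eq_iff)
    ultimately show "(p, r) \<in> glue_rel Fan"
      using 1 2 w unfolding glue_rel_def A(3)[symmetric] C(3)[symmetric] by blast
  qed
qed

definition pt :: "int ^ 'n \<Rightarrow> ('n \<Rightarrow> int ^ 'n) \<Rightarrow> complex ^ 'n \<Rightarrow> 'n toric_point" where
  "pt v b y = glue_rel Fan `` {(vcone {v}, restrict (monomial b y) (vmonoid {v}))}"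

lemma vertex_pair_in_Sigma:
  "vchart v b \<Longrightarrow> (vcone {v}, restrict (monomial b y) (vmonoid {v})) \<in> (SIGMA \<sigma>:Fan. affine_points \<sigma>)"
  using monomial_affine_points_vertex vcone_in_normal_fan vchartD(1) by blast

lemma pt_in_toric_variety: "vchart v b \<Longrightarrow> pt v b y \<in> toric_variety Fan"
  unfolding pt_def toric_variety_def by (intro quotientI vertex_pair_in_Sigma)

lemma toric_variety_class:
  assumes "x \<in> toric_variety Fan" "(\<sigma>, f) \<in> x"
  shows "\<sigma> \<in> Fan" "f \<in> affine_points \<sigma>" "x = glue_rel Fan `` {(\<sigma>, f)}"
proof -
  have x: "x \<in> (SIGMA \<sigma>:Fan. affine_points \<sigma>) // glue_rel Fan" using assms(1) by (simp add: toric_variety_def)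
  have "(\<sigma>, f) \<in> (SIGMA \<sigma>:Fan. affine_points \<sigma>)" using in_quotient_imp_subset[OF equiv_glue_rel x] assms(2) by blast
  then show "\<sigma> \<in> Fan" "f \<in> affine_points \<sigma>" by auto
  show "x = glue_rel Fan `` {(\<sigma>, f)}"
  proof -
    obtain p where p: "x = glue_rel Fan `` {p}" using x by (rule quotientE)
    then have "(p, (\<sigma>, f)) \<in> glue_rel Fan" using assms(2) by blast
    then show ?thesis unfolding p by (rule equiv_class_eq[OF equiv_glue_rel])
  qed
qed

text \<open>Since \<open>vcone A\<close> lies inside \<open>vcone {v}\<close>, \<open>f\<close>
  itself witnesses the gluing with its restriction. Hence every point has coordinates in a vertex
  chart.\<close>

lemma class_eq_pt:
  assumes A: "v \<in> A" "A \<subseteq> verts" "vcone A \<in> Fan" and f: "f \<in> affine_points (vcone A)" and b: "vchart v b"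
  shows "glue_rel Fan `` {(vcone A, f)} = pt v b (\<chi> k. f (b k))"
  unfolding pt_def
proof (rule equiv_class_eq[OF equiv_glue_rel])
  let ?g = "restrict (monomial b (\<chi> k. f (b k))) (vmonoid {v})"
  have "vcone A \<inter> vcone {v} = vcone A" using vcone_mono[of "{v}" A] A by auto
  moreover have "?g = restrict f (vmonoid {v})"
    using affine_points_vcone(2)[OF b A(1,2) f] vmonoid_mono[of "{v}" A] A by (auto simp: restrict_def fun_eq_iff)
  moreover have "restrict f (vmonoid {v}) \<in> affine_points (vcone {v})"
    by (rule restrict_affine_points[OF f vmonoid_mono]) (use A in auto)
  ultimately show "((vcone A, f), (vcone {v}, ?g)) \<in> glue_rel Fan"
    unfolding glue_rel_def using A f vcone_in_normal_fan[of v]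
    by (auto simp: affine_points_extensional intro!: bexI[of _ f])
qed

lemma toric_variety_cases:
  assumes "x \<in> toric_variety Fan"
  obtains v b y where "vchart v b" "x = pt v b y"
proof -
  obtain p where p: "p \<in> (SIGMA \<sigma>:Fan. affine_points \<sigma>)" "x = glue_rel Fan `` {p}"
    using assms unfolding toric_variety_def by (rule quotientE)
  then obtain \<sigma> f where 1: "\<sigma> \<in> Fan" "f \<in> affine_points \<sigma>" "x = glue_rel Fan `` {(\<sigma>, f)}" by auto
  obtain A where A: "A \<subseteq> verts" "A \<noteq> {}" "\<sigma> = vcone A" using normal_fan_vcone[OF 1(1)] .
  obtain v where v: "v \<in> A" using A by blast
  obtain b where b: "vchart v b" using vchart_exists v A by blast
  show thesis using that[OF b] class_eq_pt[OF v A(1) _ _ b] 1 A by auto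
qed

text \<open>Both sides describe the same point of the common open set, expanded in the two
  bases.\<close>

lemma transition_monomial:
  assumes b: "vchart v b" and b': "vchart w b'" and nz: "monomial b y (w - v) \<noteq> 0"
    and m: "m \<in> vmonoid {v, w}"
  shows "monomial b' (\<chi> j. monomial b y (b' j)) m = monomial b y m"
proof -
  have A: "v \<in> {v, w}" "w \<in> {v, w}" "{v, w} \<subseteq> verts" using vchartD(1) b b' by auto
  let ?z = "restrict (monomial b y) (vmonoid {v, w})"
  have z: "?z \<in> affine_points (vcone {v, w})"
    using nz by (intro monomial_affine_points[OF b A(1,3)]) (auto simp: monomial_0[OF vchartD(2)[OF b]])
  have "b' j \<in> vmonoid {v, w}" for j using basis_in_vmonoid[OF b', of j] vmonoid_mono[of "{w}" "{v,w}"] by blast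
  then have "(\<chi> j. ?z (b' j)) = (\<chi> j. monomial b y (b' j))" by (simp add: vec_eq_iff)
  then show ?thesis using affine_points_vcone(2)[OF b' A(2,3) z m] m by simp
qed

text \<open>Gluing passes through the monoid of \<open>vcone {v, w}\<close>, in which
  \<open>w - v\<close> is invertible. A common extension exists exactly where that one character is
  nonzero, and then it dictates the coordinates in the second chart.\<close>

lemma pt_eq_iff:
  assumes b: "vchart v b" and b': "vchart w b'"
  shows "pt v b y = pt w b' y' \<longleftrightarrow> monomial b y (w - v) \<noteq> 0 \<and> y' = (\<chi> j. monomial b y (b' j))"
proof -
  let ?f = "restrict (monomial b y) (vmonoid {v})" and ?g = "restrict (monomial b' y') (vmonoid {w})"
  have A: "v \<in> {v, w}" "w \<in> {v, w}" "{v, w} \<subseteq> verts" using vchartD(1) b b' by auto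
  have Int: "vcone {v} \<inter> vcone {w} = vcone {v, w}" using vcone_Un[of "{v}" "{w}"] by (simp add: insert_commute)
  have sub: "vmonoid {v} \<subseteq> vmonoid {v, w}" "vmonoid {w} \<subseteq> vmonoid {v, w}" by (rule vmonoid_mono, blast)+
  have bv: "b k \<in> vmonoid {v}" "b' k \<in> vmonoid {w}" for k using basis_in_vmonoid b b' by auto
  have "pt v b y = pt w b' y' \<longleftrightarrow> ((vcone {v}, ?f), (vcone {w}, ?g)) \<in> glue_rel Fan"
    unfolding pt_def
    using eq_equiv_class_iff[OF equiv_glue_rel vertex_pair_in_Sigma[OF b] vertex_pair_in_Sigma[OF b']] by blast
  also have "\<dots> \<longleftrightarrow> (\<exists>z\<in>affine_points (vcone {v, w}). ?f = restrict z (vmonoid {v}) \<and> ?g = restrict z (vmonoid {w}))"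
    using vertex_pair_in_Sigma[OF b, of y] vertex_pair_in_Sigma[OF b', of y']
    unfolding glue_rel_def Int[symmetric] by blast
  also have "\<dots> \<longleftrightarrow> monomial b y (w - v) \<noteq> 0 \<and> y' = (\<chi> j. monomial b y (b' j))"
  proof
    assume "\<exists>z\<in>affine_points (vcone {v, w}). ?f = restrict z (vmonoid {v}) \<and> ?g = restrict z (vmonoid {w})"
    then obtain z where z: "z \<in> affine_points (vcone {v, w})" "?f = restrict z (vmonoid {v})" "?g = restrict z (vmonoid {w})"
      by blast
    have "z (b k) = y $ k" for k
      using fun_cong[OF z(2), of "b k"] bv(1)[of k] by (simp add: monomial_basis[OF vchartD(2)[OF b]])
    then have y: "(\<chi> k. z (b k)) = y" by (simp add: vec_eq_iff)
    have "y' $ j = monomial b y (b' j)" for j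
      using fun_cong[OF z(3), of "b' j"] bv(2)[of j] sub affine_points_vcone(2)[OF b A(1,3) z(1), of "b' j", unfolded y]
      by (auto simp: monomial_basis[OF vchartD(2)[OF b']])
    then show "monomial b y (w - v) \<noteq> 0 \<and> y' = (\<chi> j. monomial b y (b' j))"
      using affine_points_vcone(3)[OF b A(1,3) z(1), of w, unfolded y] by (auto simp: vec_eq_iff)
  next
    assume *: "monomial b y (w - v) \<noteq> 0 \<and> y' = (\<chi> j. monomial b y (b' j))"
    let ?z = "restrict (monomial b y) (vmonoid {v, w})"
    have "?z \<in> affine_points (vcone {v, w})"
      using * by (intro monomial_affine_points[OF b A(1,3)]) (auto simp: monomial_0[OF vchartD(2)[OF b]])
    moreover have "?f = restrict ?z (vmonoid {v})" by (rule restrict_restrict_subset[OF sub(1), symmetric])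
    moreover have "?g = restrict ?z (vmonoid {w})"
      using sub(2) transition_monomial[OF b b', of y] * by (auto simp: restrict_def fun_eq_iff)
    ultimately show "\<exists>z\<in>affine_points (vcone {v, w}). ?f = restrict z (vmonoid {v}) \<and> ?g = restrict z (vmonoid {w})"
      by blast
  qed
  finally show ?thesis .
qed

lemma affine_open_iff:
  assumes b: "vchart w b"
  shows "x \<in> affine_open Fan (vcone {w}) \<longleftrightarrow> (\<exists>y. x = pt w b y)"
proof
  assume "x \<in> affine_open Fan (vcone {w})"
  then obtain f where x: "x \<in> toric_variety Fan" "(vcone {w}, f) \<in> x" by (auto simp: affine_open_def)
  note c = toric_variety_class[OF x]
  show "\<exists>y. x = pt w b y"
    using class_eq_pt[of w "{w}" f b] c b vchartD(1)[OF b] by auto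
next
  assume "\<exists>y. x = pt w b y"
  then obtain y where x: "x = pt w b y" by blast
  have "(vcone {w}, restrict (monomial b y) (vmonoid {w})) \<in> x"
    unfolding x pt_def by (rule equiv_class_self[OF equiv_glue_rel vertex_pair_in_Sigma[OF b]])
  then show "x \<in> affine_open Fan (vcone {w})"
    using x pt_in_toric_variety[OF b] by (auto simp: affine_open_def)
qed

lemma pt_in_affine_open_iff:
  assumes b: "vchart v b" and w: "w \<in> verts"
  shows "pt v b y \<in> affine_open Fan (vcone {w}) \<longleftrightarrow> monomial b y (w - v) \<noteq> 0"
proof -
  obtain b' where b': "vchart w b'" using vchart_exists[OF w] .
  show ?thesis unfolding affine_open_iff[OF b'] pt_eq_iff[OF b b'] by blast
qed

section \<open>Values of characters\<close>

text \<open>A fraction may be given over any cone and any representative. The gluing witness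
  \<open>z\<close> lives over a cone that also accounts for \<open>w\<close>, so numerator and
  denominator can be evaluated in a single monoid together with the coordinates at
  \<open>w\<close>.\<close>

lemma has_value_at_pt_gen:
  assumes b: "vchart w b" and h: "has_value_at Fan m (pt w b y) a"
  obtains z A f g where "A \<subseteq> verts" "w \<in> A" "z \<in> affine_points (vcone A)"
    "Poly_Mapping.keys f \<subseteq> vmonoid A" "Poly_Mapping.keys g \<subseteq> vmonoid A" "eval_at z g \<noteq> 0"
    "Poly_Mapping.single m 1 * g = f" "a = eval_at z f / eval_at z g"
    "\<And>m. m \<in> vmonoid {w} \<Longrightarrow> z m = monomial b y m"
proof -
  let ?f0 = "restrict (monomial b y) (vmonoid {w})"
  obtain \<sigma> f' f g where h: "\<sigma> \<in> Fan" "(\<sigma>, f') \<in> pt w b y"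
     "Poly_Mapping.keys f \<subseteq> cone_monoid \<sigma>" "Poly_Mapping.keys g \<subseteq> cone_monoid \<sigma>"
     "eval_at f' g \<noteq> 0" "Poly_Mapping.single m 1 * g = f" "a = eval_at f' f / eval_at f' g"
    using h unfolding has_value_at_def by blast
  obtain A where A: "A \<subseteq> verts" "A \<noteq> {}" "\<sigma> = vcone A" using normal_fan_vcone[OF h(1)] .
  have "((vcone {w}, ?f0), (\<sigma>, f')) \<in> glue_rel Fan" using h(2) by (simp add: pt_def)
  then obtain z where z: "z \<in> affine_points (vcone {w} \<inter> \<sigma>)" "?f0 = restrict z (vmonoid {w})"
    "f' = restrict z (cone_monoid \<sigma>)"
    by (auto simp: glue_rel_def)
  have Int: "vcone {w} \<inter> \<sigma> = vcone (insert w A)" using vcone_Un[of "{w}" A] A by simp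
  have e: "eval_at f' f = eval_at z f" "eval_at f' g = eval_at z g"
    unfolding z(3) using eval_at_restrict h by blast+
  have sub: "cone_monoid \<sigma> \<subseteq> vmonoid (insert w A)" unfolding A(3) by (rule vmonoid_mono) blast
  have "z m = monomial b y m" if "m \<in> vmonoid {w}" for m using fun_cong[OF z(2), of m] that by simp
  then show thesis
    using that[of "insert w A" z f g] A h z(1) vchartD(1)[OF b] sub unfolding Int e by blast
qed

lemma eval_at_single_times_vcone:
  assumes "z \<in> affine_points (vcone A)" "m \<in> vmonoid A" "Poly_Mapping.keys g \<subseteq> vmonoid A"
  shows "eval_at z (Poly_Mapping.single m 1 * g) = z m * eval_at z g"
  using assms by (intro eval_at_single_times) (auto simp: affine_points_def subset_iff)

text \<open>The value does not depend on the fraction, which is what makes the definite description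
  in \<open>character\<close> meaningful.\<close>

lemma has_value_at_pt:
  assumes b: "vchart w b" and m: "m \<in> vmonoid {w}"
  shows "has_value_at Fan m (pt w b y) a \<longleftrightarrow> a = monomial b y m"
proof
  assume "has_value_at Fan m (pt w b y) a"
  then obtain z A f g where h: "A \<subseteq> verts" "w \<in> A" "z \<in> affine_points (vcone A)"
    "Poly_Mapping.keys g \<subseteq> vmonoid A" "eval_at z g \<noteq> 0"
    "Poly_Mapping.single m 1 * g = f" "a = eval_at z f / eval_at z g" "z m = monomial b y m"
    using has_value_at_pt_gen[OF b] m by metis
  have "m \<in> vmonoid A" using m vmonoid_mono[of "{w}" A] h(2) by blast
  then show "a = monomial b y m"
    using eval_at_single_times_vcone[OF h(3) _ h(4), of m] h by auto
next
  assume a: "a = monomial b y m"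
  let ?f = "restrict (monomial b y) (vmonoid {w})"
  have "(vcone {w}, ?f) \<in> pt w b y"
    unfolding pt_def by (rule equiv_class_self[OF equiv_glue_rel vertex_pair_in_Sigma[OF b]])
  then show "has_value_at Fan m (pt w b y) a"
    unfolding has_value_at_def
    using m a vcone_in_normal_fan[OF vchartD(1)[OF b]] cone_monoid_0[of "vcone {w}"]
    by (intro bexI[of _ "vcone {w}"] exI[of _ ?f] exI[of _ "Poly_Mapping.single m 1"] exI[of _ 1] conjI)
       (auto simp: eval_at_def monomial_0[OF vchartD(2)[OF b]])
qed

lemma character_pt: "vchart w b \<Longrightarrow> m \<in> vmonoid {w} \<Longrightarrow> character Fan m (pt w b y) = monomial b y m"
  by (simp add: character_def has_value_at_pt)

lemma regular_at_pt: "vchart w b \<Longrightarrow> m \<in> vmonoid {w} \<Longrightarrow> regular_at Fan m (pt w b y)"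
  by (simp add: regular_at_def has_value_at_pt)

text \<open>Regularity of one character forces its inverse to be nonzero: a fraction f / g for
  \<open>v - w\<close> satisfies g = chi^(w - v) f. This is how the regularity demanded in
  \<open>C_set\<close> confines the point to the chart at \<open>w\<close>.\<close>

lemma has_value_at_inverse:
  assumes b: "vchart v b" and w: "w \<in> verts" and h: "has_value_at Fan (v - w) (pt v b y) a"
  shows "monomial b y (w - v) * a = 1"
proof -
  obtain z A f g where h: "A \<subseteq> verts" "v \<in> A" "z \<in> affine_points (vcone A)"
    "Poly_Mapping.keys f \<subseteq> vmonoid A" "eval_at z g \<noteq> 0"
    "Poly_Mapping.single (v - w) 1 * g = f" "a = eval_at z f / eval_at z g"
    "\<And>m. m \<in> vmonoid {v} \<Longrightarrow> z m = monomial b y m"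
    using has_value_at_pt_gen[OF b h] by metis
  have wv: "w - v \<in> vmonoid {v}" using diff_in_cone_monoid[of v "{v}" w] vchartD(1)[OF b] w by auto
  then have wv': "w - v \<in> vmonoid A" using vmonoid_mono[of "{v}" A] h(2) by blast
  have "Poly_Mapping.single (w - v) 1 * f = g"
    unfolding h(6)[symmetric] mult.assoc[symmetric] mult_single by simp
  then have "eval_at z g = z (w - v) * eval_at z f" using eval_at_single_times_vcone[OF h(3) wv' h(4)] by simp
  then show ?thesis using h(5,7) h(8)[OF wv] by simp
qed

lemma pt_change_chart:
  assumes b: "vchart v b" and b': "vchart w b'" and nz: "monomial b y (w - v) \<noteq> 0"
  shows "pt v b y = pt w b' (\<chi> j. monomial b y (b' j))"
  using pt_eq_iff[OF b b'] nz by blast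

lemma character_pt':
  assumes b: "vchart v b" and w: "w \<in> verts" and nz: "monomial b y (w - v) \<noteq> 0" and m: "m \<in> vmonoid {w}"
  shows "character Fan m (pt v b y) = monomial b y m"
proof -
  obtain b' where b': "vchart w b'" using vchart_exists[OF w] .
  have "m \<in> vmonoid {v, w}" using m vmonoid_mono[of "{w}" "{v,w}"] by blast
  then show ?thesis
    unfolding pt_change_chart[OF b b' nz] character_pt[OF b' m] by (rule transition_monomial[OF b b' nz])
qed

section \<open>The sets C in coordinates\<close>

text \<open>The definition tests the whole monoid at \<open>w\<close>, the right-hand side only
  vertices. This is enough because, by \<open>vertex_along_basis\<close>, a positive power of each
  coordinate at \<open>w\<close> is a character \<open>u - w\<close> with \<open>u\<close> a vertex;
  bounded coordinates then bound all characters of the monoid.\<close>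

lemma pt_in_C_set_iff:
  assumes b: "vchart v b" and w: "w \<in> verts"
  shows "pt v b y \<in> C_set Fan (vcone {w}) \<longleftrightarrow>
    (\<forall>u\<in>verts. cmod (monomial b y (u - v)) \<le> cmod (monomial b y (w - v)))"
proof
  assume C: "pt v b y \<in> C_set Fan (vcone {w})"
  have vv: "v \<in> verts" using vchartD(1)[OF b] .
  have vw: "v - w \<in> vmonoid {w}" using diff_in_cone_monoid[of w "{w}" v] w vv by auto
  then have "regular_at Fan (v - w) (pt v b y)" using C by (auto simp: C_set_def)
  then obtain a where "has_value_at Fan (v - w) (pt v b y) a" by (auto simp: regular_at_def)
  then have nz: "monomial b y (w - v) \<noteq> 0" using has_value_at_inverse[OF b w] by force
  show "\<forall>u\<in>verts. cmod (monomial b y (u - v)) \<le> cmod (monomial b y (w - v))"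
  proof
    fix u assume u: "u \<in> verts"
    have uw: "u - w \<in> vmonoid {w}" using diff_in_cone_monoid[of w "{w}" u] w u by auto
    then have "cmod (character Fan (u - w) (pt v b y)) \<le> 1" using C by (auto simp: C_set_def)
    then have le: "cmod (monomial b y (u - w)) \<le> 1" using character_pt'[OF b w nz uw] by simp
    have "regular_exponent b y (u - w)" "regular_exponent b y (w - v)"
      using regular_exponent_vmonoid[OF b, of "{v, w}" y] nz w vv diff_in_cone_monoid[of w "{v,w}" u]
        diff_in_cone_monoid[of v "{v,w}" w] u by (auto simp: monomial_0[OF vchartD(2)[OF b]])
    then have "monomial b y (u - v) = monomial b y (u - w) * monomial b y (w - v)"
      using monomial_add[OF vchartD(2)[OF b], of y "u - w" "w - v"] by simp
    then show "cmod (monomial b y (u - v)) \<le> cmod (monomial b y (w - v))"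
      using le by (simp add: norm_mult mult_left_le_one_le)
  qed
next
  assume le: "\<forall>u\<in>verts. cmod (monomial b y (u - v)) \<le> cmod (monomial b y (w - v))"
  have vv: "v \<in> verts" using vchartD(1)[OF b] .
  \<comment> \<open>The case \<open>u = v\<close> compares with the constant character 1.\<close>
  have nz: "monomial b y (w - v) \<noteq> 0"
    using bspec[OF le vv] by (auto simp: monomial_0[OF vchartD(2)[OF b]])
  obtain b' where b': "vchart w b'" using vchart_exists[OF w] .
  define y' where "y' = (\<chi> j. monomial b y (b' j))"
  have eq: "pt v b y = pt w b' y'" unfolding y'_def by (rule pt_change_chart[OF b b' nz])
  have le1: "cmod (monomial b' y' (u - w)) \<le> 1" if u: "u \<in> verts" for u
  proof -
    have "u - w \<in> vmonoid {v, w}" using diff_in_cone_monoid[of w "{v,w}" u] w vv u by auto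
    then have "monomial b' y' (u - w) = monomial b y (u - w)"
      unfolding y'_def by (rule transition_monomial[OF b b' nz])
    moreover have "regular_exponent b y (u - w)" "regular_exponent b y (w - v)"
      using regular_exponent_vmonoid[OF b, of "{v, w}" y] nz w vv diff_in_cone_monoid[of w "{v,w}" u]
        diff_in_cone_monoid[of v "{v,w}" w] u by (auto simp: monomial_0[OF vchartD(2)[OF b]])
    then have "monomial b y (u - v) = monomial b y (u - w) * monomial b y (w - v)"
      using monomial_add[OF vchartD(2)[OF b], of y "u - w" "w - v"] by simp
    ultimately show ?thesis using bspec[OF le u] nz by (simp add: norm_mult)
  qed
  have "cmod (y' $ j) \<le> 1" for j
  proof -
    obtain u c where u: "u \<in> verts" "c > 0" "u - w = c *s b' j" using vertex_along_basis[OF b'] by blast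
    then have "monomial b' y' (u - w) = y' $ j powi c"
      by (simp add: monomial_smult[OF vchartD(2)[OF b']] monomial_basis[OF vchartD(2)[OF b']])
    then have "cmod (y' $ j) ^ nat c \<le> 1" using le1[OF u(1)] u(2) by (simp add: norm_power_int power_int_nonneg_exp norm_power)
    then show ?thesis using power_le_one_iff[of "cmod (y' $ j)" "nat c"] u(2) by auto
  qed
  then have "cmod (character Fan m (pt w b' y')) \<le> 1" if "m \<in> vmonoid {w}" for m
    using character_pt[OF b' that] norm_monomial_le_one[of y' b' m] that vchartD(3)[OF b'] by auto
  then show "pt v b y \<in> C_set Fan (vcone {w})"
    unfolding eq C_set_def using pt_in_toric_variety[OF b'] regular_at_pt[OF b'] by auto
qed

text \<open>In its own chart the set is the closed unit polydisc, which gives access to its interior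
  and to radial approximation from inside.\<close>

lemma pt_in_own_C_set_iff:
  assumes b: "vchart w b"
  shows "pt w b y \<in> C_set Fan (vcone {w}) \<longleftrightarrow> (\<forall>j. cmod (y $ j) \<le> 1)"
proof
  assume "pt w b y \<in> C_set Fan (vcone {w})"
  then have "cmod (character Fan (b j) (pt w b y)) \<le> 1" for j
    using basis_in_vmonoid[OF b] by (auto simp: C_set_def)
  then show "\<forall>j. cmod (y $ j) \<le> 1"
    using character_pt[OF b basis_in_vmonoid[OF b]] by (simp add: monomial_basis[OF vchartD(2)[OF b]])
next
  assume "\<forall>j. cmod (y $ j) \<le> 1"
  then have "cmod (character Fan m (pt w b y)) \<le> 1" if "m \<in> vmonoid {w}" for m
    using character_pt[OF b that] norm_monomial_le_one[of y b m] that vchartD(3)[OF b] by auto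
  then show "pt w b y \<in> C_set Fan (vcone {w})"
    unfolding C_set_def using pt_in_toric_variety[OF b] regular_at_pt[OF b] by auto
qed

lemma C_set_cover:
  assumes x: "x \<in> toric_variety Fan"
  obtains w where "w \<in> verts" "x \<in> C_set Fan (vcone {w})"
proof -
  obtain v b y where b: "vchart v b" and x: "x = pt v b y" using toric_variety_cases[OF x] .
  let ?h = "\<lambda>u. cmod (monomial b y (u - v))"
  have fin: "finite (?h ` verts)" "?h ` verts \<noteq> {}" using finite_verts verts_nonempty by auto
  obtain w where w: "w \<in> verts" "?h w = Max (?h ` verts)" using Max_in[OF fin] by fastforce
  then have "\<forall>u\<in>verts. ?h u \<le> ?h w" using fin by simp
  then show thesis using that[OF w(1)] pt_in_C_set_iff[OF b w(1)] x by simp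
qed

lemma C_set_subset_affine_open:
  assumes "w \<in> verts" shows "C_set Fan (vcone {w}) \<subseteq> affine_open Fan (vcone {w})"
proof
  fix x assume x: "x \<in> C_set Fan (vcone {w})"
  then obtain v b y where b: "vchart v b" and e: "x = pt v b y"
    using toric_variety_cases[of x] by (auto simp: C_set_def)
  have "cmod (monomial b y (v - v)) \<le> cmod (monomial b y (w - v))"
    using x pt_in_C_set_iff[OF b assms] vchartD(1)[OF b] unfolding e by blast
  then show "x \<in> affine_open Fan (vcone {w})"
    unfolding e pt_in_affine_open_iff[OF b assms] by (auto simp: monomial_0[OF vchartD(2)[OF b]])
qed

end

section \<open>Jacobians of monomial coordinate changes\<close>

definition mcnj :: "complex ^ 'n ^ 'm \<Rightarrow> complex ^ 'n ^ 'm" where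
  "mcnj M = (\<chi> i j. cnj (M $ i $ j))"

text \<open>A complex-linear map \<open>M\<close> acts on the differentials dz by \<open>M\<close>
  and on their conjugates by \<open>mcnj M\<close>. The determinant of the resulting block matrix is
  the factor by which \<open>mu0\<close> is multiplied; it is evaluated for unimodular and for
  diagonal matrices.\<close>

definition block_diag :: "'a::zero ^ 'n ^ 'n \<Rightarrow> 'a ^ 'n ^ 'n \<Rightarrow> 'a ^ ('n \<times> bool) ^ ('n \<times> bool)" where
  "block_diag M N = (\<chi> r s. if snd r = snd s then (if snd r then N else M) $ fst r $ fst s else 0)"

lemma sum_UNIV_prod_bool:
  fixes f :: "'n::finite \<times> bool \<Rightarrow> 'a::comm_monoid_add"
  shows "(\<Sum>t\<in>UNIV. f t) = (\<Sum>k\<in>UNIV. f (k, False) + f (k, True))"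
proof -
  have "(\<Sum>t\<in>UNIV. f t) = (\<Sum>k\<in>UNIV. \<Sum>s\<in>UNIV. f (k, s))"
    unfolding UNIV_Times_UNIV[symmetric] by (simp only: sum.cartesian_product)
      (simp add: split_beta)
  then show ?thesis by (simp add: UNIV_bool add.commute)
qed

lemma prod_UNIV_prod_bool:
  fixes f :: "'n::finite \<times> bool \<Rightarrow> 'a::comm_monoid_mult"
  shows "(\<Prod>t\<in>UNIV. f t) = (\<Prod>k\<in>UNIV. f (k, False) * f (k, True))"
proof -
  have "(\<Prod>t\<in>UNIV. f t) = (\<Prod>k\<in>UNIV. \<Prod>s\<in>UNIV. f (k, s))"
    unfolding UNIV_Times_UNIV[symmetric] by (simp only: prod.cartesian_product)
      (simp add: split_beta)
  then show ?thesis by (simp add: UNIV_bool mult.commute)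
qed

lemma block_diag_mult:
  fixes M :: "'a::semiring_1 ^ 'n::finite ^ 'n"
  shows "block_diag M N ** block_diag M' N' = block_diag (M ** M') (N ** N')"
  by (auto simp: vec_eq_iff matrix_matrix_mult_def block_diag_def sum_UNIV_prod_bool)

lemma block_diag_id: "block_diag (mat 1) (mat 1) = (mat 1 :: 'a::semiring_1 ^ ('n \<times> bool) ^ ('n::finite \<times> bool))"
  by (auto simp: vec_eq_iff block_diag_def mat_def prod_eq_iff)

lemma mcnj_mult: "mcnj (M ** N) = mcnj M ** mcnj N"
  by (simp add: mcnj_def matrix_matrix_mult_def vec_eq_iff)

lemma dcoord_matrix_vector:
  "dcoord r (M *v w) = (\<Sum>s\<in>UNIV. block_diag M (mcnj M) $ r $ s * dcoord s w)"
  by (cases "snd r") (simp_all add: dcoord_def block_diag_def mcnj_def sum_UNIV_prod_bool matrix_vector_mult_def)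

lemma wedge_matrix_vector:
  "wedge dcoord (\<lambda>s. M *v v s) = det (block_diag M (mcnj M)) * wedge dcoord v"
  unfolding wedge_def det_mul[symmetric]
  by (rule arg_cong[of _ _ det]) (simp add: vec_eq_iff matrix_matrix_mult_def dcoord_matrix_vector)

lemma det_permute_both:
  fixes A :: "'a::comm_ring_1 ^ 'n::finite ^ 'n"
  assumes p: "p permutes UNIV"
  shows "det (\<chi> i j. A $ p i $ p j) = det A"
proof -
  have "det (\<chi> i j. A $ p i $ p j) = det (\<chi> i. (\<chi> i j. A $ i $ p j) $ p i)" by simp
  also have "\<dots> = of_int (sign p) * det (\<chi> i j. A $ i $ p j)" by (rule det_permute_rows[OF p])
  also have "\<dots> = of_int (sign p) * (of_int (sign p) * det A)" by (simp add: det_permute_columns[OF p])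
  also have "\<dots> = of_int (sign p * sign p) * det A" by (simp only: of_int_mult mult.assoc)
  finally show ?thesis by (simp add: sign_idempotent)
qed

definition flip_bool :: "'n \<times> bool \<Rightarrow> 'n \<times> bool" where "flip_bool r = (fst r, \<not> snd r)"

lemma flip_bool_permutes: "flip_bool permutes UNIV"
  by (rule bij_imp_permutes[OF o_bij[of flip_bool]]) (auto simp: flip_bool_def fun_eq_iff)

text \<open>Exchanging the two blocks permutes rows and columns simultaneously, so the signs
  cancel.\<close>

lemma det_block_diag_swap:
  fixes M :: "'a::comm_ring_1 ^ 'n::finite ^ 'n"
  shows "det (block_diag N M) = det (block_diag M N)"
proof -
  have "block_diag N M = (\<chi> i j. block_diag M N $ flip_bool i $ flip_bool j)"
    by (simp add: vec_eq_iff block_diag_def flip_bool_def)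
  then show ?thesis using det_permute_both[OF flip_bool_permutes, of "block_diag M N"] by simp
qed

lemma det_in_Ints:
  fixes A :: "'a::comm_ring_1 ^ 'n::finite ^ 'n"
  assumes "\<And>i j. A $ i $ j \<in> \<int>" shows "det A \<in> \<int>"
  unfolding det_def using assms by (intro Ints_sum Ints_mult Ints_prod Ints_of_int)

text \<open>The determinant is the square of an integer unit, hence \<open>1\<close>.\<close>

lemma det_block_diag_unimodular:
  fixes A :: "complex ^ 'n::finite ^ 'n"
  assumes A: "\<And>i j. A $ i $ j \<in> \<int>" and B: "\<And>i j. B $ i $ j \<in> \<int>" and AB: "B ** A = mat 1"
  shows "det (block_diag A A) = 1"
proof -
  \<comment> \<open>A substitute for the determinant of \<open>M\<close>: it is multiplicative and
    integral on integral matrices, and \<open>block_diag A A\<close> splits into two factors on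
    which it agrees.\<close>
  let ?h = "\<lambda>M. det (block_diag M (mat 1))"
  have int: "?h M \<in> \<int>" if "\<And>i j. M $ i $ j \<in> \<int>" for M :: "complex ^ 'n ^ 'n"
    by (rule det_in_Ints) (use that in \<open>auto simp: block_diag_def mat_def\<close>)
  have "?h B * ?h A = 1"
    by (simp add: det_mul[symmetric] block_diag_mult AB block_diag_id)
  moreover obtain i where i: "?h A = of_int i" using int[OF A] by (auto simp: Ints_def)
  moreover obtain j where j: "?h B = of_int j" using int[OF B] by (auto simp: Ints_def)
  ultimately have "(of_int (j * i) :: complex) = of_int 1" by simp
  then have "j * i = 1" by (simp only: of_int_eq_iff)
  then have "i * i = 1" using zmult_eq_1_iff by auto
  have "block_diag A A = block_diag A (mat 1) ** block_diag (mat 1) A" by (simp add: block_diag_mult)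
  then have "det (block_diag A A) = ?h A * ?h A" by (simp add: det_mul det_block_diag_swap[of "mat 1" A])
  also have "\<dots> = of_int (i * i)" by (simp only: i of_int_mult)
  finally show ?thesis using \<open>i * i = 1\<close> by simp
qed

lemma det_block_diag_diagonal:
  fixes d :: "'n::finite \<Rightarrow> complex"
  defines "D \<equiv> \<chi> i j. if i = j then d i else 0"
  shows "det (block_diag D (mcnj D)) = of_real ((cmod (\<Prod>k\<in>UNIV. d k))\<^sup>2)"
proof -
  have "det (block_diag D (mcnj D)) = (\<Prod>t\<in>UNIV. block_diag D (mcnj D) $ t $ t)"
    by (rule det_diagonal) (auto simp: block_diag_def D_def mcnj_def prod_eq_iff)
  also have "\<dots> = (\<Prod>k\<in>UNIV. d k * cnj (d k))"
    by (simp add: prod_UNIV_prod_bool block_diag_def D_def mcnj_def)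
  also have "\<dots> = of_real ((cmod (\<Prod>k\<in>UNIV. d k))\<^sup>2)"
    by (simp only: prod.distrib complex_norm_square cnj_prod)
  finally show ?thesis .
qed

section \<open>Reality and nondegeneracy of the standard volume form\<close>

text \<open>Restricting the exchange to indices in \<open>S\<close> allows induction, each new index
  contributing one transposition.\<close>

lemma flip_bool_on_sign:
  assumes "finite S"
  shows "permutation (\<lambda>r. if fst r \<in> S then flip_bool r else r) \<and>
    sign (\<lambda>r. if fst r \<in> S then flip_bool r else r) = (- 1) ^ card S"
  using assms
proof induction
  case empty
  then show ?case using permutation_id sign_id by (simp add: id_def)
next
  case (insert k S)
  let ?p = "\<lambda>S r. if fst r \<in> S then flip_bool r else r"
  have e: "?p (insert k S) = Transposition.transpose (k, False) (k, True) \<circ> ?p S"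
  proof
    fix r :: "'a \<times> bool"
    show "?p (insert k S) r = (Transposition.transpose (k, False) (k, True) \<circ> ?p S) r"
      using insert(2) by (cases r; cases "snd r") (auto simp: flip_bool_def Transposition.transpose_def)
  qed
  have t: "permutation (Transposition.transpose (k, False) (k, True))" by (rule permutation_swap_id)
  show ?case
    unfolding e using insert t
    by (simp add: permutation_compose sign_compose sign_swap_id)
qed

lemma sign_flip_bool: "sign (flip_bool :: 'n::finite \<times> bool \<Rightarrow> _) = (- 1) ^ CARD('n)"
  using flip_bool_on_sign[of "UNIV :: 'n set"] by (simp add: eta_contract_eq)

lemma cnj_det: "cnj (det A) = det (mcnj A)"
  by (simp add: det_def mcnj_def)

text \<open>Conjugation exchanges dz_k and its conjugate for all k, which costs the sign (-1)^n;
  conjugating the n-th power of the imaginary constant costs the same sign.\<close>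

lemma mu0_real: "mu0 z v \<in> \<real>"
proof -
  have "cnj (wedge dcoord v) = (- 1) ^ CARD('a) * wedge dcoord v"
  proof -
    have "mcnj (\<chi> r s. dcoord r (v s)) = (\<chi> r. (\<chi> r s. dcoord r (v s)) $ flip_bool r)"
      by (simp add: mcnj_def flip_bool_def dcoord_def vec_eq_iff)
    then show ?thesis unfolding wedge_def cnj_det
      using det_permute_rows[OF flip_bool_permutes, of "\<chi> r s. dcoord r (v s)"]
      by (simp add: sign_flip_bool)
  qed
  moreover define c where "c = \<i> / (2 * complex_of_real pi)"
  moreover have "cnj c = - c" by (simp add: c_def)
  ultimately have "cnj (mu0 z v) = (- c) ^ CARD('a) * ((- 1) ^ CARD('a) * wedge dcoord v)"
    by (simp only: mu0_def complex_cnj_mult complex_cnj_power)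
  also have "\<dots> = (- c * - 1) ^ CARD('a) * wedge dcoord v"
    by (simp only: power_mult_distrib mult.assoc)
  also have "\<dots> = mu0 z v" by (simp add: mu0_def c_def)
  finally show ?thesis by (simp only: Reals_cnj_iff)
qed

lemma mu0_nonzero: "\<exists>v. mu0 z v \<noteq> 0"
proof -
  define v :: "'a \<times> bool \<Rightarrow> complex ^ 'a" where
    "v s = axis (fst s) (if snd s then \<i> else 1)" for s
  \<comment> \<open>The inverse, block by block, of the 2 x 2 matrix with rows (1, i) and (1, -i),
    which is the matrix of dz and its conjugate on the vectors 1 and i.\<close>
  define E :: "complex ^ ('a \<times> bool) ^ ('a \<times> bool)" where
    "E = (\<chi> r s. if fst r = fst s then (if snd r then (if snd s then \<i> / 2 else - \<i> / 2) else 1 / 2) else 0)"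
  let ?D = "\<chi> r s. dcoord r (v s)"
  have "(?D ** E) $ (k, x) $ (l, y) = mat 1 $ (k, x) $ (l, y)" for k l x y
  proof -
    have "(?D ** E) $ (k, x) $ (l, y) = (\<Sum>j\<in>UNIV. if j = k then (if k = l then (if x = y then 1 else 0) else 0) else 0)"
      unfolding matrix_matrix_mult_def vec_lambda_beta sum_UNIV_prod_bool
      by (rule sum.cong) (auto simp: dcoord_def v_def E_def axis_def)
    then show ?thesis by (simp add: mat_def)
  qed
  then have "?D ** E = mat 1" by (simp add: vec_eq_iff)
  then have "det ?D * det E = 1" by (metis det_I det_mul)
  then have "wedge dcoord v \<noteq> 0" unfolding wedge_def by auto
  then have "mu0 z v \<noteq> 0" by (simp add: mu0_def)
  then show ?thesis by blast
qed

lemma alternating_multilinear_mu0: "alternating_multilinear (\<lambda>v. c * mu0 z v)"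
  unfolding alternating_multilinear_def
proof (intro conjI allI impI)
  fix v :: "'a \<times> bool \<Rightarrow> complex ^ 'a" and s
  let ?f = "\<lambda>w. wedge dcoord (v(s := w))"
  \<comment> \<open>Transposition turns tangent vectors into rows, where additivity and homogeneity
    of \<open>det\<close> are stated.\<close>
  have row: "?f w = det (\<chi> t. if t = s then (\<chi> r. dcoord r w) else (\<chi> r. dcoord r (v t)))" for w
    unfolding wedge_def by (subst det_transpose[symmetric]) (rule arg_cong[of _ _ det], auto simp: transpose_def vec_eq_iff)
  have "?f (w + w') = ?f w + ?f w'" for w w'
  proof -
    have "(\<chi> r. dcoord r (w + w')) = (\<chi> r. dcoord r w) + (\<chi> r. dcoord r w')"
      by (simp add: vec_eq_iff dcoord_def)
    then show ?thesis unfolding row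
      using det_row_add[of s "\<lambda>_. \<chi> r. dcoord r w" "\<lambda>_. \<chi> r. dcoord r w'" "\<lambda>t. \<chi> r. dcoord r (v t)"]
      by (simp only:)
  qed
  moreover have "?f (a *\<^sub>R w) = a *\<^sub>R ?f w" for a w
  proof -
    have "(\<chi> r. dcoord r (a *\<^sub>R w)) = complex_of_real a *s (\<chi> r. dcoord r w)"
      by (simp add: vec_eq_iff dcoord_def) (simp add: scaleR_conv_of_real)
    then show ?thesis unfolding row
      using det_row_mul[of s "complex_of_real a" "\<lambda>_. \<chi> r. dcoord r w" "\<lambda>t. \<chi> r. dcoord r (v t)"]
      by (simp only: scaleR_conv_of_real)
  qed
  ultimately have "linear ?f" by (intro linearI)
  then show "linear (\<lambda>w. c * mu0 z (v(s := w)))"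
    unfolding mu0_def by (simp add: linear_iff algebra_simps)
next
  fix v :: "'a \<times> bool \<Rightarrow> complex ^ 'a" and s t assume "s \<noteq> t \<and> v s = v t"
  then have "wedge dcoord v = 0" unfolding wedge_def
    by (intro det_identical_columns[of s t]) (auto simp: column_def)
  then show "c * mu0 z v = 0" by (simp add: mu0_def)
qed

text \<open>An exponent of \<open>b\<close> that is not invertible in the common localisation is also the dual of an element of
  \<open>b'\<close>, so that it pairs to \<open>1\<close> with the sum of either basis.\<close>

lemma sum_basis_diff_coord_zero:
  assumes b: "lattice_basis b" and b': "lattice_basis b'"
    and K: "\<And>m. (\<forall>k. k \<notin> K \<longrightarrow> 0 \<le> lcoord b m $ k) \<longleftrightarrow> (\<forall>j. j \<notin> K' \<longrightarrow> 0 \<le> lcoord b' m $ j)"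
    and k: "k \<notin> K"
  shows "lcoord b ((\<Sum>j\<in>UNIV. b' j) - (\<Sum>l\<in>UNIV. b l)) $ k = 0"
proof -
  \<comment> \<open>A column and all entries of two mutually inverse integer matrices. The goal is
    that the numbers \<open>?A j\<close> sum to 1.\<close>
  let ?A = "\<lambda>j. lcoord b (b' j) $ k" and ?B = "\<lambda>l j. lcoord b' (b l) $ j"
  have A0: "0 \<le> ?A j" for j
  proof -
    have "\<forall>i. i \<notin> K' \<longrightarrow> 0 \<le> lcoord b' (b' j) $ i" by (simp add: lcoord_basis[OF b'] axis_def)
    then show ?thesis using K[of "b' j"] k by blast
  qed
  have AK: "?A j = 0" if "j \<in> K'" for j
  proof -
    have "\<forall>i. i \<notin> K' \<longrightarrow> 0 \<le> lcoord b' (- b' j) $ i"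
      using that by (auto simp: lcoord_uminus[OF b'] lcoord_basis[OF b'] axis_def)
    then have "0 \<le> lcoord b (- b' j) $ k" using K[of "- b' j"] k by blast
    then show ?thesis using A0[of j] by (simp add: lcoord_uminus[OF b])
  qed
  have B0: "0 \<le> ?B l j" if "j \<notin> K'" for l j
  proof -
    have "\<forall>i. i \<notin> K \<longrightarrow> 0 \<le> lcoord b (b l) $ i" by (simp add: lcoord_basis[OF b] axis_def)
    then show ?thesis using K[of "b l"] that by blast
  qed
  have sum: "(\<Sum>j\<in>UNIV. ?B l j * ?A j) = (if l = k then 1 else 0)" for l
  proof -
    have "b l = (\<Sum>j\<in>UNIV. ?B l j *s b' j)" by (simp add: lcoord_expansion[OF b'])
    from arg_cong[OF this, of "\<lambda>m. lcoord b m $ k"]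
    have "lcoord b (b l) $ k = (\<Sum>j\<in>UNIV. ?B l j * ?A j)"
      by (simp add: lcoord_sum[OF b] lcoord_smult[OF b])
    then show ?thesis by (auto simp: lcoord_basis[OF b] axis_def)
  qed
  have BA: "0 \<le> ?B l j * ?A j" for l j using A0 AK B0 by (cases "j \<in> K'") auto
  \<comment> \<open>For \<open>l \<noteq> k\<close> the nonnegative terms
    \<open>?B l j * ?A j\<close> sum to 0, so where \<open>?A j\<close> is nonzero only the entry
    \<open>?B k j\<close> can survive. It cannot vanish too, and as a nonnegative integer it is at
    least 1.\<close>
  have "?A j \<le> ?B k j * ?A j" for j
  proof (cases "?A j = 0")
    case False
    then have jK: "j \<notin> K'" using AK by blast
    have off: "?B l j = 0" if "l \<noteq> k" for l
    proof -
      have "\<forall>j\<in>UNIV. ?B l j * ?A j = 0"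
        using sum[of l] that BA by (subst sum_nonneg_eq_0_iff[symmetric]) auto
      then show ?thesis using False by auto
    qed
    have "?B k j \<noteq> 0"
    proof
      assume z: "?B k j = 0"
      have "lcoord b' (b' j) = lcoord b' (\<Sum>l\<in>UNIV. lcoord b (b' j) $ l *s b l)"
        by (simp add: lcoord_expansion[OF b])
      then have "lcoord b' (b' j) $ j = (\<Sum>l\<in>UNIV. lcoord b (b' j) $ l * ?B l j)"
        by (simp add: lcoord_sum[OF b'] lcoord_smult[OF b'])
      also have "\<dots> = 0" using off z by (intro sum.neutral) (metis mult_zero_right)
      finally show False by (simp add: lcoord_basis[OF b'])
    qed
    then have "1 \<le> ?B k j" using B0[OF jK, of k] by linarith
    then show ?thesis using A0[of j] by (simp add: mult_le_cancel_right1)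
  qed simp
  then have "(\<Sum>j\<in>UNIV. ?A j) \<le> 1" using sum_mono[of UNIV ?A "\<lambda>j. ?B k j * ?A j"] sum[of k] by simp
  moreover have "(\<Sum>j\<in>UNIV. ?A j) \<noteq> 0"
  proof
    assume "(\<Sum>j\<in>UNIV. ?A j) = 0"
    then have "\<forall>j\<in>UNIV. ?A j = 0" using A0 by (subst (asm) sum_nonneg_eq_0_iff) auto
    then show False using sum[of k] by simp
  qed
  moreover have "0 \<le> (\<Sum>j\<in>UNIV. ?A j)" using A0 by (intro sum_nonneg) auto
  ultimately have "(\<Sum>j\<in>UNIV. ?A j) = 1" by linarith
  moreover have "(\<Sum>l\<in>UNIV. lcoord b (b l) $ k) = 1" by (simp add: lcoord_basis[OF b] axis_def)
  ultimately show ?thesis by (simp add: lcoord_diff[OF b] lcoord_sum[OF b])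
qed

section \<open>Derivatives of monomial maps\<close>

lemma has_derivative_powi:
  fixes x :: complex
  assumes "x \<noteq> 0 \<or> 0 \<le> n"
  shows "((\<lambda>x. x powi n) has_derivative (\<lambda>h. h * (of_int n * x powi (n - 1)))) (at x)"
proof (cases "x = 0")
  case False
  then show ?thesis using has_derivative_power_int'[of x n UNIV] by simp
next
  case True
  then obtain k where n: "n = int k" using assms nonneg_int_cases by auto
  show ?thesis
  proof (cases k)
    case 0 then show ?thesis by (simp add: n)
  next
    case (Suc j)
    have "((\<lambda>x. x ^ k) has_derivative (\<lambda>h. of_nat k * h * x ^ (k - 1))) (at x)"
      by (rule derivative_eq_intros refl | simp)+
    moreover have "(\<lambda>x. x powi n) = (\<lambda>x::complex. x ^ k)" by (simp add: n)
    moreover have "n - 1 = int j" using n Suc by simp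
    then have "(\<lambda>h. h * (of_int n * x powi (n - 1))) = (\<lambda>h. of_nat k * h * x ^ (k - 1))"
      using n Suc by (simp add: mult_ac)
    ultimately show ?thesis by simp
  qed
qed

text \<open>The factor \<open>k\<close> is left out of the product instead of dividing by
  \<open>y $ k\<close>, so that the formula is also correct on the coordinate hyperplanes.\<close>

definition monomial_partial :: "('n \<Rightarrow> int ^ 'n::finite) \<Rightarrow> complex ^ 'n \<Rightarrow> int ^ 'n \<Rightarrow> 'n \<Rightarrow> complex" where
  "monomial_partial b y m k = of_int (lcoord b m $ k) * y $ k powi (lcoord b m $ k - 1) *
     (\<Prod>l\<in>UNIV - {k}. y $ l powi (lcoord b m $ l))"

lemma has_derivative_monomial:
  assumes "regular_exponent b y m"
  shows "((\<lambda>y. monomial b y m) has_derivative (\<lambda>h. \<Sum>k\<in>UNIV. monomial_partial b y m k * h $ k)) (at y)"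
proof -
  have comp: "((\<lambda>y. y $ k) has_derivative (\<lambda>h. h $ k)) (at y)" for k
    by (rule bounded_linear.has_derivative[OF bounded_linear_vec_nth has_derivative_ident])
  have "((\<lambda>y. y $ k powi (lcoord b m $ k)) has_derivative
      (\<lambda>h. h $ k * (of_int (lcoord b m $ k) * y $ k powi (lcoord b m $ k - 1)))) (at y)" for k
    using assms by (intro has_derivative_compose[OF comp has_derivative_powi]) (auto simp: regular_exponent_def)
  then have "((\<lambda>y. \<Prod>k\<in>UNIV. y $ k powi (lcoord b m $ k)) has_derivative
      (\<lambda>h. \<Sum>k\<in>UNIV. h $ k * (of_int (lcoord b m $ k) * y $ k powi (lcoord b m $ k - 1)) *
         (\<Prod>l\<in>UNIV - {k}. y $ l powi (lcoord b m $ l)))) (at y)"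
    by (intro has_derivative_prod) auto
  then show ?thesis by (simp add: monomial_def monomial_partial_def mult_ac)
qed

definition transition_jacobian :: "('n \<Rightarrow> int ^ 'n::finite) \<Rightarrow> ('n \<Rightarrow> int ^ 'n) \<Rightarrow> complex ^ 'n \<Rightarrow> complex ^ 'n ^ 'n" where
  "transition_jacobian b b' y = (\<chi> j k. monomial_partial b y (b' j) k)"

lemma has_derivative_vec_lambda:
  fixes f :: "'a::real_normed_vector \<Rightarrow> 'n::finite \<Rightarrow> 'b::euclidean_space"
  assumes "\<And>j. ((\<lambda>x. f x j) has_derivative (\<lambda>h. f' h j)) F"
  shows "((\<lambda>x. \<chi> j. f x j) has_derivative (\<lambda>h. \<chi> j. f' h j)) F"
proof -
  have ax: "(\<chi> j. g j) = (\<Sum>j\<in>UNIV. axis j (g j))" for g :: "'n \<Rightarrow> 'b"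
    by (simp add: vec_eq_iff axis_def if_distrib[of "\<lambda>x. x $ _"] cong: if_cong)
  have bl: "bounded_linear (axis j :: 'b \<Rightarrow> 'b ^ 'n)" for j
    unfolding linear_conv_bounded_linear[symmetric] by (rule linearI) (auto simp: axis_def vec_eq_iff)
  have "((\<lambda>x. \<Sum>j\<in>UNIV. axis j (f x j)) has_derivative (\<lambda>h. \<Sum>j\<in>UNIV. axis j (f' h j))) F"
    by (rule has_derivative_sum) (rule bounded_linear.has_derivative[OF bl assms])
  then show ?thesis by (simp only: ax)
qed

lemma has_derivative_transition:
  assumes "\<And>j. regular_exponent b y (b' j)"
  shows "((\<lambda>y. \<chi> j. monomial b y (b' j)) has_derivative (\<lambda>h. transition_jacobian b b' y *v h)) (at y)"
  using has_derivative_vec_lambda[of "\<lambda>y j. monomial b y (b' j)", OF has_derivative_monomial[OF assms]]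
  by (simp add: transition_jacobian_def matrix_vector_mult_def)

lemma monomial_sum_torus:
  assumes "lattice_basis b" "\<forall>k. y $ k \<noteq> 0"
  shows "monomial b y (sum f A) = (\<Prod>a\<in>A. monomial b y (f a))"
  using assms(2)
  by (induction A rule: infinite_finite_induct)
     (auto simp: monomial_0[OF assms(1)] monomial_add[OF assms(1)] regular_exponent_def)

text \<open>In logarithmic coordinates the map is linear: the Jacobian factors as the diagonal of
  the new coordinates, the integer transition matrix \<open>A\<close>, and the diagonal of inverse
  old coordinates. \<open>A\<close> is unimodular and contributes 1; the diagonals multiply to the
  character of the difference of the basis sums.\<close>

lemma det_transition_jacobian_torus:
  assumes b: "lattice_basis b" and b': "lattice_basis b'" and y: "\<forall>k. y $ k \<noteq> 0"
  shows "det (block_diag (transition_jacobian b b' y) (mcnj (transition_jacobian b b' y)))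
    = of_real ((cmod (monomial b y ((\<Sum>j\<in>UNIV. b' j) - (\<Sum>k\<in>UNIV. b k))))\<^sup>2)"
proof -
  let ?h = "\<lambda>M. det (block_diag M (mcnj M))"
  define D1 :: "complex ^ 'a ^ 'a" where "D1 = (\<chi> i j. if i = j then monomial b y (b' i) else 0)"
  define D2 :: "complex ^ 'a ^ 'a" where "D2 = (\<chi> i j. if i = j then inverse (y $ i) else 0)"
  define A :: "complex ^ 'a ^ 'a" where "A = (\<chi> j k. of_int (lcoord b (b' j) $ k))"
  define B :: "complex ^ 'a ^ 'a" where "B = (\<chi> k j. of_int (lcoord b' (b k) $ j))"
  have hm: "?h (M ** N) = ?h M * ?h N" for M N :: "complex ^ 'a ^ 'a"
    by (simp add: mcnj_mult block_diag_mult[symmetric] det_mul)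
  have "transition_jacobian b b' y = D1 ** (A ** D2)"
  proof -
    have "monomial_partial b y (b' j) k = monomial b y (b' j) * (of_int (lcoord b (b' j) $ k) * inverse (y $ k))" for j k
    proof -
      have "monomial b y (b' j) = y $ k powi (lcoord b (b' j) $ k) * (\<Prod>l\<in>UNIV - {k}. y $ l powi (lcoord b (b' j) $ l))"
        unfolding monomial_def by (simp add: prod.remove[of UNIV k])
      moreover have "y $ k powi (lcoord b (b' j) $ k - 1) = y $ k powi (lcoord b (b' j) $ k) * inverse (y $ k)"
        using y by (simp add: power_int_diff divide_inverse)
      ultimately show ?thesis by (simp add: monomial_partial_def mult_ac)
    qed
    moreover have "(A ** D2) $ j $ k = of_int (lcoord b (b' j) $ k) * inverse (y $ k)" for j k
      by (simp add: A_def D2_def matrix_matrix_mult_def if_distrib[of "\<lambda>x. _ * x"] cong: if_cong)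
    moreover have "(D1 ** M) $ j $ k = monomial b y (b' j) * M $ j $ k" for M :: "complex ^ 'a ^ 'a" and j k
      by (simp add: D1_def matrix_matrix_mult_def if_distrib[of "\<lambda>x. x * _"] cong: if_cong)
    ultimately show ?thesis by (simp add: vec_eq_iff transition_jacobian_def)
  qed
  then have "?h (transition_jacobian b b' y) = ?h D1 * (?h A * ?h D2)" by (simp only: hm)
  moreover have "?h A = 1"
  proof -
    have "B ** A = mat 1"
    proof -
      have "(B ** A) $ k $ l = of_int (\<Sum>j\<in>UNIV. lcoord b' (b k) $ j * lcoord b (b' j) $ l)" for k l
        by (simp add: A_def B_def matrix_matrix_mult_def)
      moreover have "(\<Sum>j\<in>UNIV. lcoord b' (b k) $ j * lcoord b (b' j) $ l) = axis k 1 $ l" for k l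
      proof -
        have "axis k 1 = lcoord b (\<Sum>j\<in>UNIV. lcoord b' (b k) $ j *s b' j)"
          by (simp add: lcoord_expansion[OF b'] lcoord_basis[OF b])
        then show ?thesis by (simp add: lcoord_sum[OF b] lcoord_smult[OF b])
      qed
      ultimately show ?thesis by (auto simp: vec_eq_iff mat_def axis_def)
    qed
    then have "det (block_diag A A) = 1"
      by (intro det_block_diag_unimodular[of A B]) (auto simp: A_def B_def)
    moreover have "mcnj A = A" by (simp add: mcnj_def A_def vec_eq_iff)
    ultimately show ?thesis by simp
  qed
  moreover have "?h D1 = of_real ((cmod (\<Prod>j\<in>UNIV. monomial b y (b' j)))\<^sup>2)"
    unfolding D1_def by (rule det_block_diag_diagonal)
  moreover have "?h D2 = of_real ((cmod (\<Prod>k\<in>UNIV. inverse (y $ k)))\<^sup>2)"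
    unfolding D2_def by (rule det_block_diag_diagonal)
  moreover have "monomial b y ((\<Sum>j\<in>UNIV. b' j) - (\<Sum>k\<in>UNIV. b k))
     = (\<Prod>j\<in>UNIV. monomial b y (b' j)) * (\<Prod>k\<in>UNIV. inverse (y $ k))"
  proof -
    have "monomial b y (- (\<Sum>k\<in>UNIV. b k)) = (\<Prod>k\<in>UNIV. inverse (y $ k))"
      by (simp add: monomial_uminus[OF b] monomial_sum_torus[OF b y] monomial_basis[OF b] prod_inversef[symmetric] o_def)
    moreover have "regular_exponent b y m" for m using y by (simp add: regular_exponent_def)
    ultimately show ?thesis
      using monomial_add[OF b, of y "\<Sum>j\<in>UNIV. b' j" "- (\<Sum>k\<in>UNIV. b k)"]
      by (simp add: monomial_sum_torus[OF b y])
  qed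
  ultimately show ?thesis by (simp add: norm_mult power_mult_distrib)
qed

lemma continuous_on_component_powi:
  fixes f :: "'a::topological_space \<Rightarrow> complex ^ 'n::finite"
  assumes "continuous_on S f" and "0 \<le> n \<or> (\<forall>x\<in>S. f x $ k \<noteq> 0)"
  shows "continuous_on S (\<lambda>x. f x $ k powi n)"
proof (cases "0 \<le> n")
  case True
  then show ?thesis using assms(1) by (simp add: power_int_nonneg_exp) (intro continuous_intros)
next
  case False
  then show ?thesis using assms by (intro continuous_on_power_int continuous_intros) auto
qed

lemma continuous_on_monomial:
  assumes "continuous_on S f" "\<And>x. x \<in> S \<Longrightarrow> regular_exponent b (f x) m"
  shows "continuous_on S (\<lambda>x. monomial b (f x) m)"
  unfolding monomial_def
  using assms by (intro continuous_on_prod continuous_on_component_powi)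
    (auto simp: regular_exponent_def linorder_not_le)

lemma continuous_on_monomial_partial:
  fixes f :: "'a::topological_space \<Rightarrow> complex ^ 'n::finite"
  assumes f: "continuous_on S f" and r: "\<And>x. x \<in> S \<Longrightarrow> regular_exponent b (f x) m"
  shows "continuous_on S (\<lambda>x. monomial_partial b (f x) m k)"
\<comment> \<open>With exponent 0 the factor \<open>powi (-1)\<close> may be discontinuous at zero,
  but it is multiplied by the coefficient 0.\<close>
proof (cases "lcoord b m $ k = 0")
  case False
  have "0 \<le> lcoord b m $ k - 1 \<or> (\<forall>x\<in>S. f x $ k \<noteq> 0)" using False r by (force simp: regular_exponent_def)
  moreover have "0 \<le> lcoord b m $ l \<or> (\<forall>x\<in>S. f x $ l \<noteq> 0)" for l using r by (force simp: regular_exponent_def)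
  ultimately show ?thesis unfolding monomial_partial_def
    using f by (intro continuous_on_mult continuous_on_prod continuous_on_component_powi continuous_on_const) auto
qed (simp add: monomial_partial_def)

text \<open>Both sides are continuous along the segment that moves the zero coordinates of \<open>y\<close> away from zero, and
  they agree on the torus.\<close>

lemma det_transition_jacobian:
  fixes y :: "complex ^ 'n::finite"
  assumes b: "lattice_basis b" and b': "lattice_basis b'"
    and r: "\<And>j. regular_exponent b y (b' j)"
    and q: "regular_exponent b y ((\<Sum>j\<in>UNIV. b' j) - (\<Sum>k\<in>UNIV. b k))"
  shows "det (block_diag (transition_jacobian b b' y) (mcnj (transition_jacobian b b' y)))
    = of_real ((cmod (monomial b y ((\<Sum>j\<in>UNIV. b' j) - (\<Sum>k\<in>UNIV. b k))))\<^sup>2)"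
proof -
  let ?q = "(\<Sum>j\<in>UNIV. b' j) - (\<Sum>k\<in>UNIV. b k)"
  \<comment> \<open>Only the zero coordinates move, each becoming \<open>t\<close>. Nonzero ones
    stay fixed, so exponents regular at \<open>y\<close> remain regular along the path.\<close>
  define c :: "real \<Rightarrow> complex ^ 'n" where "c t = y + of_real t *s (\<chi> k. if y $ k = 0 then 1 else 0)" for t
  have c0: "c 0 = y" by (simp add: c_def vec_eq_iff)
  have cz: "c t $ k = 0 \<Longrightarrow> y $ k = 0" for t k by (auto simp: c_def split: if_splits)
  have ct: "c t $ k \<noteq> 0" if "t \<noteq> 0" for t k using that by (auto simp: c_def)
  have cont: "continuous_on UNIV c"
    unfolding c_def vector_scalar_mult_def by (intro continuous_intros)
  have rc: "regular_exponent b (c t) (b' j)" "regular_exponent b (c t) ?q" for t j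
    using r q cz by (auto simp: regular_exponent_def)
  define \<Phi> where "\<Phi> t = det (block_diag (transition_jacobian b b' (c t)) (mcnj (transition_jacobian b b' (c t))))" for t
  define \<Psi> where "\<Psi> t = complex_of_real ((cmod (monomial b (c t) ?q))\<^sup>2)" for t
  have "continuous_on UNIV (\<lambda>t. block_diag (transition_jacobian b b' (c t)) (mcnj (transition_jacobian b b' (c t))) $ r $ s)" for r s
  proof -
    have "continuous_on UNIV (\<lambda>t. monomial_partial b (c t) (b' j) k)" for j k
      by (rule continuous_on_monomial_partial[OF cont rc(1)])
    then show ?thesis
      by (cases "snd r = snd s"; cases "snd r")
         (auto simp: block_diag_def transition_jacobian_def mcnj_def intro!: continuous_on_cnj)
  qed
  then have "continuous_on UNIV \<Phi>"
    unfolding \<Phi>_def det_def by (intro continuous_on_sum continuous_on_mult continuous_on_prod continuous_on_const)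
  then have "(\<Phi> \<longlongrightarrow> \<Phi> 0) (at 0)" by (simp add: continuous_on_def)
  moreover have "continuous_on UNIV \<Psi>"
    unfolding \<Psi>_def by (intro continuous_intros continuous_on_monomial[OF cont rc(2)])
  then have "(\<Psi> \<longlongrightarrow> \<Psi> 0) (at 0)" by (simp add: continuous_on_def)
  moreover have "\<Phi> t = \<Psi> t" if "t \<noteq> 0" for t
    unfolding \<Phi>_def \<Psi>_def using ct[OF that] by (intro det_transition_jacobian_torus[OF b b']) blast
  then have "eventually (\<lambda>t. \<Phi> t = \<Psi> t) (at 0)" by (simp add: eventually_at_filter)
  ultimately have "\<Phi> 0 = \<Psi> 0" using tendsto_cong tendsto_unique trivial_limit_at by blast
  then show ?thesis by (simp add: \<Phi>_def \<Psi>_def c0)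
qed

section \<open>The canonical volume form\<close>

lemma regular_exponent_uminus:
  assumes b: "lattice_basis b" and nz: "monomial b y m \<noteq> 0"
  shows "regular_exponent b y m" "regular_exponent b y (- m)"
  using nz by (auto simp: monomial_nonzero_iff regular_exponent_def lcoord_uminus[OF b])

lemma regular_exponent_smult:
  "lattice_basis b \<Longrightarrow> regular_exponent b y m \<Longrightarrow> 0 \<le> a \<Longrightarrow> regular_exponent b y (a *s m)"
  by (simp add: regular_exponent_def lcoord_smult)

text \<open>Where \<open>m\<close> has a negative coordinate along \<open>b' j\<close>, regularity
  in the new coordinates makes the \<open>j\<close>-th of them nonzero, so negative multiples of
  \<open>b' j\<close> are regular in the old coordinates as well. The product can then be assembled
  term by term.\<close>

lemma monomial_comp:
  assumes b: "lattice_basis b" and b': "lattice_basis b'"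
    and r: "\<And>j. regular_exponent b y (b' j)"
    and r': "regular_exponent b' (\<chi> j. monomial b y (b' j)) m"
  shows "regular_exponent b y m" "monomial b' (\<chi> j. monomial b y (b' j)) m = monomial b y m"
proof -
  let ?c = "lcoord b' m"
  have tm: "regular_exponent b y (?c $ j *s b' j)" for j
  proof (cases "0 \<le> ?c $ j")
    case True
    then show ?thesis using r regular_exponent_smult[OF b] by blast
  next
    case False
    then have "monomial b y (b' j) \<noteq> 0" using r' by (force simp: regular_exponent_def)
    then have "regular_exponent b y ((- ?c $ j) *s (- b' j))"
      using False by (intro regular_exponent_smult[OF b] regular_exponent_uminus[OF b]) auto
    moreover have "(- ?c $ j) *s (- b' j) = ?c $ j *s b' j" by (simp add: vec_eq_iff)
    ultimately show ?thesis by simp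
  qed
  have "regular_exponent b y (\<Sum>j\<in>F. ?c $ j *s b' j) \<and>
    monomial b y (\<Sum>j\<in>F. ?c $ j *s b' j) = (\<Prod>j\<in>F. monomial b y (b' j) powi ?c $ j)" if "finite F" for F
    using that
    by induction (simp_all add: regular_exponent_0[OF b] monomial_0[OF b] tm
        regular_exponent_add[OF b] monomial_add[OF b] monomial_smult[OF b])
  from this[of UNIV]
  show "regular_exponent b y m" "monomial b' (\<chi> j. monomial b y (b' j)) m = monomial b y m"
    by (simp_all add: lcoord_expansion[OF b'] monomial_def[of b'])
qed

context smooth_polytope
begin

lemma continuous_on_affine_point:
  assumes b: "vchart v b"
  shows "continuous_on UNIV (\<lambda>y. restrict (monomial b y) (vmonoid {v}))"
proof (rule continuous_on_coordinatewise_then_product)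
  fix m
  show "continuous_on UNIV (\<lambda>y. restrict (monomial b y) (vmonoid {v}) m)"
  proof (cases "m \<in> vmonoid {v}")
    case True
    then have "regular_exponent b y m" for y using vchartD(3)[OF b] regular_exponent_nonneg by blast
    then show ?thesis using True by (simp add: continuous_on_monomial continuous_on_id)
  qed simp
qed

section \<open>The topology in vertex charts\<close>

text \<open>A vertex chart is continuous into the pointwise topology, and the affine points of any
  smaller cone map continuously to coordinates at one of its vertices. Testing the vertex charts is
  therefore enough.\<close>

lemma openin_toric_topology_iff:
  "openin (toric_topology Fan) W \<longleftrightarrow>
    W \<subseteq> toric_variety Fan \<and> (\<forall>v b. vchart v b \<longrightarrow> open {y. pt v b y \<in> W})"
proof (intro iffI conjI allI impI)
  assume W: "openin (toric_topology Fan) W"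
  then show "W \<subseteq> toric_variety Fan" by (simp add: openin_toric_topology)
  fix v b assume b: "vchart v b"
  have "openin (top_of_set (affine_points (vcone {v})))
        {f \<in> affine_points (vcone {v}). glue_rel Fan `` {(vcone {v}, f)} \<in> W}"
    using W vcone_in_normal_fan[OF vchartD(1)[OF b]] by (simp add: openin_toric_topology)
  then obtain T where T: "open T"
    "{f \<in> affine_points (vcone {v}). glue_rel Fan `` {(vcone {v}, f)} \<in> W} = affine_points (vcone {v}) \<inter> T"
    by (auto simp: openin_open)
  have "{y. pt v b y \<in> W} = (\<lambda>y. restrict (monomial b y) (vmonoid {v})) -` T"
    using T(2) monomial_affine_points_vertex[OF b] unfolding pt_def by blast
  then show "open {y. pt v b y \<in> W}"
    using open_vimage[OF T(1) continuous_on_affine_point[OF b]] by simp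
next
  assume W: "W \<subseteq> toric_variety Fan \<and> (\<forall>v b. vchart v b \<longrightarrow> open {y. pt v b y \<in> W})"
  show "openin (toric_topology Fan) W" unfolding openin_toric_topology
  proof (intro conjI ballI)
    show "W \<subseteq> toric_variety Fan" using W by blast
    fix \<sigma> assume s: "\<sigma> \<in> Fan"
    obtain A where A: "A \<subseteq> verts" "A \<noteq> {}" "\<sigma> = vcone A" using normal_fan_vcone[OF s] .
    obtain v where v: "v \<in> A" using A by blast
    obtain b where b: "vchart v b" using vchart_exists v A by blast
    let ?g = "\<lambda>f::int ^ 'n \<Rightarrow> complex. \<chi> k. f (b k)"
    have "{f \<in> affine_points \<sigma>. glue_rel Fan `` {(\<sigma>, f)} \<in> W} = affine_points \<sigma> \<inter> ?g -` {y. pt v b y \<in> W}"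
      using class_eq_pt[OF v A(1) _ _ b] s unfolding A(3) by auto
    moreover have "open (?g -` {y. pt v b y \<in> W})"
      using W b by (intro open_vimage continuous_on_vec_lambda continuous_on_product_coordinates) blast
    ultimately show "openin (top_of_set (affine_points \<sigma>)) {f \<in> affine_points \<sigma>. glue_rel Fan `` {(\<sigma>, f)} \<in> W}"
      by (simp add: openin_open_Int)
  qed
qed

lemma topspace_toric_topology: "topspace (toric_topology Fan) = toric_variety Fan"
proof
  show "topspace (toric_topology Fan) \<subseteq> toric_variety Fan"
    using openin_toric_topology_iff openin_topspace by blast
  have "openin (toric_topology Fan) (toric_variety Fan)"
    unfolding openin_toric_topology_iff using pt_in_toric_variety by simp
  then show "toric_variety Fan \<subseteq> topspace (toric_topology Fan)" by (rule openin_subset)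
qed

lemma chart_dom_vcone: "chart_dom Fan (vcone {v}, b) = affine_open Fan (vcone {v})"
  by (simp add: chart_dom_def)

lemma chart_map_pt:
  assumes "vchart v b" shows "chart_map Fan (vcone {v}, b) (pt v b y) = y"
  using character_pt[OF assms basis_in_vmonoid[OF assms]]
  by (simp add: chart_map_def vec_eq_iff monomial_basis[OF vchartD(2)[OF assms]])

lemma chart_map_pt':
  assumes b: "vchart v b" and b': "vchart w b'" and nz: "monomial b y (w - v) \<noteq> 0"
  shows "chart_map Fan (vcone {w}, b') (pt v b y) = (\<chi> j. monomial b y (b' j))"
  unfolding pt_change_chart[OF b b' nz] by (rule chart_map_pt[OF b'])

lemma chart_inv_pt:
  assumes b: "vchart v b" shows "chart_inv Fan (vcone {v}, b) y = pt v b y"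
  unfolding chart_inv_def chart_dom_vcone
proof (rule inv_into_f_eq)
  show "inj_on (chart_map Fan (vcone {v}, b)) (affine_open Fan (vcone {v}))"
    by (rule inj_onI) (metis affine_open_iff[OF b] chart_map_pt[OF b])
  show "pt v b y \<in> affine_open Fan (vcone {v})" using affine_open_iff[OF b] by blast
  show "chart_map Fan (vcone {v}, b) (pt v b y) = y" by (rule chart_map_pt[OF b])
qed

lemma open_monomial_nonzero:
  assumes b: "vchart v b" and w: "w \<in> verts" shows "open {y. monomial b y (w - v) \<noteq> 0}"
proof -
  have "continuous_on UNIV (\<lambda>y. monomial b y (w - v))"
    using vchart_coord_nonneg[OF b w] by (intro continuous_on_monomial continuous_on_id regular_exponent_nonneg) blast
  then show ?thesis by (intro open_Collect_neq continuous_on_const)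
qed

section \<open>The Jacobian cocycle and the density\<close>

text \<open>The exponent of the transition cocycle of the canonical bundle, up to sign. It is
  additive along a chain of three charts, which drives all comparisons of densities.\<close>

definition basis_diff :: "('n \<Rightarrow> int ^ 'n) \<Rightarrow> ('n \<Rightarrow> int ^ 'n) \<Rightarrow> int ^ 'n" where
  "basis_diff b b' = (\<Sum>j\<in>UNIV. b' j) - (\<Sum>k\<in>UNIV. b k)"

text \<open>Both bases describe the monoid of \<open>vcone {v, w}\<close>, each with its own set of
  inverted generators; this is the hypothesis under which the sums of the bases can be
  compared.\<close>

lemma basis_diff_coord_zero:
  assumes b: "vchart v b" and b': "vchart w b'" and k: "lcoord b (w - v) $ k = 0"
  shows "lcoord b (basis_diff b b') $ k = 0"
  unfolding basis_diff_def
proof (rule sum_basis_diff_coord_zero[OF vchartD(2)[OF b] vchartD(2)[OF b']])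
  have A: "v \<in> {v, w}" "w \<in> {v, w}" "{v, w} \<subseteq> verts" using vchartD(1) b b' by auto
  show "(\<forall>k. k \<notin> {k. \<exists>a\<in>{v, w}. lcoord b (a - v) $ k \<noteq> 0} \<longrightarrow> 0 \<le> lcoord b m $ k) \<longleftrightarrow>
    (\<forall>k. k \<notin> {k. \<exists>a\<in>{v, w}. lcoord b' (a - w) $ k \<noteq> 0} \<longrightarrow> 0 \<le> lcoord b' m $ k)" for m
    using cone_monoid_vcone[OF b A(1,3), of m] cone_monoid_vcone[OF b' A(2,3), of m] by blast
  show "k \<notin> {k. \<exists>a\<in>{v, w}. lcoord b (a - v) $ k \<noteq> 0}"
    using k by (auto simp: lcoord_0[OF vchartD(2)[OF b]])
qed

lemma monomial_basis_diff_nonzero: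
  assumes b: "vchart v b" and b': "vchart w b'" and nz: "monomial b y (w - v) \<noteq> 0"
  shows "monomial b y (basis_diff b b') \<noteq> 0"
  using nz basis_diff_coord_zero[OF b b'] unfolding monomial_nonzero_iff by blast

lemma regular_exponent_basis_change:
  assumes b: "vchart v b" and b': "vchart w b'" and nz: "monomial b y (w - v) \<noteq> 0"
  shows "regular_exponent b y (b' j)"
proof (rule regular_exponent_vmonoid[OF b, of "{v, w}"])
  show "v \<in> {v, w}" "{v, w} \<subseteq> verts" using vchartD(1) b b' by auto
  show "\<forall>a\<in>{v, w}. monomial b y (a - v) \<noteq> 0" using nz by (simp add: monomial_0[OF vchartD(2)[OF b]])
  show "b' j \<in> vmonoid {v, w}" using basis_in_vmonoid[OF b'] vmonoid_mono[of "{w}" "{v, w}"] by blast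
qed

text \<open>Stated for any \<open>f\<close> that agrees with the coordinate change on the open
  overlap, so that it applies to the affine coordinates of projective space too.\<close>

lemma has_derivative_chart_transition:
  assumes b: "vchart v b" and b': "vchart w b'" and nz: "monomial b y (w - v) \<noteq> 0"
    and f: "\<And>z. monomial b z (w - v) \<noteq> 0 \<Longrightarrow> f z = chart_map Fan (vcone {w}, b') (pt v b z)"
  shows "(f has_derivative (\<lambda>h. transition_jacobian b b' y *v h)) (at y)"
proof (rule has_derivative_transform_within_open[OF has_derivative_transition])
  show "regular_exponent b y (b' j)" for j by (rule regular_exponent_basis_change[OF b b' nz])
  show "open {y. monomial b y (w - v) \<noteq> 0}" by (rule open_monomial_nonzero[OF b vchartD(1)[OF b']])
  show "y \<in> {y. monomial b y (w - v) \<noteq> 0}" using nz by simp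
  fix y' assume "y' \<in> {y. monomial b y (w - v) \<noteq> 0}"
  then show "(\<chi> j. monomial b y' (b' j)) = f y'"
    using chart_map_pt'[OF b b'] f by simp
qed

text \<open>\<open>mu0\<close> has constant coefficients; the base point 0 on the right is a dummy
  value.\<close>

lemma mu0_jacobian:
  assumes b: "vchart v b" and b': "vchart w b'" and nz: "monomial b y (w - v) \<noteq> 0"
  shows "mu0 z (\<lambda>s. transition_jacobian b b' y *v \<xi> s)
    = of_real ((cmod (monomial b y (basis_diff b b')))\<^sup>2) * mu0 0 \<xi>"
proof -
  have "regular_exponent b y (basis_diff b b')"
    using monomial_basis_diff_nonzero[OF assms] regular_exponent_uminus[OF vchartD(2)[OF b]] by blast
  from det_transition_jacobian[OF vchartD(2)[OF b] vchartD(2)[OF b'] regular_exponent_basis_change[OF assms]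
      this[unfolded basis_diff_def]]
  show ?thesis by (simp add: mu0_def wedge_matrix_vector basis_diff_def)
qed

lemma mu0_transition:
  assumes b: "vchart v b" and b': "vchart w b'" and nz: "monomial b y (w - v) \<noteq> 0"
  shows "mu0 z (\<lambda>s. frechet_derivative (chart_map Fan (vcone {w}, b') \<circ> chart_inv Fan (vcone {v}, b)) (at y) (\<xi> s))
    = of_real ((cmod (monomial b y (basis_diff b b')))\<^sup>2) * mu0 0 \<xi>"
proof -
  have "((chart_map Fan (vcone {w}, b') \<circ> chart_inv Fan (vcone {v}, b)) has_derivative
      (\<lambda>h. transition_jacobian b b' y *v h)) (at y)"
    by (rule has_derivative_chart_transition[OF assms]) (simp add: chart_inv_pt[OF b])
  from frechet_derivative_at[OF this] show ?thesis using mu0_jacobian[OF assms, of z \<xi>] by simp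
qed

text \<open>On \<open>C\<^sub>w\<close> the form is \<open>mu0\<close> in the coordinates at \<open>w\<close>; its density in the coordinates \<open>b\<close> is the squared
  absolute value of the Jacobian determinant of the coordinate change.\<close>

definition form_density :: "('n \<Rightarrow> int ^ 'n) \<Rightarrow> complex ^ 'n \<Rightarrow> 'n toric_point \<Rightarrow> real" where
  "form_density b y x = (SOME d. \<exists>w b'. vchart w b' \<and> x \<in> C_set Fan (vcone {w}) \<and>
     d = (cmod (monomial b y (basis_diff b b')))\<^sup>2)"

lemma C_set_monomial_nonzero:
  assumes b: "vchart v b" and w: "w \<in> verts" and C: "pt v b y \<in> C_set Fan (vcone {w})"
  shows "monomial b y (w - v) \<noteq> 0"
  using C_set_subset_affine_open[OF w] C pt_in_affine_open_iff[OF b w] by blast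

text \<open>If all coordinates have absolute value at most \<open>1\<close>, those that occur in a monomial of absolute value
  \<open>1\<close> have absolute value \<open>1\<close>.\<close>

lemma norm_monomial_basis_diff_one:
  assumes b: "vchart v b" and b': "vchart w b'"
    and Cv: "pt v b y \<in> C_set Fan (vcone {v})" and Cw: "pt v b y \<in> C_set Fan (vcone {w})"
  shows "cmod (monomial b y (basis_diff b b')) = 1"
proof -
  note lb = vchartD(2)[OF b]
  have vv: "v \<in> verts" and wv: "w \<in> verts" using vchartD(1) b b' by auto
  have le: "cmod (y $ k) \<le> 1" for k using Cv pt_in_own_C_set_iff[OF b] by blast
  have one: "1 \<le> cmod (monomial b y (w - v))"
    using Cw pt_in_C_set_iff[OF b wv] vv by (auto simp: monomial_0[OF lb] dest: bspec)
  have unit: "cmod (y $ k) = 1" if k: "lcoord b (w - v) $ k \<noteq> 0" for k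
  proof -
    have pos: "0 < lcoord b (w - v) $ k" using k vchart_coord_nonneg[OF b wv, of k] by simp
    have l1: "cmod (y $ l powi lcoord b (w - v) $ l) \<le> 1" for l
      using le vchart_coord_nonneg[OF b wv] by (simp add: norm_power_int power_int_le_one)
    \<comment> \<open>Isolating factor \<open>k\<close>: the remaining factors are at most 1, so
      this one must already be at least 1.\<close>
    have "1 \<le> cmod (y $ k powi lcoord b (w - v) $ k) * (\<Prod>l\<in>UNIV - {k}. cmod (y $ l powi lcoord b (w - v) $ l))"
      using one unfolding monomial_def prod_norm[symmetric]
      by (subst (asm) prod.remove[of UNIV k]) simp_all
    also have "\<dots> \<le> cmod (y $ k powi lcoord b (w - v) $ k) * 1"
      by (intro mult_left_mono prod_le_1) (use l1 in auto)
    also have "\<dots> = cmod (y $ k) ^ nat (lcoord b (w - v) $ k)"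
      using pos by (simp add: norm_power_int power_int_nonneg_exp norm_power)
    finally have "1 \<le> cmod (y $ k) ^ nat (lcoord b (w - v) $ k)" .
    moreover have "cmod (y $ k) ^ nat (lcoord b (w - v) $ k) < 1" if "cmod (y $ k) < 1"
      using power_strict_mono[OF that norm_ge_zero, of "nat (lcoord b (w - v) $ k)"] pos by simp
    ultimately show ?thesis using le[of k] by force
  qed
  have "cmod (y $ k powi lcoord b (basis_diff b b') $ k) = 1" for k
  proof (cases "lcoord b (w - v) $ k = 0")
    case True
    then show ?thesis using basis_diff_coord_zero[OF b b' True] by simp
  next
    case False
    then show ?thesis using unit by (simp add: norm_power_int)
  qed
  then show ?thesis by (simp add: monomial_def prod_norm[symmetric])
qed

text \<open>The two densities differ by the character of \<open>basis_diff b2 b1\<close>. In the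
  chart at \<open>w2\<close> the point lies in the sets of both \<open>w2\<close> and
  \<open>w1\<close>, where that character has absolute value 1.\<close>

lemma density_independent:
  assumes b: "vchart v b" and b1: "vchart w1 b1" and b2: "vchart w2 b2"
    and C1: "pt v b y \<in> C_set Fan (vcone {w1})" and C2: "pt v b y \<in> C_set Fan (vcone {w2})"
  shows "cmod (monomial b y (basis_diff b b1)) = cmod (monomial b y (basis_diff b b2))"
proof -
  note nz1 = C_set_monomial_nonzero[OF b vchartD(1)[OF b1] C1]
  note nz2 = C_set_monomial_nonzero[OF b vchartD(1)[OF b2] C2]
  define y2 where "y2 = (\<chi> j. monomial b y (b2 j))"
  have eq: "pt v b y = pt w2 b2 y2" unfolding y2_def by (rule pt_change_chart[OF b b2 nz2])
  have one: "cmod (monomial b2 y2 (basis_diff b2 b1)) = 1"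
    using C1 C2 unfolding eq by (intro norm_monomial_basis_diff_one[OF b2 b1])
  then have "monomial b2 y2 (basis_diff b2 b1) \<noteq> 0" by auto
  then have "regular_exponent b2 y2 (basis_diff b2 b1)" using regular_exponent_uminus[OF vchartD(2)[OF b2]] by blast
  from monomial_comp[OF vchartD(2)[OF b] vchartD(2)[OF b2] regular_exponent_basis_change[OF b b2 nz2] this[unfolded y2_def]]
  have r: "regular_exponent b y (basis_diff b2 b1)" and e: "monomial b y (basis_diff b2 b1) = monomial b2 y2 (basis_diff b2 b1)"
    by (simp_all add: y2_def)
  have "regular_exponent b y (basis_diff b b2)"
    using monomial_basis_diff_nonzero[OF b b2 nz2] regular_exponent_uminus[OF vchartD(2)[OF b]] by blast
  moreover have "basis_diff b b1 = basis_diff b2 b1 + basis_diff b b2" by (simp add: basis_diff_def)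
  ultimately show ?thesis using monomial_add[OF vchartD(2)[OF b] r] e one by (simp add: norm_mult)
qed

lemma density_eq:
  assumes b: "vchart v b" and b': "vchart w b'" and C: "pt v b y \<in> C_set Fan (vcone {w})"
  shows "form_density b y (pt v b y) = (cmod (monomial b y (basis_diff b b')))\<^sup>2"
  unfolding form_density_def
proof (rule some_equality)
  show "\<exists>w' b''. vchart w' b'' \<and> pt v b y \<in> C_set Fan (vcone {w'}) \<and>
      (cmod (monomial b y (basis_diff b b')))\<^sup>2 = (cmod (monomial b y (basis_diff b b'')))\<^sup>2"
    using b' C by blast
  fix d assume "\<exists>w' b''. vchart w' b'' \<and> pt v b y \<in> C_set Fan (vcone {w'}) \<and>
      d = (cmod (monomial b y (basis_diff b b'')))\<^sup>2"
  then show "d = (cmod (monomial b y (basis_diff b b')))\<^sup>2"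
    using density_independent[OF b _ b' _ C] by auto
qed

text \<open>One vertex \<open>u\<close> whose set contains the point computes the density in both
  charts; additivity of \<open>basis_diff\<close> through \<open>b'\<close> gives the
  factor.\<close>

lemma density_transition:
  assumes b: "vchart v b" and b': "vchart w b'" and nz: "monomial b y (w - v) \<noteq> 0"
  defines "y' \<equiv> \<chi> j. monomial b y (b' j)"
  shows "form_density b y (pt v b y) = (cmod (monomial b y (basis_diff b b')))\<^sup>2 * form_density b' y' (pt v b y)"
proof -
  have eq: "pt v b y = pt w b' y'" unfolding y'_def by (rule pt_change_chart[OF b b' nz])
  obtain u where u: "u \<in> verts" "pt v b y \<in> C_set Fan (vcone {u})"
    using C_set_cover[OF pt_in_toric_variety[OF b]] .
  obtain b'' where b'': "vchart u b''" using vchart_exists[OF u(1)] .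
  have d: "form_density b y (pt v b y) = (cmod (monomial b y (basis_diff b b'')))\<^sup>2" by (rule density_eq[OF b b'' u(2)])
  have C': "pt w b' y' \<in> C_set Fan (vcone {u})" using u(2) eq by simp
  have d': "form_density b' y' (pt v b y) = (cmod (monomial b' y' (basis_diff b' b'')))\<^sup>2"
    unfolding eq by (rule density_eq[OF b' b'' C'])
  have "monomial b' y' (basis_diff b' b'') \<noteq> 0"
    by (rule monomial_basis_diff_nonzero[OF b' b'' C_set_monomial_nonzero[OF b' u(1) C']])
  then have "regular_exponent b' y' (basis_diff b' b'')" using regular_exponent_uminus[OF vchartD(2)[OF b']] by blast
  from monomial_comp[OF vchartD(2)[OF b] vchartD(2)[OF b'] regular_exponent_basis_change[OF b b' nz] this[unfolded y'_def]]
  have r: "regular_exponent b y (basis_diff b' b'')" and e: "monomial b y (basis_diff b' b'') = monomial b' y' (basis_diff b' b'')"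
    by (simp_all add: y'_def)
  have "regular_exponent b y (basis_diff b b')"
    using monomial_basis_diff_nonzero[OF b b' nz] regular_exponent_uminus[OF vchartD(2)[OF b]] by blast
  moreover have "basis_diff b b'' = basis_diff b b' + basis_diff b' b''" by (simp add: basis_diff_def)
  ultimately have "monomial b y (basis_diff b b'') = monomial b y (basis_diff b b') * monomial b' y' (basis_diff b' b'')"
    using monomial_add[OF vchartD(2)[OF b] _ r] e by simp
  then show ?thesis unfolding d d' by (simp add: norm_mult power_mult_distrib)
qed

lemma density_nonzero:
  assumes b: "vchart v b" shows "form_density b y (pt v b y) \<noteq> 0"
proof -
  obtain u where u: "u \<in> verts" "pt v b y \<in> C_set Fan (vcone {u})"
    using C_set_cover[OF pt_in_toric_variety[OF b]] .
  obtain b'' where b'': "vchart u b''" using vchart_exists[OF u(1)] .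
  show ?thesis
    using density_eq[OF b b'' u(2)] monomial_basis_diff_nonzero[OF b b'' C_set_monomial_nonzero[OF b u]] by simp
qed

text \<open>Pasting over finitely many closed pieces. They are closed because they are cut out by
  inequalities between monomials with nonnegative exponents, and on each the density is
  explicit.\<close>

lemma continuous_density:
  assumes b: "vchart v b" shows "continuous_on UNIV (\<lambda>y. form_density b y (pt v b y))"
proof -
  let ?A = "\<lambda>w. {y. pt v b y \<in> C_set Fan (vcone {w})}"
  have "(\<Union>w\<in>verts. ?A w) = UNIV"
    using C_set_cover[OF pt_in_toric_variety[OF b]] by blast
  moreover have "continuous_on (\<Union>w\<in>verts. ?A w) (\<lambda>y. form_density b y (pt v b y))"
  proof (rule continuous_on_closed_Union[OF finite_verts])
    fix w assume w: "w \<in> verts"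
    have cont: "continuous_on UNIV (\<lambda>y. cmod (monomial b y (u - v)))" if "u \<in> verts" for u
      using vchart_coord_nonneg[OF b that]
      by (intro continuous_on_norm continuous_on_monomial continuous_on_id regular_exponent_nonneg) blast
    have "?A w = (\<Inter>u\<in>verts. {y. cmod (monomial b y (u - v)) \<le> cmod (monomial b y (w - v))})"
      using pt_in_C_set_iff[OF b w] by auto
    then show "closed (?A w)" using cont w by (auto intro!: closed_INT closed_Collect_le)
    obtain b' where b': "vchart w b'" using vchart_exists[OF w] .
    have "regular_exponent b y (basis_diff b b')" if "y \<in> ?A w" for y
      using monomial_basis_diff_nonzero[OF b b' C_set_monomial_nonzero[OF b w]] that
        regular_exponent_uminus[OF vchartD(2)[OF b]] by blast
    then have "continuous_on (?A w) (\<lambda>y. (cmod (monomial b y (basis_diff b b')))\<^sup>2)"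
      by (intro continuous_on_power continuous_on_norm continuous_on_monomial continuous_on_id) auto
    then show "continuous_on (?A w) (\<lambda>y. form_density b y (pt v b y))"
      by (rule continuous_on_eq) (simp add: density_eq[OF b b'])
  qed
  ultimately show ?thesis by simp
qed

lemma openin_affine_open:
  assumes v: "v \<in> verts" shows "openin (toric_topology Fan) (affine_open Fan (vcone {v}))"
  unfolding openin_toric_topology_iff
  using open_monomial_nonzero v pt_in_affine_open_iff[OF _ v] by (auto simp: affine_open_def)

lemma affine_open_subset: "affine_open Fan \<sigma> \<subseteq> toric_variety Fan"
  by (auto simp: affine_open_def)

lemma openin_chart_map_vimage:
  assumes b: "vchart v b" and U: "open U"
  shows "openin (toric_topology Fan) {x \<in> affine_open Fan (vcone {v}). chart_map Fan (vcone {v}, b) x \<in> U}"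
  unfolding openin_toric_topology_iff
proof (intro conjI allI impI)
  show "{x \<in> affine_open Fan (vcone {v}). chart_map Fan (vcone {v}, b) x \<in> U} \<subseteq> toric_variety Fan"
    using affine_open_subset by blast
  fix w b' assume b': "vchart w b'"
  let ?D = "{y. monomial b' y (v - w) \<noteq> 0}" and ?G = "\<lambda>y. \<chi> k. monomial b' y (b k)"
  have "continuous_on ?D ?G"
    by (intro continuous_on_vec_lambda continuous_on_monomial continuous_on_id)
       (use regular_exponent_basis_change[OF b' b] in auto)
  then have "open (?D \<inter> ?G -` U)"
    using open_monomial_nonzero[OF b' vchartD(1)[OF b]] U by (intro continuous_open_preimage)
  moreover have "{y. pt w b' y \<in> {x \<in> affine_open Fan (vcone {v}). chart_map Fan (vcone {v}, b) x \<in> U}} = ?D \<inter> ?G -` U"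
    using pt_in_affine_open_iff[OF b' vchartD(1)[OF b]] chart_map_pt'[OF b' b] by auto
  ultimately show "open {y. pt w b' y \<in> {x \<in> affine_open Fan (vcone {v}). chart_map Fan (vcone {v}, b) x \<in> U}}"
    by simp
qed

lemma continuous_map_chart_map:
  assumes b: "vchart v b"
  shows "continuous_map (subtopology (toric_topology Fan) (affine_open Fan (vcone {v}))) euclidean
    (chart_map Fan (vcone {v}, b))"
  unfolding continuous_map
proof (intro conjI allI impI)
  fix U :: "(complex ^ 'n) set" assume "openin euclidean U"
  then have "openin (toric_topology Fan) {x \<in> affine_open Fan (vcone {v}). chart_map Fan (vcone {v}, b) x \<in> U}"
    using openin_chart_map_vimage[OF b] by simp
  moreover have "{x \<in> topspace (subtopology (toric_topology Fan) (affine_open Fan (vcone {v}))). chart_map Fan (vcone {v}, b) x \<in> U}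
    = {x \<in> affine_open Fan (vcone {v}). chart_map Fan (vcone {v}, b) x \<in> U} \<inter> affine_open Fan (vcone {v})"
    using affine_open_subset by (auto simp: topspace_toric_topology)
  ultimately show "openin (subtopology (toric_topology Fan) (affine_open Fan (vcone {v})))
      {x \<in> topspace (subtopology (toric_topology Fan) (affine_open Fan (vcone {v}))). chart_map Fan (vcone {v}, b) x \<in> U}"
    unfolding openin_subtopology by blast
qed simp

section \<open>Existence\<close>

definition canonical_form :: "'n form" where
  "canonical_form = (\<lambda>c x. if c \<in> charts Fan \<and> x \<in> chart_dom Fan c
     then (\<lambda>\<xi>. of_real (form_density (snd c) (chart_map Fan c x) x) * mu0 0 \<xi>) else undefined)"

lemma canonical_form_pt:
  assumes b: "vchart v b"
  shows "canonical_form (vcone {v}, b) (pt v b y) = (\<lambda>\<xi>. of_real (form_density b y (pt v b y)) * mu0 0 \<xi>)"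
proof -
  have "(vcone {v}, b) \<in> charts Fan" using b charts_iff by blast
  moreover have "pt v b y \<in> chart_dom Fan (vcone {v}, b)" using affine_open_iff[OF b] chart_dom_vcone by blast
  ultimately show ?thesis unfolding canonical_form_def by (simp add: chart_map_pt[OF b])
qed

lemma chart_cases:
  assumes "c \<in> charts Fan" "x \<in> chart_dom Fan c"
  obtains v b y where "c = (vcone {v}, b)" "vchart v b" "x = pt v b y"
proof -
  obtain v b where c: "c = (vcone {v}, b)" "vchart v b" using assms(1) charts_iff by blast
  then show thesis using that assms(2) affine_open_iff[OF c(2)] by (auto simp: chart_dom_vcone)
qed

lemma top_form_canonical: "top_form Fan canonical_form"
  unfolding top_form_def
proof (intro conjI ballI allI)
  have "chart_dom Fan c \<subseteq> toric_variety Fan" for c by (simp add: chart_dom_def affine_open_subset)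
  then show "restrict_form Fan (toric_variety Fan) canonical_form = canonical_form"
    unfolding restrict_form_def canonical_form_def fun_eq_iff by auto
next
  fix c x assume c: "c \<in> charts Fan" "x \<in> chart_dom Fan c"
  show "alternating_multilinear (canonical_form c x)"
    using chart_cases[OF c] canonical_form_pt alternating_multilinear_mu0 by metis
next
  fix c c' :: "'n chart" and x \<xi> assume c: "c \<in> charts Fan" and c': "c' \<in> charts Fan" and x: "x \<in> chart_dom Fan c \<inter> chart_dom Fan c'"
  obtain v b y where 1: "c = (vcone {v}, b)" "vchart v b" "x = pt v b y" using chart_cases[OF c] x by blast
  obtain w b' where 2: "c' = (vcone {w}, b')" "vchart w b'" using c' charts_iff by blast
  have nz: "monomial b y (w - v) \<noteq> 0"
    using x pt_in_affine_open_iff[OF 1(2) vchartD(1)[OF 2(2)]] unfolding 1 2 chart_dom_vcone by blast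
  have x': "x = pt w b' (\<chi> j. monomial b y (b' j))" unfolding 1 by (rule pt_change_chart[OF 1(2) 2(2) nz])
  have y: "chart_map Fan c x = y" unfolding 1 by (rule chart_map_pt[OF 1(2)])
  have L: "canonical_form c x \<xi> = of_real (form_density b y x) * mu0 0 \<xi>" unfolding 1 canonical_form_pt[OF 1(2)] ..
  have R: "canonical_form c' x \<zeta> = of_real (form_density b' (\<chi> j. monomial b y (b' j)) x) * mu0 0 \<zeta>" for \<zeta>
    unfolding x' unfolding 2(1) canonical_form_pt[OF 2(2)] ..
  show "canonical_form c x \<xi> = canonical_form c' x
     (\<lambda>s. frechet_derivative (chart_map Fan c' \<circ> chart_inv Fan c) (at (chart_map Fan c x)) (\<xi> s))"
    unfolding L R y
    unfolding 1(1) 2(1) mu0_transition[OF 1(2) 2(2) nz] 1(3) density_transition[OF 1(2) 2(2) nz]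
    by simp
qed

lemma continuous_volume_form_canonical: "continuous_volume_form Fan canonical_form"
  unfolding continuous_volume_form_def
proof (intro conjI ballI allI top_form_canonical)
  fix c :: "'n chart" and \<xi> :: "'n \<times> bool \<Rightarrow> complex ^ 'n" assume "c \<in> charts Fan"
  then obtain v b where c: "c = (vcone {v}, b)" "vchart v b" using charts_iff by blast
  let ?T = "subtopology (toric_topology Fan) (affine_open Fan (vcone {v}))"
  have "continuous_on UNIV (\<lambda>y. of_real (form_density b y (pt v b y)) * mu0 0 \<xi>)"
    by (intro continuous_on_mult continuous_on_of_real continuous_density[OF c(2)] continuous_on_const)
  then have "continuous_map euclidean euclidean (\<lambda>y. of_real (form_density b y (pt v b y)) * mu0 0 \<xi>)" by simp
  from continuous_map_compose[OF continuous_map_chart_map[OF c(2)] this]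
  have "continuous_map ?T euclidean ((\<lambda>y. of_real (form_density b y (pt v b y)) * mu0 0 \<xi>) \<circ> chart_map Fan c)"
    by (simp add: c(1))
  then show "continuous_map (subtopology (toric_topology Fan) (chart_dom Fan c)) euclidean (\<lambda>x. canonical_form c x \<xi>)"
    unfolding c(1) chart_dom_vcone
  proof (rule continuous_map_eq)
    fix x assume "x \<in> topspace ?T"
    then obtain y where x: "x = pt v b y" using affine_open_iff[OF c(2)] by auto
    show "((\<lambda>y. of_real (form_density b y (pt v b y)) * mu0 0 \<xi>) \<circ> chart_map Fan (vcone {v}, b)) x = canonical_form (vcone {v}, b) x \<xi>"
      unfolding x canonical_form_pt[OF c(2)] by (simp add: chart_map_pt[OF c(2)])
  qed
next
  fix c x \<xi> assume c: "c \<in> charts Fan" "x \<in> chart_dom Fan c"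
  obtain v b y where 1: "c = (vcone {v}, b)" "vchart v b" "x = pt v b y" using chart_cases[OF c] .
  show "canonical_form c x \<xi> \<in> \<real>"
    unfolding 1(1) 1(3) canonical_form_pt[OF 1(2)] by (intro Reals_mult Reals_of_real mu0_real)
next
  fix c x assume c: "c \<in> charts Fan" "x \<in> chart_dom Fan c"
  obtain v b y where 1: "c = (vcone {v}, b)" "vchart v b" "x = pt v b y" using chart_cases[OF c] .
  obtain \<xi> where "mu0 (0 :: complex ^ 'n) \<xi> \<noteq> 0" using mu0_nonzero by blast
  then show "\<exists>\<xi>. canonical_form c x \<xi> \<noteq> 0"
    unfolding 1(1) 1(3) canonical_form_pt[OF 1(2)] using density_nonzero[OF 1(2)] by auto
qed

text \<open>On all of \<open>C_set\<close>, not only its interior, the density equals the Jacobian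
  factor of the change to the chart at \<open>w\<close>.\<close>

lemma is_omega_infty_canonical: "is_omega_infty P canonical_form"
  unfolding is_omega_infty_def Let_def
proof (intro conjI continuous_volume_form_canonical, clarify)
  fix \<sigma> b' assume "(\<sigma>, b') \<in> charts Fan"
  then obtain w where w: "\<sigma> = vcone {w}" "vchart w b'" using charts_iff by blast
  let ?W = "toric_topology Fan interior_of C_set Fan \<sigma>"
  have "restrict_form Fan ?W canonical_form c x = pullback_form Fan ?W (chart_map Fan (\<sigma>, b')) mu0 c x" for c x
  proof (cases "c \<in> charts Fan \<and> x \<in> ?W \<inter> chart_dom Fan c")
    case True
    obtain v b y where 1: "c = (vcone {v}, b)" "vchart v b" "x = pt v b y" using chart_cases True by blast
    have C: "pt v b y \<in> C_set Fan (vcone {w})"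
      using True interior_of_subset[of "toric_topology Fan" "C_set Fan \<sigma>"] unfolding 1 w(1) by blast
    have y: "chart_map Fan c x = y" unfolding 1 by (rule chart_map_pt[OF 1(2)])
    have "canonical_form c x \<xi> = mu0 (chart_map Fan (\<sigma>, b') x)
       (\<lambda>s. frechet_derivative (chart_map Fan (\<sigma>, b') \<circ> chart_inv Fan c) (at (chart_map Fan c x)) (\<xi> s))" for \<xi>
      unfolding y
      unfolding 1(1) 1(3) w(1) canonical_form_pt[OF 1(2)] density_eq[OF 1(2) w(2) C]
        mu0_transition[OF 1(2) w(2) C_set_monomial_nonzero[OF 1(2) vchartD(1)[OF w(2)] C]] ..
    then show ?thesis using True by (simp add: restrict_form_def pullback_form_def fun_eq_iff)
  next
    case False
    then show ?thesis unfolding restrict_form_def pullback_form_def by auto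
  qed
  then show "restrict_form Fan ?W canonical_form = pullback_form Fan ?W (chart_map Fan (\<sigma>, b')) mu0"
    by (simp add: fun_eq_iff)
qed

section \<open>Uniqueness\<close>

text \<open>Two charts occur because forms are compared through their expressions in an arbitrary
  chart, while the approximation takes place in the chart whose polydisc contains the point.\<close>

lemma continuous_on_form:
  assumes "continuous_volume_form Fan \<omega>" and b: "vchart v b" and b': "vchart w b'"
  shows "continuous_on {z. pt w b' z \<in> affine_open Fan (vcone {v})} (\<lambda>z. \<omega> (vcone {v}, b) (pt w b' z) \<xi>)"
proof -
  let ?U = "affine_open Fan (vcone {v})"
  have c: "(vcone {v}, b) \<in> charts Fan" using b charts_iff by blast
  have openD: "open {z. pt w b' z \<in> ?U}"
    using openin_affine_open[OF vchartD(1)[OF b]] b' by (simp add: openin_toric_topology_iff)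
  have cont: "continuous_map (subtopology (toric_topology Fan) ?U) euclidean (\<lambda>x. \<omega> (vcone {v}, b) x \<xi>)"
    using assms(1) c by (auto simp: continuous_volume_form_def chart_dom_vcone dest!: bspec)
  show ?thesis unfolding continuous_on_open_vimage[OF openD]
  proof (intro allI impI)
    fix B :: "complex set" assume "open B"
    then have "openin (subtopology (toric_topology Fan) ?U)
       {x \<in> topspace (subtopology (toric_topology Fan) ?U). \<omega> (vcone {v}, b) x \<xi> \<in> B}"
      using cont unfolding continuous_map by simp
    then have "openin (toric_topology Fan) {x \<in> topspace (subtopology (toric_topology Fan) ?U). \<omega> (vcone {v}, b) x \<xi> \<in> B}"
      using openin_affine_open[OF vchartD(1)[OF b]] by (simp add: openin_open_subtopology)
    then have "open {z. pt w b' z \<in> {x \<in> topspace (subtopology (toric_topology Fan) ?U). \<omega> (vcone {v}, b) x \<xi> \<in> B}}"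
      using b' unfolding openin_toric_topology_iff by blast
    moreover have "{z. pt w b' z \<in> {x \<in> topspace (subtopology (toric_topology Fan) ?U). \<omega> (vcone {v}, b) x \<xi> \<in> B}}
      = (\<lambda>z. \<omega> (vcone {v}, b) (pt w b' z) \<xi>) -` B \<inter> {z. pt w b' z \<in> ?U}"
      using affine_open_subset by (auto simp: topspace_toric_topology)
    ultimately show "open ((\<lambda>z. \<omega> (vcone {v}, b) (pt w b' z) \<xi>) -` B \<inter> {z. pt w b' z \<in> ?U})" by simp
  qed
qed

lemma interior_C_set:
  assumes b: "vchart w b" and y: "\<forall>j. cmod (y $ j) < 1"
  shows "pt w b y \<in> toric_topology Fan interior_of C_set Fan (vcone {w})"
proof -
  let ?U = "{y :: complex ^ 'n. \<forall>j. cmod (y $ j) < 1}"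
  let ?W = "{x \<in> affine_open Fan (vcone {w}). chart_map Fan (vcone {w}, b) x \<in> ?U}"
  have "open (\<Inter>j. {y :: complex ^ 'n. cmod (y $ j) < 1})"
    by (intro open_INT finite ballI open_Collect_less continuous_intros)
  moreover have "?U = (\<Inter>j. {y. cmod (y $ j) < 1})" by auto
  ultimately have "open ?U" by simp
  then have "openin (toric_topology Fan) ?W" by (rule openin_chart_map_vimage[OF b])
  moreover have "?W \<subseteq> C_set Fan (vcone {w})"
  proof
    fix x assume x: "x \<in> ?W"
    then obtain z where z: "x = pt w b z" using affine_open_iff[OF b] by blast
    then have "\<forall>j. cmod (z $ j) \<le> 1" using x by (auto simp: chart_map_pt[OF b] less_imp_le)
    then show "x \<in> C_set Fan (vcone {w})" using pt_in_own_C_set_iff[OF b] z by blast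
  qed
  ultimately have "?W \<subseteq> toric_topology Fan interior_of C_set Fan (vcone {w})" by (intro interior_of_maximal)
  moreover have "pt w b y \<in> ?W" using y affine_open_iff[OF b] chart_map_pt[OF b] by auto
  ultimately show ?thesis by blast
qed

lemma is_omega_infty_unique:
  assumes 1: "is_omega_infty P \<omega>" and 2: "is_omega_infty P \<omega>'"
  shows "\<omega> = \<omega>'"
proof -
  have cv: "continuous_volume_form Fan \<omega>" "continuous_volume_form Fan \<omega>'"
    using 1 2 by (auto simp: is_omega_infty_def Let_def)
  have und: "\<omega> c x = undefined \<and> \<omega>' c x = undefined" if "\<not> (c \<in> charts Fan \<and> x \<in> chart_dom Fan c)" for c x
  proof -
    have "restrict_form Fan (toric_variety Fan) \<omega> = \<omega>" "restrict_form Fan (toric_variety Fan) \<omega>' = \<omega>'"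
      using cv by (auto simp: continuous_volume_form_def top_form_def)
    then have "\<omega> c x = restrict_form Fan (toric_variety Fan) \<omega> c x" "\<omega>' c x = restrict_form Fan (toric_variety Fan) \<omega>' c x"
      by simp_all
    then show ?thesis using that unfolding restrict_form_def by auto
  qed
  have int: "\<omega> c x = \<omega>' c x" if w: "w \<in> verts" and x: "x \<in> toric_topology Fan interior_of C_set Fan (vcone {w})" for c x w
  proof (cases "c \<in> charts Fan \<and> x \<in> chart_dom Fan c")
    case True
    let ?W = "toric_topology Fan interior_of C_set Fan (vcone {w})"
    obtain b where b: "vchart w b" using vchart_exists[OF w] .
    have "(vcone {w}, b) \<in> charts Fan" using b charts_iff by blast
    then have "restrict_form Fan ?W \<omega> = restrict_form Fan ?W \<omega>'"
      using 1 2 unfolding is_omega_infty_def Let_def by fastforce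
    then have "restrict_form Fan ?W \<omega> c x = restrict_form Fan ?W \<omega>' c x" by simp
    then show ?thesis using True x by (simp add: restrict_form_def)
  qed (use und in simp)
  have "\<omega> c x = \<omega>' c x" for c x
  proof (cases "c \<in> charts Fan \<and> x \<in> chart_dom Fan c")
    case True
    then obtain v b y0 where c: "c = (vcone {v}, b)" "vchart v b" "x = pt v b y0" using chart_cases by blast
    obtain w where w: "w \<in> verts" "x \<in> C_set Fan (vcone {w})"
      using C_set_cover pt_in_toric_variety[OF c(2)] c(3) by blast
    obtain b' where b': "vchart w b'" using vchart_exists[OF w(1)] .
    obtain y where y: "x = pt w b' y" using C_set_subset_affine_open[OF w(1)] w(2) affine_open_iff[OF b'] by blast
    have le: "cmod (y $ j) \<le> 1" for j using w(2) pt_in_own_C_set_iff[OF b'] unfolding y by blast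
    let ?D = "{z. pt w b' z \<in> affine_open Fan (vcone {v})}"
    have D: "open ?D" using openin_affine_open[OF vchartD(1)[OF c(2)]] b' by (simp add: openin_toric_topology_iff)
    show ?thesis
    proof (rule ccontr)
      assume "\<omega> c x \<noteq> \<omega>' c x"
      then obtain \<xi> where ne: "\<omega> c x \<xi> \<noteq> \<omega>' c x \<xi>" by (auto simp: fun_eq_iff)
      let ?F = "\<lambda>z. \<omega> c (pt w b' z) \<xi> - \<omega>' c (pt w b' z) \<xi>"
      have "continuous_on ?D ?F"
        unfolding c(1) by (intro continuous_on_diff continuous_on_form[OF _ c(2) b'] cv)
      then have O: "open (?D \<inter> ?F -` (- {0}))" by (intro continuous_open_preimage D) auto
      have yO: "y \<in> ?D \<inter> ?F -` (- {0})" using ne True unfolding y c(1) chart_dom_vcone by simp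
      \<comment> \<open>Radial shrinking pushes a point of the closed polydisc into the open one;
        for \<open>t\<close> close to 1 it stays in the open set where the two forms are supposed to
        differ.\<close>
      have "((\<lambda>t. complex_of_real t *s y) \<longlongrightarrow> complex_of_real 1 *s y) (at_left 1)"
        unfolding vector_scalar_mult_def by (intro tendsto_intros)
      then have "eventually (\<lambda>t. complex_of_real t *s y \<in> ?D \<inter> ?F -` (- {0})) (at_left 1)"
        by (rule topological_tendstoD[OF _ O]) (use yO in simp)
      moreover have "eventually (\<lambda>t::real. t \<in> {0<..<1}) (at_left 1)" by (rule eventually_at_left_real) simp
      ultimately have "eventually (\<lambda>t. complex_of_real t *s y \<in> ?D \<inter> ?F -` (- {0}) \<and> t \<in> {0<..<1}) (at_left (1::real))"
        by (rule eventually_conj)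
      then obtain t where t: "complex_of_real t *s y \<in> ?D \<inter> ?F -` (- {0})" "t \<in> {0<..<1}"
        using eventually_happens'[OF trivial_limit_at_left_real] by blast
      have "cmod ((complex_of_real t *s y) $ j) < 1" for j
      proof -
        have "t * cmod (y $ j) \<le> t * 1" using le t by (intro mult_left_mono) auto
        then have "t * cmod (y $ j) < 1" using t(2) unfolding greaterThanLessThan_iff by linarith
        then show ?thesis using t by (simp add: norm_mult)
      qed
      then have "pt w b' (complex_of_real t *s y) \<in> toric_topology Fan interior_of C_set Fan (vcone {w})"
        by (intro interior_C_set[OF b']) blast
      then have "\<omega> c (pt w b' (complex_of_real t *s y)) = \<omega>' c (pt w b' (complex_of_real t *s y))"
        by (rule int[OF w(1)])
      then show False using t(1) by simp
    qed
  qed (use und in simp)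
  then show ?thesis by (simp add: fun_eq_iff)
qed

lemma ex1_omega_infty: "\<exists>!\<omega>. is_omega_infty P \<omega>"
  using is_omega_infty_canonical is_omega_infty_unique by blast

lemma omega_infty_canonical: "omega_infty P = canonical_form"
  unfolding omega_infty_def using is_omega_infty_canonical is_omega_infty_unique by (intro the_equality) auto

end

section \<open>Projective space\<close>

lemma lattice_basisI:
  assumes "\<And>m c. m = (\<Sum>k\<in>UNIV. c $ k *s b k) \<longleftrightarrow> c = F m"
  shows "lattice_basis b" "lcoord b m = F m"
proof -
  show lb: "lattice_basis b" unfolding lattice_basis_def assms by simp
  show "lcoord b m = F m" using lcoord_unique[OF lb] assms by blast
qed

text \<open>Numbers the vertices other than \<open>k\<close> by \<open>'n\<close>: at the vertex
  \<open>Some i\<close>, the index \<open>i\<close> is free and is given to the origin.\<close>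

definition other_vertex :: "'n option \<Rightarrow> 'n \<Rightarrow> 'n option" where
  "other_vertex k l = (case k of None \<Rightarrow> Some l | Some i \<Rightarrow> if l = i then None else Some l)"

definition simplex_basis :: "'n::finite option \<Rightarrow> 'n \<Rightarrow> int ^ 'n" where
  "simplex_basis k l = simplex_vertex (other_vertex k l) - simplex_vertex k"

lemma other_vertex_cases: "j = k \<or> (\<exists>l. j = other_vertex k l)"
  by (cases k; cases j) (auto simp: other_vertex_def)

lemma simplex_basis_None: "simplex_basis None l = axis l 1"
  by (simp add: simplex_basis_def other_vertex_def simplex_vertex_def)

lemma simplex_basis_Some: "simplex_basis (Some i) l $ j = (if l = j \<and> l \<noteq> i then 1 else 0) - (if j = i then 1 else 0)"
  by (auto simp: simplex_basis_def other_vertex_def simplex_vertex_def axis_def)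

lemma sum_simplex_basis_Some:
  "(\<Sum>l\<in>UNIV. c $ l *s simplex_basis (Some i) l) $ j = (if j = i then - (\<Sum>l\<in>UNIV. c $ l) else c $ j)"
proof (cases "j = i")
  case True
  then show ?thesis by (simp add: simplex_basis_Some sum_negf)
next
  case False
  have "c $ l * simplex_basis (Some i) l $ j = (if l = j then c $ j else 0)" for l
    using False by (simp add: simplex_basis_Some)
  then show ?thesis using False by simp
qed

text \<open>At \<open>Some i\<close> the coordinates of \<open>m\<close> are its entries, except
  that the \<open>i\<close>-th is replaced by minus the sum of all. This map is an involution, which
  explains why both directions use the same argument.\<close>

lemma lattice_basis_simplex_basis:
  fixes k :: "'n::finite option"
  shows "lattice_basis (simplex_basis k)"
proof (cases k)
  case None
  have "m = (\<Sum>l\<in>UNIV. c $ l *s simplex_basis None l) \<longleftrightarrow> c = m" for m c :: "int ^ 'n"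
    by (auto simp: simplex_basis_None basis_expansion)
  then show ?thesis unfolding None by (rule lattice_basisI(1))
next
  case (Some i)
  have "m = (\<Sum>l\<in>UNIV. c $ l *s simplex_basis (Some i) l)
      \<longleftrightarrow> c = (\<chi> l. if l = i then - (\<Sum>j\<in>UNIV. m $ j) else m $ l)" (is "?L \<longleftrightarrow> ?R") for m c :: "int ^ 'n"
  proof -
    have L: "?L \<longleftrightarrow> (\<forall>j. m $ j = (if j = i then - (\<Sum>l\<in>UNIV. c $ l) else c $ j))"
      by (simp only: vec_eq_iff sum_simplex_basis_Some)
    have split: "(\<Sum>j\<in>UNIV. x $ j) = x $ i + (\<Sum>j\<in>UNIV - {i}. x $ j)" for x :: "int ^ 'n"
      by (simp add: sum.remove[of UNIV i])
    have off: "(\<Sum>j\<in>UNIV - {i}. m $ j) = (\<Sum>j\<in>UNIV - {i}. c $ j)" if "\<forall>j. j \<noteq> i \<longrightarrow> m $ j = c $ j"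
      using that by (intro sum.cong) auto
    have "(\<forall>j. m $ j = (if j = i then - (\<Sum>l\<in>UNIV. c $ l) else c $ j))
        \<longleftrightarrow> (\<forall>l. c $ l = (if l = i then - (\<Sum>j\<in>UNIV. m $ j) else m $ l))"
    proof (intro iffI allI)
      fix l assume h: "\<forall>j. m $ j = (if j = i then - (\<Sum>l\<in>UNIV. c $ l) else c $ j)"
      then have "m $ i = - (\<Sum>l\<in>UNIV. c $ l)" "\<forall>j. j \<noteq> i \<longrightarrow> m $ j = c $ j" by simp_all
      then show "c $ l = (if l = i then - (\<Sum>j\<in>UNIV. m $ j) else m $ l)"
        using off split[of m] split[of c] by (cases "l = i") simp_all
    next
      fix j assume h: "\<forall>l. c $ l = (if l = i then - (\<Sum>j\<in>UNIV. m $ j) else m $ l)"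
      then have "c $ i = - (\<Sum>j\<in>UNIV. m $ j)" "\<forall>j. j \<noteq> i \<longrightarrow> m $ j = c $ j" by simp_all
      then show "m $ j = (if j = i then - (\<Sum>l\<in>UNIV. c $ l) else c $ j)"
        using off split[of m] split[of c] by (cases "j = i") simp_all
    qed
    moreover have "?R \<longleftrightarrow> (\<forall>l. c $ l = (if l = i then - (\<Sum>j\<in>UNIV. m $ j) else m $ l))"
      by (simp only: vec_eq_iff vec_lambda_beta)
    ultimately show ?thesis using L by (simp only:)
  qed
  then show ?thesis unfolding Some by (rule lattice_basisI(1))
qed

text \<open>Origin of the n + 1: the basis at vertex k sums the n other vertices and subtracts n
  times vertex k, that is, it gives the sum of all vertices minus n + 1 times vertex k. For
  \<open>None\<close> only the sum of all vertices remains.\<close>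

lemma sum_simplex_basis:
  fixes k :: "'n::finite option"
  shows "(\<Sum>l\<in>UNIV. simplex_basis k l) - (\<Sum>l\<in>UNIV. simplex_basis None l) = (- int (CARD('n) + 1)) *s simplex_vertex k"
proof (cases k)
  case None
  then show ?thesis by (simp add: simplex_vertex_def)
next
  case (Some i)
  have "(\<Sum>l\<in>UNIV. simplex_basis (Some i) l $ j) - (\<Sum>l\<in>UNIV. simplex_basis None l $ j) = (if j = i then - int (CARD('n) + 1) else 0)" for j
  proof -
    have "simplex_basis (Some i) l $ j - simplex_basis None l $ j
      = (if l = i then (if j = i then - 1 else 0) else 0) - (if j = i then 1 else 0)" for l
      by (auto simp: simplex_basis_Some simplex_basis_None axis_def)
    then show ?thesis by (simp add: sum_subtractf[symmetric]) (simp add: sum_subtractf)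
  qed
  then show ?thesis by (simp add: Some vec_eq_iff simplex_vertex_def axis_def)
qed

lemma emb_simplex_vertex: "emb ` range (simplex_vertex :: 'n::finite option \<Rightarrow> _) = insert 0 Basis"
proof -
  have "emb (simplex_vertex (None :: 'n option)) = 0" by (simp add: simplex_vertex_def emb_0)
  moreover have "emb (simplex_vertex (Some j)) = axis j 1" for j :: 'n
    by (simp add: simplex_vertex_def emb_def axis_def vec_eq_iff)
  moreover have "(Basis :: (real ^ 'n) set) = range (\<lambda>j. axis j 1)" by (auto simp: Basis_vec_def)
  ultimately show ?thesis by (simp add: UNIV_option_conv image_image)
qed

lemma std_simplex_hull: "(std_simplex :: (real ^ 'n::finite) set) = convex hull (insert 0 Basis)"
proof -
  have B: "(Basis :: (real ^ 'n) set) = range (\<lambda>j. axis j 1)" by (auto simp: Basis_vec_def)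
  have "inj (\<lambda>j::'n. axis j (1::real))" by (auto simp: inj_def axis_eq_axis)
  then have "{x::real ^ 'n. (\<forall>i\<in>Basis. 0 \<le> x \<bullet> i) \<and> sum (\<lambda>i. x \<bullet> i) Basis \<le> 1} = std_simplex"
    unfolding std_simplex_def B by (simp add: sum.reindex inner_axis)
  then show ?thesis by (simp only: Starlike.std_simplex)
qed

text \<open>The assumptions on the simplex come from the hypotheses of the theorem in the case
  \<open>P = std_simplex\<close>.\<close>

locale smooth_simplex = smooth_polytope "std_simplex :: (real ^ 'n::finite) set"
begin

lemma verts_simplex: "verts = range simplex_vertex"
proof -
  have "\<not> affine_dependent (insert 0 (Basis :: (real ^ 'n) set))"
    by (simp add: affine_dependent_iff_dependent independent_Basis)
  from extreme_point_of_convex_hull_affine_independent[OF this]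
  have "{x. x extreme_point_of convex hull (insert 0 (Basis :: (real ^ 'n) set))} = insert 0 Basis" by blast
  then have "emb ` verts = emb ` range simplex_vertex"
    unfolding emb_simplex_vertex std_simplex_hull[symmetric] by (rule trans[OF emb_verts])
  then show ?thesis by (rule inj_image_eq_iff[THEN iffD1, rotated]) (auto simp: inj_def emb_eq_iff)
qed

lemma vchart_simplex: "vchart (simplex_vertex k) (simplex_basis k)"
  unfolding vchart_def
proof (intro conjI lattice_basis_simplex_basis)
  show v: "simplex_vertex k \<in> verts" by (simp add: verts_simplex)
  show "cone_monoid (vcone {simplex_vertex k}) = {m. \<forall>l. 0 \<le> lcoord (simplex_basis k) m $ l}"
  proof (rule cone_monoid_dual_basis[OF lattice_basis_simplex_basis])
    fix u
    have "u \<in> vcone {simplex_vertex k} \<longleftrightarrow> (\<forall>j. 0 \<le> emb (simplex_vertex j - simplex_vertex k) \<bullet> u)"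
      using mem_vcone_iff[of "{simplex_vertex k}"] v by (auto simp: verts_simplex)
    also have "\<dots> \<longleftrightarrow> (\<forall>l. 0 \<le> emb (simplex_basis k l) \<bullet> u)"
      unfolding simplex_basis_def using other_vertex_cases[of _ k] by (metis diff_self emb_0 inner_zero_left order_refl)
    finally show "u \<in> vcone {simplex_vertex k} \<longleftrightarrow> (\<forall>l. 0 \<le> emb (simplex_basis k l) \<bullet> u)" .
  qed
qed

section \<open>Homogeneous coordinates and the comparison of forms\<close>

definition spt :: "'n option \<Rightarrow> complex ^ 'n \<Rightarrow> 'n toric_point" where
  "spt k y = pt (simplex_vertex k) (simplex_basis k) y"

definition homogeneous :: "'n option \<Rightarrow> complex ^ 'n \<Rightarrow> complex ^ ('n option)" where
  "homogeneous k y = (\<chi> j. monomial (simplex_basis k) y (simplex_vertex j - simplex_vertex k))"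

lemma spt_cases:
  assumes "x \<in> toric_variety Fan" obtains k y where "x = spt k y"
proof -
  obtain v b z where b: "vchart v b" and x: "x = pt v b z" using toric_variety_cases[OF assms] .
  obtain k where v: "v = simplex_vertex k" using vchartD(1)[OF b] verts_simplex by auto
  have "x \<in> affine_open Fan (vcone {v})" using affine_open_iff[OF b] x by blast
  then show thesis using affine_open_iff[OF vchart_simplex[of k]] that unfolding v spt_def by blast
qed

lemma spt_in_toric_variety: "spt k y \<in> toric_variety Fan"
  unfolding spt_def by (rule pt_in_toric_variety[OF vchart_simplex])

lemma homogeneous_self: "homogeneous k y $ k = 1"
  by (simp add: homogeneous_def monomial_0[OF lattice_basis_simplex_basis])

lemma homogeneous_other: "homogeneous k y $ other_vertex k l = y $ l"
  by (simp add: homogeneous_def simplex_basis_def[symmetric] monomial_basis[OF lattice_basis_simplex_basis])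

lemma homogeneous_inj: "homogeneous k y = homogeneous k y' \<Longrightarrow> y = y'"
  unfolding vec_eq_iff[of y] by (metis homogeneous_other)

lemma spt_in_affine_open_iff: "spt k y \<in> affine_open Fan (vcone {simplex_vertex j}) \<longleftrightarrow> homogeneous k y $ j \<noteq> 0"
  using pt_in_affine_open_iff[OF vchart_simplex, of "simplex_vertex j" k y]
  by (simp add: verts_simplex spt_def homogeneous_def)

text \<open>Dividing one vertex section by another trivialises both; the quotient is independent of
  the chart \<open>k\<close> used to write them.\<close>

lemma character_spt:
  assumes "homogeneous k y $ i \<noteq> 0"
  shows "character Fan (simplex_vertex j - simplex_vertex i) (spt k y) = homogeneous k y $ j / homogeneous k y $ i"
proof -
  let ?b = "simplex_basis k" and ?v = "simplex_vertex"
  have nz: "monomial ?b y (?v i - ?v k) \<noteq> 0" using assms by (simp add: homogeneous_def)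
  have V: "?v j \<in> verts" for j by (simp add: verts_simplex)
  have "?v j - ?v i \<in> vmonoid {?v i}" using diff_in_cone_monoid[of "?v i" "{?v i}" "?v j"] V by auto
  from character_pt'[OF vchart_simplex V nz this]
  have ch: "character Fan (?v j - ?v i) (spt k y) = monomial ?b y (?v j - ?v i)" by (simp add: spt_def)
  have "?v j - ?v i \<in> vmonoid {?v k, ?v i}" using diff_in_cone_monoid[of "?v i" "{?v k, ?v i}" "?v j"] V by auto
  then have "regular_exponent ?b y (?v j - ?v i)"
    using nz V by (intro regular_exponent_vmonoid[OF vchart_simplex, of k "{?v k, ?v i}"])
      (auto simp: monomial_0[OF lattice_basis_simplex_basis])
  then have "monomial ?b y (?v j - ?v k) = monomial ?b y (?v j - ?v i) * monomial ?b y (?v i - ?v k)"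
    using monomial_add[OF lattice_basis_simplex_basis, of k y "?v j - ?v i" "?v i - ?v k"]
      regular_exponent_uminus(1)[OF lattice_basis_simplex_basis nz] by simp
  then show ?thesis using nz ch by (simp add: homogeneous_def)
qed

text \<open>The vertex chosen in \<open>to_projective\<close> for the trivialisation only rescales
  the vector, so all choices give the same line.\<close>

lemma to_projective_spt: "to_projective (spt k y) = {a *s homogeneous k y | a. a \<noteq> 0}"
proof (intro set_eqI iffI)
  fix w assume "w \<in> to_projective (spt k y)"
  then obtain i a where a: "a \<noteq> 0" "spt k y \<in> affine_open Fan (vcone {simplex_vertex i})"
    "w = (\<chi> j. a * character Fan (simplex_vertex j - simplex_vertex i) (spt k y))"
    unfolding to_projective_def vcone_def by auto
  have nz: "homogeneous k y $ i \<noteq> 0" using a(2) spt_in_affine_open_iff by blast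
  have "w = (a / homogeneous k y $ i) *s homogeneous k y"
    unfolding a(3) by (simp add: vec_eq_iff character_spt[OF nz])
  moreover have "a / homogeneous k y $ i \<noteq> 0" using a(1) nz by simp
  ultimately show "w \<in> {a *s homogeneous k y | a. a \<noteq> 0}" by blast
next
  fix w assume "w \<in> {a *s homogeneous k y | a. a \<noteq> 0}"
  then obtain a where a: "a \<noteq> 0" "w = a *s homogeneous k y" by blast
  have nz: "homogeneous k y $ k \<noteq> 0" by (simp add: homogeneous_self)
  have "spt k y \<in> affine_open Fan (vcone {simplex_vertex k})" using nz spt_in_affine_open_iff by blast
  moreover have "w = (\<chi> j. a * character Fan (simplex_vertex j - simplex_vertex k) (spt k y))"
    by (simp add: vec_eq_iff character_spt[OF nz] a(2) homogeneous_self)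
  ultimately show "w \<in> to_projective (spt k y)"
    unfolding to_projective_def vcone_def using a(1) by auto
qed

lemma bij_to_projective: "bij_betw to_projective (toric_variety Fan) projective_space"
proof (rule bij_betw_imageI)
  show "inj_on to_projective (toric_variety Fan)"
  proof (rule inj_onI)
    fix x x' assume x: "x \<in> toric_variety Fan" "x' \<in> toric_variety Fan" and eq: "to_projective x = to_projective x'"
    obtain k y where 1: "x = spt k y" using spt_cases[OF x(1)] .
    obtain k' y' where 2: "x' = spt k' y'" using spt_cases[OF x(2)] .
    have h: "1 *s homogeneous k y \<in> to_projective x'"
      unfolding eq[symmetric] unfolding 1 to_projective_spt by (intro CollectI exI[of _ 1]) simp
    then obtain a where a: "1 *s homogeneous k y = a *s homogeneous k' y'"
      unfolding 2 to_projective_spt by blast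
    \<comment> \<open>Proportional to a vector with \<open>k\<close>-th entry 1, the second point
      also lies in the chart \<open>k\<close>; normalising that entry to 1 in both leaves no scaling
      freedom.\<close>
    from arg_cong[OF a, of "\<lambda>w. w $ k"] have "1 = a * homogeneous k' y' $ k" by (simp add: homogeneous_self)
    then have "homogeneous k' y' $ k \<noteq> 0" by auto
    then have "x' \<in> affine_open Fan (vcone {simplex_vertex k})" unfolding 2 spt_in_affine_open_iff .
    then obtain y'' where 3: "x' = spt k y''" using affine_open_iff[OF vchart_simplex] unfolding spt_def by blast
    obtain a where a: "1 *s homogeneous k y = a *s homogeneous k y''"
      using h unfolding 3 to_projective_spt by blast
    from arg_cong[OF a, of "\<lambda>w. w $ k"] have "a = 1" by (simp add: homogeneous_self)
    then have "homogeneous k y = homogeneous k y''" using a by simp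
    then show "x = x'" unfolding 1 3 using homogeneous_inj by blast
  qed
  show "to_projective ` toric_variety Fan = projective_space"
  proof (intro set_eqI iffI)
    fix L assume "L \<in> to_projective ` toric_variety Fan"
    then obtain x where x: "x \<in> toric_variety Fan" "L = to_projective x" by blast
    obtain k y where "x = spt k y" using spt_cases[OF x(1)] .
    then have L: "L = {a *s homogeneous k y | a. a \<noteq> 0}" using x(2) to_projective_spt by simp
    have "homogeneous k y \<noteq> 0" using homogeneous_self[of k y] by auto
    then show "L \<in> projective_space"
      unfolding L projective_space_def by (intro CollectI exI[of _ "homogeneous k y"]) simp
  next
    fix L :: "(complex ^ ('n option)) set" assume "L \<in> projective_space"
    then obtain w where w: "w \<noteq> 0" "L = {a *s w | a. a \<noteq> 0}" unfolding projective_space_def by blast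
    obtain k where k: "w $ k \<noteq> 0" using w(1) by (auto simp: vec_eq_iff)
    define y where "y = (\<chi> l. w $ other_vertex k l / w $ k)"
    have h: "homogeneous k y = (1 / w $ k) *s w"
    proof -
      have "homogeneous k y $ j = w $ j / w $ k" for j
        using other_vertex_cases[of j k] k by (auto simp: homogeneous_self homogeneous_other y_def)
      then show ?thesis by (simp add: vec_eq_iff)
    qed
    have "to_projective (spt k y) = L"
    proof (intro set_eqI iffI)
      fix u assume "u \<in> to_projective (spt k y)"
      then obtain a where a: "a \<noteq> 0" "u = (a / w $ k) *s w" unfolding to_projective_spt h by auto
      moreover have "a / w $ k \<noteq> 0" using a k by simp
      ultimately show "u \<in> L" unfolding w(2) by blast
    next
      fix u assume "u \<in> L"
      then obtain a where a: "a \<noteq> 0" "u = a *s w" unfolding w(2) by blast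
      then have "u = (a * w $ k) *s homogeneous k y" "a * w $ k \<noteq> 0" unfolding h using k by (auto simp: vec_eq_iff)
      then show "u \<in> to_projective (spt k y)" unfolding to_projective_spt by blast
    qed
    then show "L \<in> to_projective ` toric_variety Fan" using spt_in_toric_variety by blast
  qed
qed

lemma nonzero_x0_iff:
  assumes "x \<in> toric_variety Fan"
  shows "to_projective x \<in> nonzero_x0 \<longleftrightarrow> x \<in> affine_open Fan (vcone {simplex_vertex None})"
proof -
  obtain k y where x: "x = spt k y" using spt_cases[OF assms] .
  have "to_projective x \<in> projective_space" using bij_to_projective assms by (auto simp: bij_betw_def)
  moreover have "(\<forall>w\<in>to_projective x. w $ None \<noteq> 0) \<longleftrightarrow> homogeneous k y $ None \<noteq> 0"
  proof
    have "1 *s homogeneous k y \<in> to_projective x"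
      unfolding x to_projective_spt by (intro CollectI exI[of _ 1]) simp
    moreover assume "\<forall>w\<in>to_projective x. w $ None \<noteq> 0"
    ultimately have "(1 *s homogeneous k y) $ None \<noteq> 0" by blast
    then show "homogeneous k y $ None \<noteq> 0" by simp
  qed (auto simp: x to_projective_spt)
  ultimately show ?thesis unfolding nonzero_x0_def x spt_in_affine_open_iff by simp
qed

lemma affine_coords_spt: "affine_coords (to_projective (spt None z)) = z"
proof -
  let ?L = "to_projective (spt None z)"
  have "1 *s homogeneous None z \<in> ?L" unfolding to_projective_spt by (intro CollectI exI[of _ 1]) simp
  then have "(SOME w. w \<in> ?L) \<in> ?L" by (rule someI)
  then obtain a where a: "a \<noteq> 0" "(SOME w. w \<in> ?L) = a *s homogeneous None z" unfolding to_projective_spt by blast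
  have "homogeneous None z $ Some j = z $ j" for j
    using homogeneous_other[of None z j] by (simp add: other_vertex_def)
  then show ?thesis using a(1)
    unfolding affine_coords_def Let_def a(2) by (simp add: vec_eq_iff homogeneous_self)
qed

text \<open>Membership in the set of vertex \<open>k\<close> says that the \<open>k\<close>-th
  homogeneous coordinate is the largest in absolute value. The density is the squared absolute value
  of its power with exponent -(n + 1).\<close>

lemma form_density_simplex:
  "form_density (simplex_basis None) z (spt None z)
    = 1 / Max (insert 1 (range (\<lambda>j. cmod (z $ j)))) ^ (2 * (CARD('n) + 1))"
proof -
  let ?b = "simplex_basis (None :: 'n option)" and ?v = "simplex_vertex :: 'n option \<Rightarrow> _"
  note lb = lattice_basis_simplex_basis[of "None :: 'n option"]
  obtain w where w: "w \<in> verts" "spt None z \<in> C_set Fan (vcone {w})" using C_set_cover[OF spt_in_toric_variety] .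
  then obtain k where k: "w = ?v k" using verts_simplex by auto
  have C: "pt (?v None) ?b z \<in> C_set Fan (vcone {?v k})" using w(2) by (simp add: spt_def k)
  have hom: "homogeneous None z $ None = 1" "homogeneous None z $ Some j = z $ j" for j
    using homogeneous_self[of None z] homogeneous_other[of None z j] by (simp_all add: other_vertex_def)
  have le: "cmod (homogeneous None z $ j) \<le> cmod (homogeneous None z $ k)" for j
    using C pt_in_C_set_iff[OF vchart_simplex, of "?v k" None z] by (simp add: verts_simplex homogeneous_def)
  have "Max (insert 1 (range (\<lambda>j. cmod (z $ j)))) = cmod (homogeneous None z $ k)"
  proof (rule Max_eqI)
    show "y \<le> cmod (homogeneous None z $ k)" if "y \<in> insert 1 (range (\<lambda>j. cmod (z $ j)))" for y
      using that le[of None] le[of "Some _"] by (auto simp: hom)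
    show "cmod (homogeneous None z $ k) \<in> insert 1 (range (\<lambda>j. cmod (z $ j)))"
      by (cases k) (auto simp: hom)
  qed simp
  moreover have "homogeneous None z $ k = monomial ?b z (?v k)" by (simp add: homogeneous_def simplex_vertex_def)
  moreover have "form_density ?b z (spt None z) = (cmod (monomial ?b z (?v k)) powi (- int (CARD('n) + 1)))\<^sup>2"
    using density_eq[OF vchart_simplex vchart_simplex C]
    by (simp only: spt_def basis_diff_def sum_simplex_basis monomial_smult[OF lb] norm_power_int)
  moreover have "(M powi (- int n))\<^sup>2 = 1 / M ^ (2 * n)" for M :: real and n
    by (simp add: power_int_minus_divide power_divide power_mult[symmetric] mult.commute del: of_nat_Suc)
  ultimately show ?thesis by metis
qed

text \<open>On the open set of the origin, the affine coordinates are the chart of that vertex. The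
  Jacobian factor from an arbitrary chart cancels against the transition rule for the density,
  leaving the density in the affine chart.\<close>

lemma omega_infty_simplex:
  defines "W \<equiv> {x \<in> toric_variety Fan. to_projective x \<in> nonzero_x0}"
  shows "restrict_form Fan W (omega_infty std_simplex) = pullback_form Fan W (affine_coords \<circ> to_projective) projective_density"
proof -
  let ?b0 = "simplex_basis (None :: 'n option)" and ?v0 = "simplex_vertex (None :: 'n option)"
  have W: "W = affine_open Fan (vcone {?v0})"
    unfolding W_def using nonzero_x0_iff affine_open_subset by blast
  have "restrict_form Fan W canonical_form c x = pullback_form Fan W (affine_coords \<circ> to_projective) projective_density c x" for c x
  proof (cases "c \<in> charts Fan \<and> x \<in> W \<inter> chart_dom Fan c")
    case True
    obtain v b y where 1: "c = (vcone {v}, b)" "vchart v b" "x = pt v b y" using chart_cases True by blast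
    note b0 = vchart_simplex[of "None :: 'n option"]
    have nz: "monomial b y (?v0 - v) \<noteq> 0"
      using True pt_in_affine_open_iff[OF 1(2) vchartD(1)[OF b0]] unfolding 1 W by blast
    have ac: "(affine_coords \<circ> to_projective) (pt v b z) = chart_map Fan (vcone {?v0}, ?b0) (pt v b z)"
      if "monomial b z (?v0 - v) \<noteq> 0" for z
      unfolding pt_change_chart[OF 1(2) b0 that] chart_map_pt[OF b0]
      using affine_coords_spt by (simp add: spt_def)
    have "((affine_coords \<circ> to_projective) \<circ> chart_inv Fan c has_derivative (\<lambda>h. transition_jacobian b ?b0 y *v h)) (at y)"
      by (rule has_derivative_chart_transition[OF 1(2) b0 nz]) (use ac in \<open>simp add: 1(1) chart_inv_pt[OF 1(2)]\<close>)
    from frechet_derivative_at[OF this]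
    have fd: "frechet_derivative ((affine_coords \<circ> to_projective) \<circ> chart_inv Fan c) (at y) = (\<lambda>h. transition_jacobian b ?b0 y *v h)"
      by simp
    define z where "z = (\<chi> j. monomial b y (?b0 j))"
    have x: "x = spt None z" unfolding 1(3) spt_def z_def by (rule pt_change_chart[OF 1(2) b0 nz])
    have z: "(affine_coords \<circ> to_projective) x = z" unfolding x by (simp add: affine_coords_spt)
    have y: "chart_map Fan c x = y" unfolding 1 by (rule chart_map_pt[OF 1(2)])
    let ?M = "Max (insert 1 (range (\<lambda>j. cmod (z $ j)))) ^ (2 * (CARD('n) + 1))"
    have dens: "form_density b y x = (cmod (monomial b y (basis_diff b ?b0)))\<^sup>2 * (1 / ?M)"
      using density_transition[OF 1(2) b0 nz] form_density_simplex[of z] unfolding 1(3)[symmetric] z_def[symmetric] x[symmetric]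
      by simp
    have pd: "projective_density z \<zeta> = mu0 0 \<zeta> / of_real ?M" for \<zeta> by (simp add: projective_density_def mu0_def)
    have "canonical_form c x \<xi> = projective_density ((affine_coords \<circ> to_projective) x)
       (\<lambda>s. frechet_derivative ((affine_coords \<circ> to_projective) \<circ> chart_inv Fan c) (at (chart_map Fan c x)) (\<xi> s))" for \<xi>
    proof -
      have "canonical_form c x \<xi> = of_real (form_density b y x) * mu0 0 \<xi>"
        unfolding 1(1) 1(3) canonical_form_pt[OF 1(2)] ..
      then show ?thesis unfolding y fd z pd mu0_jacobian[OF 1(2) b0 nz] dens by simp
    qed
    then show ?thesis using True by (simp add: restrict_form_def pullback_form_def fun_eq_iff)
  next
    case False
    then show ?thesis unfolding restrict_form_def pullback_form_def by auto
  qed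
  then show ?thesis unfolding omega_infty_canonical by (simp add: fun_eq_iff)
qed

end

theorem mainTheorem3:
  fixes P :: "(real ^ 'n::finite) set"
  assumes "lattice_polytope P"
    and "absolutely_simple P"
    and "interior P \<noteq> {}"
  shows "(\<exists>!\<omega>. is_omega_infty P \<omega>) \<and>
    (P = std_simplex \<longrightarrow>
       bij_betw to_projective (toric_variety (normal_fan P)) projective_space \<and>
       (let W = {x \<in> toric_variety (normal_fan P). to_projective x \<in> nonzero_x0} in
          restrict_form (normal_fan P) W (omega_infty P) =
          pullback_form (normal_fan P) W (affine_coords \<circ> to_projective) projective_density))"
proof -
  have sp: "smooth_polytope P"
    using assms by unfold_locales auto
  show ?thesis
  proof (intro conjI impI)
    show "\<exists>!\<omega>. is_omega_infty P \<omega>" by (rule smooth_polytope.ex1_omega_infty[OF sp])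
    assume P: "P = std_simplex"
    then interpret smooth_simplex using sp by (simp add: smooth_simplex_def)
    show "bij_betw to_projective (toric_variety (normal_fan P)) projective_space"
      unfolding P by (rule bij_to_projective)
    show "let W = {x \<in> toric_variety (normal_fan P). to_projective x \<in> nonzero_x0} in
          restrict_form (normal_fan P) W (omega_infty P) =
          pullback_form (normal_fan P) W (affine_coords \<circ> to_projective) projective_density"
      unfolding P Let_def by (rule omega_infty_simplex)
  qed
qed

end
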